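(* Let $N\in\mathbb{N}$, $T>0$, let $a_2,a_{1,1},\dots,a_{1,N},a_0\in C([0,T];\mathbb{C})$ and consider $$P(t,D_x,D_t)=D_t-a_2(t)\Delta_x+\sum_{j=1}^N a_{1,j}(t)D_{x_j}+a_0(t)$$ and the Cauchy problem (CP): $Pu(t,x)=f(t,x)$, $u(0,x)=g(x)$, $t\in[0,T]$, $x\in\mathbb{T}^N$. Suppose that $\operatorname{Im}(a_2)(t)<0$ for every $t\in[0,T]$. Then: (i) Given $r\in\mathbb{R}$, $f\in C([0,T];H^r(\mathbb{T}^N))$ and $g\in H^r(\mathbb{T}^N)$, there exists a unique $u\in C([0,T];H^r(\mathbb{T}^N))\cap C^1([0,T];H^{r-2}(\mathbb{T}^N))$ which solves (CP). (ii) For every $f\in C([0,T];C^\infty(\mathbb{T}^N))$ and $g\in C^\infty(\mathbb{T}^N)$, there exists a unique $u\in C^1([0,T];C^\infty(\mathbb{T}^N))$ which solves (CP). (iii) Given $s\ge1$, $f\in C([0,T];G^s(\mathbb{T}^N))$ and $g\in G^s(\mathbb{T}^N)$, there exists a unique $u\in C^1([0,T];G^s(\mathbb{T}^N))$ which solves (CP).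
   Context: $\mathbb{T}^N=\mathbb{R}^N/2\pi\mathbb{Z}^N$, $D_t=\frac1i\partial_t$, $D_{x_j}=\frac1i\partial_{x_j}$, $\Delta_x=\sum_j\partial_{x_j}^2$. Spaces. For a distribution $u$ on $\mathbb{T}^N$ its Fourier coefficients are $\widehat u(\xi)=\langle u,e^{-ix\xi}\rangle$, $\xi\in\mathbb{Z}^N$, normalized so that $u=\sum_\xi\widehat u(\xi)e^{ix\xi}$. For $r\in\mathbb{R}$, $H^r(\mathbb{T}^N)$ is the set of distributions with $\|u\|_{H^r}^2=\sum_{\xi}|\widehat u(\xi)|^2(1+|\xi|)^{2r}<\infty$. $C^\infty(\mathbb{T}^N)=\bigcap_r H^r(\mathbb{T}^N)$ carries the projective limit topology. For $s\ge1$, $G^s(\mathbb{T}^N)$ is the set of $f\in C^\infty(\mathbb{T}^N)$ for which there are $C,h>0$ with $|D^\alpha f(x)|\le Ch^{|\alpha|}|\alpha|!^s$ for all multi-indices $\alpha$ and all $x$. With $\|f\|_{h,s}=\sup_\alpha \|D^\alpha f\|_\infty/(h^{|\alpha|}|\alpha|!^s)$ and $G^s_h(\mathbb{T}^N)=\{f:\|f\|_{h,s}<\infty\}$, $G^s(\mathbb{T}^N)$ carries the (locally convex) inductive limit topology of the Banach spaces $G^s_h(\mathbb{T}^N)$, $h\to\infty$. $C([0,T];X)$ and $C^1([0,T];X)$ denote the continuous, resp. continuously differentiable, maps $[0,T]\to X$. Solutions. $u\in C([0,T];H^\rho(\mathbb{T}^N))$ (some $\rho\in\mathbb{R}$) solves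 (CP) if $u(0)=g$ and $Pu=f$ holds with $D_tu$ understood as the weak derivative in $t$ on $(0,T)$: $\langle D_tu,\varphi\rangle=\int_0^T u(t)(-D_t\varphi(t))\,dt$ for $\varphi\in C_c^\infty((0,T))$. *)

theory Defs
  imports "HOL-Analysis.Analysis"
begin

subsection \<open>Smooth functions on the torus\<close>

text \<open>A function on the N-torus is a function on \<open>real ^ 'n\<close>, with \<open>N = CARD('n)\<close>, that is
  \<open>2\<pi>\<close>-periodic in each coordinate.\<close>

definition dir_deriv :: "'a::real_normed_vector \<Rightarrow> ('a \<Rightarrow> complex) \<Rightarrow> 'a \<Rightarrow> complex" where
  "dir_deriv v f x = frechet_derivative f (at x) v"

text \<open>Every iterated directional derivative is (Frechet) differentiable, hence continuous; in finite
  dimension this is the usual class of infinitely differentiable functions.\<close>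

definition smooth :: "('a::real_normed_vector \<Rightarrow> complex) \<Rightarrow> bool" where
  "smooth f \<longleftrightarrow> (\<forall>vs x. foldr dir_deriv vs f differentiable (at x))"

definition int_vec :: "int ^ 'n \<Rightarrow> real ^ 'n" where
  "int_vec k = (\<chi> j. real_of_int (k $ j))"

definition torus_fun :: "(real ^ 'n \<Rightarrow> complex) set" where
  "torus_fun = {\<phi>. smooth \<phi> \<and> (\<forall>x k. \<phi> (x + (2 * pi) *\<^sub>R int_vec k) = \<phi> x)}"

definition Dx :: "'n::finite \<Rightarrow> (real ^ 'n \<Rightarrow> complex) \<Rightarrow> real ^ 'n \<Rightarrow> complex" where
  "Dx j \<phi> x = (1 / \<i>) * dir_deriv (axis j 1) \<phi> x"

definition laplacian :: "(real ^ 'n::finite \<Rightarrow> complex) \<Rightarrow> real ^ 'n \<Rightarrow> complex" where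
  "laplacian \<phi> x = (\<Sum>j\<in>UNIV. dir_deriv (axis j 1) (dir_deriv (axis j 1) \<phi>) x)"

text \<open>Multi-indices are functions \<open>'n \<Rightarrow> nat\<close>. The index type carries no canonical order, so
  \<open>D\<^sup>\<alpha>\<close> is formed along an arbitrary list in which each \<open>j\<close> occurs \<open>\<alpha> j\<close> times; for smooth functions
  the choice is immaterial because mixed partial derivatives commute.\<close>

abbreviation mi_order :: "('n::finite \<Rightarrow> nat) \<Rightarrow> nat" where
  "mi_order \<alpha> \<equiv> (\<Sum>j\<in>UNIV. \<alpha> j)"

definition D_multi :: "('n::finite \<Rightarrow> nat) \<Rightarrow> (real ^ 'n \<Rightarrow> complex) \<Rightarrow> real ^ 'n \<Rightarrow> complex" where
  "D_multi \<alpha> \<phi> = foldr Dx (SOME js. \<forall>j. count_list js j = \<alpha> j) \<phi>"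


subsection \<open>Distributions on the torus\<close>

text \<open>A distribution is a continuous complex-linear functional on the smooth periodic functions. As
  HOL functions are total, it is normalized to be \<open>0\<close> on all other arguments, so that equality of
  distributions is equality in HOL. The vector space operations are pointwise.\<close>

type_synonym 'n distr = "(real ^ 'n \<Rightarrow> complex) \<Rightarrow> complex"

definition test_seminorm :: "nat \<Rightarrow> (real ^ 'n::finite \<Rightarrow> complex) \<Rightarrow> real" where
  "test_seminorm m \<phi> = Sup {cmod (D_multi \<alpha> \<phi> x) | \<alpha> x. mi_order \<alpha> \<le> m}"

definition distributions :: "'n::finite distr set" where
  "distributions = {u.
     (\<forall>\<phi>. \<phi> \<notin> torus_fun \<longrightarrow> u \<phi> = 0) \<and>
     (\<forall>\<phi>\<in>torus_fun. \<forall>\<psi>\<in>torus_fun. u (\<lambda>x. \<phi> x + \<psi> x) = u \<phi> + u \<psi>) \<and>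
     (\<forall>c. \<forall>\<phi>\<in>torus_fun. u (\<lambda>x. c * \<phi> x) = c * u \<phi>) \<and>
     (\<exists>C m. \<forall>\<phi>\<in>torus_fun. cmod (u \<phi>) \<le> C * test_seminorm m \<phi>)}"

text \<open>The factor \<open>(2\<pi>)\<^sup>-\<^sup>N\<close> is forced by the normalization \<open>u = \<Sum>\<^sub>\<xi> \<langle>u, e\<^sup>-\<^sup>i\<^sup>x\<^sup>\<xi>\<rangle> e\<^sup>i\<^sup>x\<^sup>\<xi>\<close>.\<close>

definition distr_of :: "(real ^ 'n::finite \<Rightarrow> complex) \<Rightarrow> 'n distr" where
  "distr_of \<phi> = (\<lambda>\<psi>. if \<psi> \<in> torus_fun
     then integral (cbox 0 (\<chi> j. 2 * pi)) (\<lambda>x. \<phi> x * \<psi> x) / (2 * pi) ^ CARD('n) else 0)"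

definition distr_Dx :: "'n::finite \<Rightarrow> 'n distr \<Rightarrow> 'n distr" where
  "distr_Dx j u = (\<lambda>\<psi>. if \<psi> \<in> torus_fun then - u (Dx j \<psi>) else 0)"

definition distr_laplacian :: "'n::finite distr \<Rightarrow> 'n distr" where
  "distr_laplacian u = (\<lambda>\<psi>. if \<psi> \<in> torus_fun then u (laplacian \<psi>) else 0)"

definition fourier_coeff :: "'n::finite distr \<Rightarrow> int ^ 'n \<Rightarrow> complex" where
  "fourier_coeff u \<xi> = u (\<lambda>x. exp (- \<i> * of_real (x \<bullet> int_vec \<xi>)))"


subsection \<open>The function spaces and their topologies\<close>

definition sobolev :: "real \<Rightarrow> 'n::finite distr set" where
  "sobolev r = {u \<in> distributions.
     (\<lambda>\<xi>. (cmod (fourier_coeff u \<xi>))\<^sup>2 * (1 + norm (int_vec \<xi>)) powr (2 * r)) summable_on UNIV}"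

definition sobolev_norm :: "real \<Rightarrow> 'n::finite distr \<Rightarrow> real" where
  "sobolev_norm r u =
     sqrt (\<Sum>\<^sub>\<infinity>\<xi>. (cmod (fourier_coeff u \<xi>))\<^sup>2 * (1 + norm (int_vec \<xi>)) powr (2 * r))"

definition sobolev_top :: "real \<Rightarrow> 'n::finite distr topology" where
  "sobolev_top r =
     Metric_space.mtopology (sobolev r) (\<lambda>u v. sobolev_norm r (\<lambda>\<phi>. u \<phi> - v \<phi>))"

definition Cinf :: "'n::finite distr set" where
  "Cinf = (\<Inter>r. sobolev r)"

text \<open>Projective limit: the coarsest topology for which all inclusions into the Sobolev spaces are
  continuous.\<close>

definition Cinf_top :: "'n::finite distr topology" where
  "Cinf_top = topology_generated_by {U \<inter> Cinf | r U. openin (sobolev_top r) U}"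

definition gevrey :: "real \<Rightarrow> 'n::finite distr set" where
  "gevrey s = {u \<in> Cinf. \<exists>\<phi>\<in>torus_fun. u = distr_of \<phi> \<and>
     (\<exists>C>0. \<exists>h>0. \<forall>\<alpha> x.
        cmod (D_multi \<alpha> \<phi> x) \<le> C * h ^ mi_order \<alpha> * fact (mi_order \<alpha>) powr s)}"

definition gevrey_quotients :: "real \<Rightarrow> real \<Rightarrow> (real ^ 'n::finite \<Rightarrow> complex) \<Rightarrow> real set" where
  "gevrey_quotients h s \<phi> =
     {cmod (D_multi \<alpha> \<phi> x) / (h ^ mi_order \<alpha> * fact (mi_order \<alpha>) powr s) | \<alpha> x. True}"

definition gevrey_norm :: "real \<Rightarrow> real \<Rightarrow> (real ^ 'n::finite \<Rightarrow> complex) \<Rightarrow> real" where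
  "gevrey_norm h s \<phi> = Sup (gevrey_quotients h s \<phi>)"

definition gevrey_step :: "real \<Rightarrow> real \<Rightarrow> (real ^ 'n::finite \<Rightarrow> complex) set" where
  "gevrey_step h s = {\<phi> \<in> torus_fun. bdd_above (gevrey_quotients h s \<phi>)}"

text \<open>The locally convex inductive limit topology is the one defined by all seminorms whose
  restriction to each step (a space with norm \<open>gevrey_norm h s\<close>) is continuous.\<close>

definition gevrey_seminorm :: "real \<Rightarrow> ('n::finite distr \<Rightarrow> real) \<Rightarrow> bool" where
  "gevrey_seminorm s p \<longleftrightarrow>
     (\<forall>u\<in>gevrey s. \<forall>v\<in>gevrey s. p (\<lambda>\<phi>. u \<phi> + v \<phi>) \<le> p u + p v) \<and>
     (\<forall>c. \<forall>u\<in>gevrey s. p (\<lambda>\<phi>. c * u \<phi>) = cmod c * p u) \<and>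
     (\<forall>h>0. \<exists>C. \<forall>\<phi>\<in>gevrey_step h s. p (distr_of \<phi>) \<le> C * gevrey_norm h s \<phi>)"

definition gevrey_top :: "real \<Rightarrow> 'n::finite distr topology" where
  "gevrey_top s = topology_generated_by
     {{v \<in> gevrey s. p (\<lambda>\<phi>. v \<phi> - u \<phi>) < e} | p u e. gevrey_seminorm s p \<and> u \<in> gevrey s \<and> e > 0}"


subsection \<open>Curves\<close>

text \<open>Maps on \<open>[0,T]\<close> are represented by functions that are \<open>undefined\<close> outside \<open>[0,T]\<close>, so that
  uniqueness can be expressed by equality in HOL.\<close>

definition C0_curves :: "real \<Rightarrow> 'n distr topology \<Rightarrow> (real \<Rightarrow> 'n distr) set" where
  "C0_curves T X = {u \<in> extensional {0..T}. continuous_map (top_of_set {0..T}) X u}"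

definition C1_curves :: "real \<Rightarrow> 'n distr topology \<Rightarrow> (real \<Rightarrow> 'n distr) set" where
  "C1_curves T X = {u \<in> C0_curves T X. \<exists>u'\<in>C0_curves T X. \<forall>t\<in>{0..T}.
     limitin X (\<lambda>\<tau>. (\<lambda>\<psi>. (u \<tau> \<psi> - u t \<psi>) / of_real (\<tau> - t))) (u' t) (at t within {0..T})}"


subsection \<open>The Cauchy problem\<close>

definition time_tests :: "real \<Rightarrow> (real \<Rightarrow> complex) set" where
  "time_tests T = {\<phi>. smooth \<phi> \<and> compact (closure {t. \<phi> t \<noteq> 0}) \<and>
     closure {t. \<phi> t \<noteq> 0} \<subseteq> {0<..<T}}"

text \<open>Weak integral of a distribution-valued function; for continuous curves in a Sobolev space it
  agrees with the vector-valued Riemann integral.\<close>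

definition distr_integral :: "real \<Rightarrow> (real \<Rightarrow> 'n distr) \<Rightarrow> 'n distr" where
  "distr_integral T w = (\<lambda>\<psi>. integral {0..T} (\<lambda>t. w t \<psi>))"

definition weak_Dt :: "real \<Rightarrow> (real \<Rightarrow> 'n distr) \<Rightarrow> (real \<Rightarrow> complex) \<Rightarrow> 'n distr" where
  "weak_Dt T u \<phi> =
     distr_integral T (\<lambda>t \<psi>. u t \<psi> * (- ((1 / \<i>) * vector_derivative \<phi> (at t))))"

definition spatial_part ::
  "(real \<Rightarrow> complex) \<Rightarrow> ('n::finite \<Rightarrow> real \<Rightarrow> complex) \<Rightarrow> (real \<Rightarrow> complex) \<Rightarrow>
   (real \<Rightarrow> 'n distr) \<Rightarrow> real \<Rightarrow> 'n distr" where
  "spatial_part a2 a1 a0 u t = (\<lambda>\<psi>.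
     - a2 t * distr_laplacian (u t) \<psi> + (\<Sum>j\<in>UNIV. a1 j t * distr_Dx j (u t) \<psi>) + a0 t * u t \<psi>)"

text \<open>The equation \<open>Pu = f\<close> is an identity of distribution-valued functionals on the time test
  functions, where a curve \<open>w\<close> acts by \<open>\<phi> \<mapsto> \<integral> w(t) \<phi>(t) dt\<close>.\<close>

definition solves_CP ::
  "real \<Rightarrow> (real \<Rightarrow> complex) \<Rightarrow> ('n::finite \<Rightarrow> real \<Rightarrow> complex) \<Rightarrow> (real \<Rightarrow> complex) \<Rightarrow>
   (real \<Rightarrow> 'n distr) \<Rightarrow> 'n distr \<Rightarrow> (real \<Rightarrow> 'n distr) \<Rightarrow> bool" where
  "solves_CP T a2 a1 a0 f g u \<longleftrightarrow>
     (\<exists>\<rho>. u \<in> C0_curves T (sobolev_top \<rho>)) \<and> u 0 = g \<and>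
     (\<forall>\<phi>\<in>time_tests T.
        (\<lambda>\<psi>. weak_Dt T u \<phi> \<psi> + distr_integral T (\<lambda>t \<psi>. spatial_part a2 a1 a0 u t \<psi> * \<phi> t) \<psi>)
        = distr_integral T (\<lambda>t \<psi>. f t \<psi> * \<phi> t))"

end

theory Submission
  imports Defs
begin

text \<open>On the Fourier side the problem decouples into the scalar linear equations
  \<open>u\<^sub>\<xi>' = p\<^sub>\<xi> u\<^sub>\<xi> + i f\<^sub>\<xi>\<close>, where \<open>p\<^sub>\<xi>\<close> has real part
  \<open>Im a\<^sub>2 |\<xi>|\<^sup>2 + O(|\<xi>|) + O(1)\<close>. As \<open>Im a\<^sub>2\<close> is negative on a compact interval, this real part is
  bounded above uniformly in \<open>\<xi>\<close>, so the propagators are uniformly bounded and \<open>u\<^sub>\<xi>\<close> decays like the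
  data, while a time derivative costs a factor \<open>|\<xi>|\<^sup>2\<close>. Sobolev, smooth and Gevrey regularity are all
  conditions on the decay of Fourier coefficients, and convergence in the respective topologies follows by
  dominated convergence of series. For the Gevrey classes one also needs that a continuous curve
  has a decay rate that is uniform in time, that is, regularity of the inductive limit. Uniqueness holds
  because, by the lemma of du Bois-Reymond, weak solutions satisfy the scalar equations classically.\<close>

subsection \<open>Rapidly converging Fourier series\<close>

text \<open>Distributions are bare functionals here, so much of the work is their dictionary with
  coefficient sequences. That coefficients determine a distribution rests on completeness of the
  exponentials, obtained by embedding the torus in a complex vector space and approximating by
  polynomials there. No smoothing effect of the equation is exploited: the sign condition only has
  to bound the propagators uniformly in the frequency, and the two orders lost by the time
  derivative are those of the symbol. One formula defines the solution in all three cases, and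
  uniqueness is proved once, among curves in Sobolev spaces of arbitrary order. The coefficients of
  a continuous curve in H^r need not have a square summable majorant, so the source is controlled
  through its time integral and Minkowski's inequality. In the Gevrey case, seminorms given by
  weights that grow more slowly than every exp(delta |xi|^(1/s)) extract decay from the topology,
  and in the other direction a common decay rate puts a family into one Banach step.\<close>

lemma dir_deriv_eq:
  assumes "(f has_derivative f') (at x)"
  shows "dir_deriv v f x = f' v"
  using frechet_derivative_at[OF assms] by (simp add: dir_deriv_def)

lemma dir_deriv_has_derivative:
  assumes "f differentiable (at x)"
  shows "(f has_derivative (\<lambda>v. dir_deriv v f x)) (at x)"
  using assms unfolding dir_deriv_def by (simp add: frechet_derivative_works)

text \<open>\<open>smooth\<close> speaks about derivatives along all finite lists of directions. A
  class of differentiable functions closed under \<open>dir_deriv\<close> survives all of them, so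
  smoothness follows from exhibiting such a class, without formulas for higher derivatives.\<close>

lemma smooth_coinduct:
  assumes "f \<in> S"
    and diff: "\<And>f x. f \<in> S \<Longrightarrow> f differentiable (at x)"
    and step: "\<And>f v. f \<in> S \<Longrightarrow> dir_deriv v f \<in> S"
  shows "smooth f"
proof -
  have "foldr dir_deriv vs f \<in> S" for vs
    by (induction vs) (use assms(1) step in auto)
  then show ?thesis unfolding smooth_def using diff by blast
qed

lemma smooth_differentiable: "smooth f \<Longrightarrow> f differentiable (at x)"
  unfolding smooth_def by (drule spec[of _ "[]"]) simp

lemma smooth_dir_deriv: "smooth f \<Longrightarrow> smooth (dir_deriv v f)"
  unfolding smooth_def by (rule allI, drule spec[of _ "_ @ [v]"]) simp

lemma smooth_isCont: "smooth f \<Longrightarrow> isCont f x"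
  using smooth_differentiable differentiable_imp_continuous_within by blast

lemma smooth_continuous_on: "smooth f \<Longrightarrow> continuous_on S f"
  by (simp add: continuous_at_imp_continuous_on smooth_isCont)

lemma smooth_lincomb:
  assumes "smooth f" "smooth g"
  shows "smooth (\<lambda>x. a * f x + b * g x)"
proof (rule smooth_coinduct)
  show "(\<lambda>x. a * f x + b * g x) \<in> {\<lambda>x. a * f x + b * g x | a b f g. smooth f \<and> smooth g}"
    using assms by blast
next
  have der: "((\<lambda>x. a * f x + b * g x) has_derivative (\<lambda>v. a * dir_deriv v f x + b * dir_deriv v g x)) (at x)"
    if "smooth f" "smooth g" for a b f g x
    by (intro derivative_intros dir_deriv_has_derivative smooth_differentiable that)
  fix h assume "h \<in> {\<lambda>x. a * f x + b * g x | a b f g. smooth f \<and> smooth (g :: 'a \<Rightarrow> complex)}"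
  then obtain a b f g where h: "h = (\<lambda>x. a * f x + b * g x)" "smooth f" "smooth (g :: 'a \<Rightarrow> complex)"
    by blast
  show "h differentiable (at x)" for x
    unfolding h(1) using der[OF h(2,3)] by (auto simp: differentiable_def)
  have "dir_deriv v h = (\<lambda>x. a * dir_deriv v f x + b * dir_deriv v g x)" for v
    unfolding h(1) using dir_deriv_eq[OF der[OF h(2,3)]] by blast
  then show "dir_deriv v h \<in> {\<lambda>x. a * f x + b * g x | a b f g. smooth f \<and> smooth g}" for v
    using h smooth_dir_deriv by blast
qed

section \<open>Exponentials, rapidly decreasing sequences and termwise differentiation\<close>

definition japanese :: "int ^ 'n \<Rightarrow> real" where
  "japanese \<xi> = 1 + norm (int_vec \<xi>)"

lemma japanese_ge_1 [simp]: "1 \<le> japanese \<xi>"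
  by (simp add: japanese_def)

lemma japanese_pos [simp]: "0 < japanese \<xi>" "0 \<le> japanese \<xi>" "japanese \<xi> \<noteq> 0"
  using japanese_ge_1[of \<xi>] by linarith+

lemma int_vec_simps [simp]: "int_vec 0 = 0" "int_vec (- \<xi>) = - int_vec \<xi>" 
  "int_vec (\<xi> + \<eta>) = int_vec \<xi> + int_vec \<eta>" "int_vec (\<xi> - \<eta>) = int_vec \<xi> - int_vec \<eta>"
  "int_vec \<xi> $ j = real_of_int (\<xi> $ j)"
  by (auto simp: int_vec_def vec_eq_iff)

lemma japanese_uminus [simp]: "japanese (- \<xi>) = japanese \<xi>"
  by (simp add: japanese_def)

lemma norm_int_vec_le: "norm (int_vec \<xi>) \<le> japanese \<xi>"
  by (simp add: japanese_def)

lemma component_le_japanese: "\<bar>real_of_int (\<xi> $ j)\<bar> \<le> japanese \<xi>"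
  using component_le_norm_cart[of "int_vec \<xi>" j] norm_int_vec_le[of \<xi>] by simp

definition cexp :: "int ^ 'n::finite \<Rightarrow> real ^ 'n \<Rightarrow> complex" where
  "cexp \<xi> x = cis (x \<bullet> int_vec \<xi>)"

lemma norm_cexp [simp]: "cmod (cexp \<xi> x) = 1"
  by (simp add: cexp_def)

lemma cexp_mult: "cexp \<xi> x * cexp \<eta> x = cexp (\<xi> + \<eta>) x"
  by (simp add: cexp_def cis_mult inner_add_right)

lemma cexp_0 [simp]: "cexp 0 x = 1"
  by (simp add: cexp_def)

lemma cexp_add: "cexp \<xi> (x + y) = cexp \<xi> x * cexp \<xi> y"
  by (simp add: cexp_def cis_mult inner_add_left)

lemma cexp_periodic: "cexp \<xi> (x + (2 * pi) *\<^sub>R int_vec k) = cexp \<xi> x"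
proof -
  have "(2 * pi) *\<^sub>R int_vec k \<bullet> int_vec \<xi> = 2 * pi * of_int (\<Sum>i\<in>UNIV. k $ i * \<xi> $ i)"
    by (simp add: inner_vec_def sum_distrib_left mult.assoc)
  then have "cis ((2 * pi) *\<^sub>R int_vec k \<bullet> int_vec \<xi>) = 1"
    by (metis cis_multiple_2pi Ints_of_int)
  then show ?thesis
    unfolding cexp_add by (simp add: cexp_def)
qed

lemma fourier_coeff_eq: "fourier_coeff u \<xi> = u (cexp (- \<xi>))"
proof -
  have "(\<lambda>x. exp (- \<i> * complex_of_real (x \<bullet> int_vec \<xi>))) = cexp (- \<xi>)"
    by (auto simp: cexp_def cis_conv_exp)
  then show ?thesis by (simp add: fourier_coeff_def)
qed

text \<open>Decay is measured by weighted absolute summability instead of suprema, so that a series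
  and all its formal derivatives converge absolutely straight from the definition.\<close>

definition rapid :: "(int ^ 'n \<Rightarrow> complex) \<Rightarrow> bool" where
  "rapid c \<longleftrightarrow> (\<forall>m. (\<lambda>\<xi>. cmod (c \<xi>) * japanese \<xi> ^ m) summable_on UNIV)"

definition fourier_series :: "(int ^ 'n::finite \<Rightarrow> complex) \<Rightarrow> real ^ 'n \<Rightarrow> complex" where
  "fourier_series c x = (\<Sum>\<^sub>\<infinity>\<xi>. c \<xi> * cexp \<xi> x)"

lemma summable_on_bound:
  fixes f :: "'a \<Rightarrow> 'b::banach" and g :: "'a \<Rightarrow> real"
  assumes "g summable_on A" "\<And>x. x \<in> A \<Longrightarrow> norm (f x) \<le> g x"
  shows "f summable_on A"
proof (rule abs_summable_summable, rule summable_on_comparison_test[OF assms(1)])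
  show "norm (f x) \<le> g x" if "x \<in> A" for x using assms(2)[OF that] .
qed auto

text \<open>Multipliers of polynomial growth cover both differentiation, which acts on coefficients
  in this way, and the pairing with the coefficients of a distribution.\<close>

lemma rapid_mult:
  assumes "rapid c" "\<And>\<xi>. cmod (p \<xi>) \<le> K * japanese \<xi> ^ k"
  shows "rapid (\<lambda>\<xi>. c \<xi> * p \<xi>)"
  unfolding rapid_def
proof
  fix m
  have "(\<lambda>\<xi>. K * (cmod (c \<xi>) * japanese \<xi> ^ (k + m))) summable_on UNIV"
    using assms(1) unfolding rapid_def by (intro summable_on_cmult_right) blast
  then show "(\<lambda>\<xi>. cmod (c \<xi> * p \<xi>) * japanese \<xi> ^ m) summable_on UNIV"
  proof (rule summable_on_bound)
    fix \<xi> :: "int ^ 'a"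
    have "cmod (c \<xi>) * cmod (p \<xi>) * japanese \<xi> ^ m \<le> cmod (c \<xi>) * (K * japanese \<xi> ^ k) * japanese \<xi> ^ m"
      using assms(2)[of \<xi>] by (intro mult_right_mono mult_left_mono) auto
    then show "norm (cmod (c \<xi> * p \<xi>) * japanese \<xi> ^ m) \<le> K * (cmod (c \<xi>) * japanese \<xi> ^ (k + m))"
      by (simp add: norm_mult power_add algebra_simps)
  qed
qed

lemma rapid_abs_summable: "rapid c \<Longrightarrow> (\<lambda>\<xi>. cmod (c \<xi>)) summable_on UNIV"
  unfolding rapid_def by (metis (no_types, lifting) ext mult.right_neutral power_0)

lemma rapid_mult_bounded: 
  assumes "rapid c" "\<And>\<xi>. cmod (p \<xi>) \<le> K" shows "rapid (\<lambda>\<xi>. c \<xi> * p \<xi>)"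
  using rapid_mult[OF assms(1), of p K 0] assms(2) by simp

lemma rapid_inner: "rapid c \<Longrightarrow> rapid (\<lambda>\<xi>. c \<xi> * (\<i> * of_real (v \<bullet> int_vec \<xi>)))"
proof (rule rapid_mult[where K = "norm v" and k = 1])
  fix \<xi>
  show "cmod (\<i> * complex_of_real (v \<bullet> int_vec \<xi>)) \<le> norm v * japanese \<xi> ^ 1"
    using Cauchy_Schwarz_ineq2[of v "int_vec \<xi>"] mult_left_mono[OF norm_int_vec_le[of \<xi>], of "norm v"]
    by (simp add: norm_mult)
qed auto

lemma rapid_component: "rapid c \<Longrightarrow> rapid (\<lambda>\<xi>. c \<xi> * of_int (\<xi> $ j))"
  by (rule rapid_mult[where K = 1 and k = 1]) (use component_le_japanese[of _ j] in auto)

lemma fourier_series_summable: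
  assumes "(\<lambda>\<xi>. cmod (c \<xi>)) summable_on UNIV"
  shows "(\<lambda>\<xi>. c \<xi> * cexp \<xi> x) summable_on UNIV"
  by (rule summable_on_bound[OF assms]) (simp add: norm_mult)

lemma norm_infsum_le_infsum:
  fixes f :: "'a \<Rightarrow> 'b::banach" and g :: "'a \<Rightarrow> real"
  assumes "g summable_on A" "\<And>x. x \<in> A \<Longrightarrow> norm (f x) \<le> g x"
  shows "norm (infsum f A) \<le> infsum g A"
  using norm_infsum_le[OF has_sum_infsum[OF summable_on_bound[OF assms]] has_sum_infsum[OF assms(1)]] assms(2)
  by auto

lemma norm_fourier_series_le:
  assumes "(\<lambda>\<xi>. cmod (c \<xi>)) summable_on UNIV"
  shows "cmod (fourier_series c x) \<le> (\<Sum>\<^sub>\<infinity>\<xi>. cmod (c \<xi>))"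
  unfolding fourier_series_def by (rule norm_infsum_le_infsum[OF assms]) (simp add: norm_mult)

text \<open>The exponential of the real part that occurs in Taylor's bound for \<open>exp\<close> is
  1 on the imaginary axis, so the remainder is quadratic for all real a, not only for small
  ones.\<close>

lemma norm_cis_taylor: "cmod (cis a - 1 - \<i> * of_real a) \<le> a\<^sup>2"
  using Taylor_exp[of "\<i> * of_real a" 1] by (simp add: cis_conv_exp norm_mult power2_eq_square diff_diff_eq add.commute)

text \<open>The Taylor remainder of the term at xi is at most cmod (c xi) |y - x|^2 (1 + |xi|)^2.
  Rapid decay makes this summable over xi, so the total remainder is O(|y - x|^2).\<close>

lemma fourier_series_has_derivative:
  assumes c: "rapid c"
  shows "(fourier_series c has_derivative
    (\<lambda>v. fourier_series (\<lambda>\<xi>. c \<xi> * (\<i> * of_real (v \<bullet> int_vec \<xi>))) x)) (at x)"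
proof -
  let ?L = "\<lambda>v. fourier_series (\<lambda>\<xi>. c \<xi> * (\<i> * of_real (v \<bullet> int_vec \<xi>))) x"
  define M where "M = (\<Sum>\<^sub>\<infinity>\<xi>. cmod (c \<xi>) * japanese \<xi> ^ 1)"
  define M2 where "M2 = (\<Sum>\<^sub>\<infinity>\<xi>. cmod (c \<xi>) * japanese \<xi> ^ 2)"
  have s1: "(\<lambda>\<xi>. cmod (c \<xi>) * japanese \<xi> ^ m) summable_on UNIV" for m
    using c by (auto simp: rapid_def)
  have sL: "(\<lambda>\<xi>. c \<xi> * (\<i> * of_real (v \<bullet> int_vec \<xi>)) * cexp \<xi> x) summable_on UNIV" for v
    by (rule fourier_series_summable[OF rapid_abs_summable[OF rapid_inner[OF c]]])
  have sF: "(\<lambda>\<xi>. c \<xi> * cexp \<xi> x) summable_on UNIV" for x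
    by (rule fourier_series_summable[OF rapid_abs_summable[OF c]])
  have inn: "\<bar>v \<bullet> int_vec \<xi>\<bar> \<le> norm v * japanese \<xi>" for v and \<xi> :: "int ^ 'a"
    using Cauchy_Schwarz_ineq2[of v "int_vec \<xi>"] mult_left_mono[OF norm_int_vec_le[of \<xi>], of "norm v"] by simp
  have lin: "bounded_linear ?L"
  proof (rule bounded_linear_intro)
    show "?L (v + w) = ?L v + ?L w" for v w
      unfolding fourier_series_def
      by (subst infsum_add[OF sL sL, symmetric]) (auto intro!: infsum_cong simp: algebra_simps inner_add_left)
    show "?L (r *\<^sub>R v) = r *\<^sub>R ?L v" for r v
      unfolding fourier_series_def
      by (subst infsum_scaleR_right[symmetric]) (auto intro!: infsum_cong simp: scaleR_conv_of_real[where 'a = complex])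
    show "norm (?L v) \<le> norm v * M" for v
      unfolding fourier_series_def M_def
    proof (subst infsum_cmult_right'[symmetric], rule norm_infsum_le_infsum)
      show "(\<lambda>\<xi>. norm v * (cmod (c \<xi>) * japanese \<xi> ^ 1)) summable_on UNIV"
        by (intro summable_on_cmult_right s1)
      show "cmod (c \<xi> * (\<i> * of_real (v \<bullet> int_vec \<xi>)) * cexp \<xi> x) \<le> norm v * (cmod (c \<xi>) * japanese \<xi> ^ 1)" for \<xi>
        using mult_left_mono[OF inn[of v \<xi>], of "cmod (c \<xi>)"] by (simp add: norm_mult algebra_simps)
    qed
  qed
  have rem: "cmod (fourier_series c y - fourier_series c x - ?L (y - x)) \<le> (norm (y - x))\<^sup>2 * M2" for y
  proof -
    have eq: "fourier_series c y - fourier_series c x - ?L (y - x) =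
       (\<Sum>\<^sub>\<infinity>\<xi>. c \<xi> * cexp \<xi> x * (cis ((y - x) \<bullet> int_vec \<xi>) - 1 - \<i> * of_real ((y - x) \<bullet> int_vec \<xi>)))"
    proof -
      have 1: "c \<xi> * cexp \<xi> x * (cis ((y - x) \<bullet> int_vec \<xi>) - 1 - \<i> * of_real ((y - x) \<bullet> int_vec \<xi>))
         = c \<xi> * cexp \<xi> y + (- (c \<xi> * cexp \<xi> x) + - (c \<xi> * (\<i> * of_real ((y - x) \<bullet> int_vec \<xi>)) * cexp \<xi> x))" for \<xi>
      proof -
        have "cexp \<xi> y = cexp \<xi> x * cis ((y - x) \<bullet> int_vec \<xi>)"
          using cexp_add[of \<xi> x "y - x"] by (simp add: cexp_def)
        then show ?thesis by (simp add: algebra_simps)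
      qed
      have "((\<lambda>\<xi>. c \<xi> * cexp \<xi> x * (cis ((y - x) \<bullet> int_vec \<xi>) - 1 - \<i> * of_real ((y - x) \<bullet> int_vec \<xi>)))
        has_sum (fourier_series c y + (- fourier_series c x + - ?L (y - x)))) UNIV"
        unfolding 1 fourier_series_def by (intro has_sum_add has_sum_uminusI has_sum_infsum sF sL)
      then show ?thesis by (simp add: infsumI)
    qed
    show ?thesis unfolding eq M2_def
    proof (subst infsum_cmult_right'[symmetric], rule norm_infsum_le_infsum)
      show "(\<lambda>\<xi>. (norm (y - x))\<^sup>2 * (cmod (c \<xi>) * japanese \<xi> ^ 2)) summable_on UNIV"
        by (intro summable_on_cmult_right s1)
      fix \<xi> :: "int ^ 'a"
      have "cmod (cis ((y - x) \<bullet> int_vec \<xi>) - 1 - \<i> * of_real ((y - x) \<bullet> int_vec \<xi>)) \<le> ((y - x) \<bullet> int_vec \<xi>)\<^sup>2"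
        by (rule norm_cis_taylor)
      also have "\<dots> \<le> (norm (y - x) * japanese \<xi>)\<^sup>2"
        using inn[of "y - x" \<xi>] by (simp add: abs_le_square_iff[symmetric])
      finally have "cmod (c \<xi>) * cmod (cis ((y - x) \<bullet> int_vec \<xi>) - 1 - \<i> * of_real ((y - x) \<bullet> int_vec \<xi>))
         \<le> cmod (c \<xi>) * (norm (y - x) * japanese \<xi>)\<^sup>2"
        by (intro mult_left_mono) auto
      then show "cmod (c \<xi> * cexp \<xi> x * (cis ((y - x) \<bullet> int_vec \<xi>) - 1 - \<i> * of_real ((y - x) \<bullet> int_vec \<xi>)))
         \<le> (norm (y - x))\<^sup>2 * (cmod (c \<xi>) * japanese \<xi> ^ 2)"
        by (simp only: norm_mult norm_cexp power_mult_distrib mult_1_right mult_ac)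
    qed
  qed
  show ?thesis
  proof (rule has_derivativeI_sandwich[of 1])
    show "bounded_linear ?L" by (rule lin)
    show "((\<lambda>y. norm (y - x) * M2) \<longlongrightarrow> 0) (at x)"
      by (intro tendsto_eq_intros) auto
    show "norm (fourier_series c y - fourier_series c x - ?L (y - x)) / norm (y - x) \<le> norm (y - x) * M2"
      if "y \<noteq> x" for y
      using rem[of y] that by (simp add: divide_simps power2_eq_square algebra_simps)
  qed auto
qed

lemma dir_deriv_fourier_series:
  assumes "rapid c"
  shows "dir_deriv v (fourier_series c) = fourier_series (\<lambda>\<xi>. c \<xi> * (\<i> * of_real (v \<bullet> int_vec \<xi>)))"
  using dir_deriv_eq[OF fourier_series_has_derivative[OF assms]] by blast

lemma smooth_fourier_series:
  assumes "rapid c" shows "smooth (fourier_series c)"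
proof (rule smooth_coinduct)
  show "fourier_series c \<in> fourier_series ` Collect rapid" using assms by blast
next
  fix f :: "real ^ 'a \<Rightarrow> complex" and x v assume "f \<in> fourier_series ` Collect rapid"
  then obtain c where f: "f = fourier_series c" "rapid c" by blast
  show "f differentiable (at x)"
    unfolding f using fourier_series_has_derivative[OF f(2)] by (auto simp: differentiable_def)
  show "dir_deriv v f \<in> fourier_series ` Collect rapid"
    unfolding f dir_deriv_fourier_series[OF f(2)] using rapid_inner[OF f(2)] by blast
qed

lemma fourier_series_torus_fun: "rapid c \<Longrightarrow> fourier_series c \<in> torus_fun"
  unfolding torus_fun_def using smooth_fourier_series by (auto simp: fourier_series_def cexp_periodic)

lemma Dx_fourier_series:
  assumes "rapid c"
  shows "Dx j (fourier_series c) = fourier_series (\<lambda>\<xi>. c \<xi> * of_int (\<xi> $ j))"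
proof
  fix x
  have "Dx j (fourier_series c) x = (1 / \<i>) * fourier_series (\<lambda>\<xi>. c \<xi> * (\<i> * of_real (axis j 1 \<bullet> int_vec \<xi>))) x"
    by (simp add: Dx_def dir_deriv_fourier_series[OF assms])
  also have "\<dots> = fourier_series (\<lambda>\<xi>. c \<xi> * of_int (\<xi> $ j)) x"
    unfolding fourier_series_def
    by (subst infsum_cmult_right'[symmetric]) (auto intro!: infsum_cong simp: inner_axis' complex_eq_iff algebra_simps)
  finally show "Dx j (fourier_series c) x = fourier_series (\<lambda>\<xi>. c \<xi> * of_int (\<xi> $ j)) x" .
qed

lemma has_sum_sum:
  fixes f :: "'i \<Rightarrow> 'a \<Rightarrow> 'b::topological_comm_monoid_add"
  assumes "\<And>i. i \<in> I \<Longrightarrow> (f i has_sum S i) A"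
  shows "((\<lambda>x. \<Sum>i\<in>I. f i x) has_sum (\<Sum>i\<in>I. S i)) A"
  using assms by (induction I rule: infinite_finite_induct) (auto intro!: has_sum_add)

lemma norm_int_vec_squared: "(norm (int_vec \<xi>))\<^sup>2 = (\<Sum>j\<in>UNIV. real_of_int (\<xi> $ j) * real_of_int (\<xi> $ j))"
  by (simp add: power2_norm_eq_inner inner_vec_def)

lemma laplacian_fourier_series:
  assumes "rapid c"
  shows "laplacian (fourier_series c) = fourier_series (\<lambda>\<xi>. c \<xi> * of_real (- (norm (int_vec \<xi>))\<^sup>2))"
proof
  fix x
  have r: "rapid (\<lambda>\<xi>. c \<xi> * of_int (\<xi> $ j) * of_int (\<xi> $ j))" for j
    by (intro rapid_component assms)
  have "laplacian (fourier_series c) x =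
     (\<Sum>j\<in>UNIV. - fourier_series (\<lambda>\<xi>. c \<xi> * of_int (\<xi> $ j) * of_int (\<xi> $ j)) x)"
    unfolding laplacian_def dir_deriv_fourier_series[OF assms] dir_deriv_fourier_series[OF rapid_inner[OF assms]]
    by (intro sum.cong refl) (auto simp: fourier_series_def infsum_uminus[symmetric] inner_axis' complex_eq_iff algebra_simps intro!: infsum_cong)
  also have "\<dots> = (\<Sum>\<^sub>\<infinity>\<xi>. \<Sum>j\<in>UNIV. - (c \<xi> * of_int (\<xi> $ j) * of_int (\<xi> $ j) * cexp \<xi> x))"
    unfolding fourier_series_def infsum_uminus[symmetric]
    by (rule infsumI[symmetric], intro has_sum_sum has_sum_infsum summable_on_uminus[THEN iffD2] fourier_series_summable rapid_abs_summable r)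
  also have "\<dots> = fourier_series (\<lambda>\<xi>. c \<xi> * of_real (- (norm (int_vec \<xi>))\<^sup>2)) x"
    unfolding fourier_series_def
    by (intro infsum_cong) (simp add: norm_int_vec_squared sum_negf sum_distrib_left sum_distrib_right mult_ac)
  finally show "laplacian (fourier_series c) x = fourier_series (\<lambda>\<xi>. c \<xi> * of_real (- (norm (int_vec \<xi>))\<^sup>2)) x" .
qed

subsection \<open>Integration over the torus\<close>

abbreviation torus_box :: "(real ^ 'n::finite) set" where
  "torus_box \<equiv> cbox 0 (\<chi> j. 2 * pi)"

definition periodic :: "(real ^ 'n \<Rightarrow> 'b) \<Rightarrow> bool" where
  "periodic f \<longleftrightarrow> (\<forall>x k. f (x + (2 * pi) *\<^sub>R int_vec k) = f x)"

lemma periodic_axis: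
  fixes f :: "real ^ 'n::finite \<Rightarrow> 'b"
  assumes "periodic f"
  shows "f (x + (2 * pi) *\<^sub>R axis j 1) = f x" "f (x - (2 * pi) *\<^sub>R axis j 1) = f x"
proof -
  have 1: "int_vec (axis j 1) = axis j (1::real)"
    by (simp add: vec_eq_iff axis_def)
  show *: "f (x + (2 * pi) *\<^sub>R axis j 1) = f x" for x
    using assms unfolding periodic_def by (metis 1)
  show "f (x - (2 * pi) *\<^sub>R axis j 1) = f x"
    using *[of "x - (2 * pi) *\<^sub>R axis j 1"] by simp
qed

lemma has_integral_translate:
  fixes f :: "'a::euclidean_space \<Rightarrow> 'b::real_normed_vector"
  assumes "(f has_integral i) (cbox a b)"
  shows "((\<lambda>x. f (x + c)) has_integral i) (cbox (a - c) (b - c))"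
  using has_integral_affinity'[OF assms, of 1 c] by simp

text \<open>The hyperplane x_j = h cuts the period box in two. Translation moves the right piece to
  the left end of the box and, up to a full period, the left piece to the right end.\<close>

lemma integral_torus_translate:
  fixes f :: "real ^ 'n::finite \<Rightarrow> complex"
  assumes cont: "continuous_on UNIV f" and per: "periodic f" and h: "0 \<le> h" "h \<le> 2 * pi"
  shows "integral torus_box (\<lambda>x. f (x + h *\<^sub>R axis j 1)) = integral torus_box f"
proof -
  define L where "L = (\<lambda>c. cbox 0 (\<chi> i. if i = j then c else 2 * pi) :: (real ^ 'n) set)"
  define R where "R = (\<lambda>c. cbox (\<chi> i. if i = j then c else 0) (\<chi> i. 2 * pi) :: (real ^ 'n) set)"
  have int: "f integrable_on cbox a b" for a b
    by (intro integrable_continuous continuous_on_subset[OF cont]) auto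
  have L: "torus_box \<inter> {x. x \<bullet> axis j 1 \<le> c} = L c" if "0 \<le> c" "c \<le> 2 * pi" for c
    unfolding L_def using that by (auto simp: mem_box_cart inner_axis split: if_splits; smt (verit))
  have R: "torus_box \<inter> {x. x \<bullet> axis j 1 \<ge> c} = R c" if "0 \<le> c" "c \<le> 2 * pi" for c
    unfolding R_def using that by (auto simp: mem_box_cart inner_axis split: if_splits; smt (verit))
  have split: "(g has_integral i + k) torus_box"
    if "(g has_integral i) (L c)" "(g has_integral k) (R c)" "0 \<le> c" "c \<le> 2 * pi" for g :: "real ^ 'n \<Rightarrow> complex" and i k c
    by (rule has_integral_split[where k = "axis j 1" and c = c]) (use that L R in \<open>auto simp: axis_in_Basis_iff\<close>)
  define IL where "IL = integral (L h) f"
  define IR where "IR = integral (R h) f"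
  have f: "(f has_integral IL) (L h)" "(f has_integral IR) (R h)"
    unfolding IL_def IR_def by (auto simp: L_def R_def intro!: integrable_integral int)
  have 1: "(f has_integral IL + IR) torus_box"
    by (rule split[OF f h])
  have "((\<lambda>x. f (x + h *\<^sub>R axis j 1)) has_integral IR) (L (2 * pi - h))"
    using has_integral_translate[OF f(2)[unfolded R_def], of "h *\<^sub>R axis j 1"] unfolding L_def
    by (rule back_subst[where P = "\<lambda>S. (_ has_integral _) S"]) (rule arg_cong2[where f = cbox]; auto simp: vec_eq_iff axis_def)
  \<comment> \<open>With the shift h alone the left piece would leave the box. The shift h - 2 pi
    places it at [2 pi - h, 2 pi] in the j-th coordinate, and periodicity removes the extra period
    from the argument of f.\<close>
  moreover have "((\<lambda>x. f (x + (h *\<^sub>R axis j 1 - (2 * pi) *\<^sub>R axis j 1))) has_integral IL) (R (2 * pi - h))"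
    using has_integral_translate[OF f(1)[unfolded L_def], of "h *\<^sub>R axis j 1 - (2 * pi) *\<^sub>R axis j 1"] unfolding R_def
    by (rule back_subst[where P = "\<lambda>S. (_ has_integral _) S"]) (rule arg_cong2[where f = cbox]; auto simp: vec_eq_iff axis_def)
  then have "((\<lambda>x. f (x + h *\<^sub>R axis j 1)) has_integral IL) (R (2 * pi - h))"
    by (simp only: add_diff_eq periodic_axis(2)[OF per])
  ultimately have "((\<lambda>x. f (x + h *\<^sub>R axis j 1)) has_integral IR + IL) torus_box"
    using h by (intro split[where c = "2 * pi - h"]) auto
  with 1 show ?thesis
    by (simp add: integral_unique add.commute)
qed

text \<open>No boundary terms arise: the integral of f(x + h e_j) over the box is constant in h by
  periodicity, and differentiating it under the integral sign at h = 0 gives the integral of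
  f'.\<close>

lemma integral_torus_deriv:
  fixes f f' :: "real ^ 'n::finite \<Rightarrow> complex"
  assumes per: "periodic f" and cont': "continuous_on UNIV f'"
    and der: "\<And>x. \<exists>F. (f has_derivative F) (at x) \<and> F (axis j 1) = f' x"
  shows "integral torus_box f' = 0"
proof -
  have cont: "continuous_on UNIV f"
    using der by (meson continuous_at_imp_continuous_on has_derivative_continuous)
  have "((\<lambda>h. integral torus_box (\<lambda>x. f (x + h *\<^sub>R axis j 1))) has_vector_derivative
      integral torus_box (\<lambda>x. f' (x + 0 *\<^sub>R axis j 1))) (at 0 within {0..1})"
  proof (rule leibniz_rule_vector_derivative)
    fix h x
    obtain F where F: "(f has_derivative F) (at (x + h *\<^sub>R axis j 1))" "F (axis j 1) = f' (x + h *\<^sub>R axis j 1)"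
      using der by blast
    have "((\<lambda>h. f (x + h *\<^sub>R axis j 1)) has_derivative (\<lambda>k. F (0 + k *\<^sub>R axis j 1))) (at h within {0..1})"
      by (rule has_derivative_compose[where f = "\<lambda>h. x + h *\<^sub>R axis j 1" and g = f, OF _ F(1)])
         (auto intro!: derivative_eq_intros)
    then show "((\<lambda>h. f (x + h *\<^sub>R axis j 1)) has_vector_derivative f' (x + h *\<^sub>R axis j 1)) (at h within {0..1})"
      unfolding has_vector_derivative_def using F(2) linear_scale[OF has_derivative_linear[OF F(1)]] by simp
  next
    show "(\<lambda>x. f (x + h *\<^sub>R axis j 1)) integrable_on torus_box" for h
      by (intro integrable_continuous continuous_on_compose2[OF cont]) (auto intro!: continuous_intros)
    show "continuous_on ({0..1} \<times> torus_box) (\<lambda>(h, x). f' (x + h *\<^sub>R axis j 1))"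
      unfolding split_beta by (intro continuous_on_compose2[OF cont']) (auto intro!: continuous_intros)
  qed auto
  moreover have "((\<lambda>h. integral torus_box (\<lambda>x. f (x + h *\<^sub>R axis j 1))) has_vector_derivative 0) (at 0 within {0..1})"
  proof (rule has_vector_derivative_transform[where f = "\<lambda>_. integral torus_box f"])
    show "integral torus_box (\<lambda>x. f (x + h *\<^sub>R axis j 1)) = integral torus_box f" if "h \<in> {0..1}" for h
      by (rule integral_torus_translate[OF cont per]) (use that pi_gt3 in auto)
  qed (auto intro: derivative_eq_intros)
  ultimately show ?thesis
    using vector_derivative_unique_within_closed_interval[of 0 "1::real" 0] by simp
qed

section \<open>Fourier coefficients of functions and orthogonality of the exponentials\<close>

definition fourier_transform :: "(real ^ 'n::finite \<Rightarrow> complex) \<Rightarrow> int ^ 'n \<Rightarrow> complex" where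
  "fourier_transform \<phi> \<xi> = integral torus_box (\<lambda>x. \<phi> x * cexp (- \<xi>) x) / (2 * pi) ^ CARD('n)"

lemma cexp_eq_fourier_series: "cexp \<xi> = fourier_series (\<lambda>\<eta>. if \<eta> = \<xi> then 1 else 0)"
proof
  fix x
  have "fourier_series (\<lambda>\<eta>. if \<eta> = \<xi> then 1 else 0) x = (\<Sum>\<^sub>\<infinity>\<eta>\<in>{\<xi>}. cexp \<eta> x)"
    unfolding fourier_series_def by (rule infsum_cong_neutral) auto
  then show "cexp \<xi> x = fourier_series (\<lambda>\<eta>. if \<eta> = \<xi> then 1 else 0) x" by simp
qed

lemma rapid_finite_support:
  assumes "finite {\<xi>. c \<xi> \<noteq> 0}" shows "rapid c"
  unfolding rapid_def
proof
  fix m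
  have "finite {x \<in> UNIV. cmod (c x) * japanese x ^ m \<noteq> 0}"
    by (rule finite_subset[OF _ assms]) auto
  then show "(\<lambda>\<xi>. cmod (c \<xi>) * japanese \<xi> ^ m) summable_on UNIV"
    by (rule finite_nonzero_values_imp_summable_on)
qed

lemma rapid_single: "rapid (\<lambda>\<eta>. if \<eta> = \<xi> then z else 0)"
  by (rule rapid_finite_support) auto

lemma cexp_torus_fun [simp]: "cexp \<xi> \<in> torus_fun"
  unfolding cexp_eq_fourier_series by (rule fourier_series_torus_fun[OF rapid_single])

lemma torus_fun_smooth: "\<phi> \<in> torus_fun \<Longrightarrow> smooth \<phi>"
  and torus_fun_periodic: "\<phi> \<in> torus_fun \<Longrightarrow> periodic \<phi>"
  by (auto simp: torus_fun_def periodic_def)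

lemma torus_fun_continuous_on: "\<phi> \<in> torus_fun \<Longrightarrow> continuous_on S \<phi>"
  by (simp add: smooth_continuous_on torus_fun_smooth)

lemma cexp_continuous_on [continuous_intros]: 
  "continuous_on S f \<Longrightarrow> continuous_on S (\<lambda>x. cexp \<xi> (f x))"
  by (rule continuous_on_compose2[OF torus_fun_continuous_on[OF cexp_torus_fun]]) auto

lemma cexp_has_derivative: "(cexp \<xi> has_derivative (\<lambda>v. \<i> * of_real (v \<bullet> int_vec \<xi>) * cexp \<xi> x)) (at x)"
proof -
  have "fourier_series (\<lambda>\<eta>. (if \<eta> = \<xi> then 1 else 0) * (\<i> * of_real (v \<bullet> int_vec \<eta>))) x
      = \<i> * of_real (v \<bullet> int_vec \<xi>) * cexp \<xi> x" for v
  proof -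
    have "fourier_series (\<lambda>\<eta>. (if \<eta> = \<xi> then 1 else 0) * (\<i> * of_real (v \<bullet> int_vec \<eta>))) x
       = (\<Sum>\<^sub>\<infinity>\<eta>\<in>{\<xi>}. \<i> * of_real (v \<bullet> int_vec \<eta>) * cexp \<eta> x)"
      unfolding fourier_series_def by (rule infsum_cong_neutral) auto
    then show ?thesis by simp
  qed
  then show ?thesis
    using fourier_series_has_derivative[OF rapid_single, of \<xi> 1 x] by (simp add: cexp_eq_fourier_series[symmetric])
qed

text \<open>For nonzero xi some component xi_j is nonzero, and \<open>cexp \<xi>\<close> is then a
  constant multiple of the j-th derivative of a periodic function, namely of itself.\<close>

lemma integral_cexp: "integral torus_box (cexp \<xi>) = (if \<xi> = 0 then (2 * pi) ^ CARD('n) else 0)"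
  for \<xi> :: "int ^ 'n::finite"
proof (cases "\<xi> = 0")
  case True
  have "measure lborel (torus_box :: (real ^ 'n) set) = (2 * pi) ^ CARD('n)"
    by (subst content_cbox_cart) (auto simp: interval_ne_empty_cart)
  then have "integral (torus_box :: (real ^ 'n) set) (\<lambda>x. 1 :: complex) = (2 * pi) ^ CARD('n)"
    by (simp add: scaleR_conv_of_real)
  with True show ?thesis by (simp add: cexp_0[abs_def])
next
  case False
  then obtain j where j: "\<xi> $ j \<noteq> 0" by (auto simp: vec_eq_iff)
  have "integral torus_box (\<lambda>x. \<i> * of_int (\<xi> $ j) * cexp \<xi> x) = 0"
  proof (rule integral_torus_deriv[of "cexp \<xi>"])
    show "periodic (cexp \<xi>)" by (simp add: periodic_def cexp_periodic)
    show "continuous_on UNIV (\<lambda>x. \<i> * of_int (\<xi> $ j) * cexp \<xi> x)" by (intro continuous_intros)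
    show "\<exists>F. (cexp \<xi> has_derivative F) (at x) \<and> F (axis j 1) = \<i> * of_int (\<xi> $ j) * cexp \<xi> x" for x
      by (rule exI[of _ "\<lambda>v. \<i> * of_real (v \<bullet> int_vec \<xi>) * cexp \<xi> x"]) (simp add: cexp_has_derivative inner_axis')
  qed
  with j False show ?thesis by simp
qed

lemma torus_integrable:
  fixes f :: "real ^ 'n::finite \<Rightarrow> complex"
  shows "continuous_on UNIV f \<Longrightarrow> f integrable_on torus_box"
  by (rule integrable_continuous, erule continuous_on_subset) simp

subsection \<open>Completeness of the exponentials\<close>

text \<open>The annihilator of the exponentials. It is stable under multiplication by exponentials,
  hence a module over the trigonometric polynomials; completeness means that its periodic members
  vanish.\<close>

definition orth :: "(real ^ 'n::finite \<Rightarrow> complex) set" where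
  "orth = {f. continuous_on UNIV f \<and> (\<forall>\<xi>. integral torus_box (\<lambda>x. f x * cexp \<xi> x) = 0)}"

lemma orth_cmult: "f \<in> orth \<Longrightarrow> (\<lambda>x. c * f x) \<in> orth"
  unfolding orth_def by (auto intro!: continuous_intros simp: mult.assoc)

lemma orth_add: "f \<in> orth \<Longrightarrow> g \<in> orth \<Longrightarrow> (\<lambda>x. f x + g x) \<in> orth"
  unfolding orth_def
  by (auto intro!: continuous_intros simp: distrib_right, subst integral_add) (auto intro!: continuous_intros torus_integrable)

lemma orth_sum: "(\<And>i. i \<in> I \<Longrightarrow> f i \<in> orth) \<Longrightarrow> (\<lambda>x. \<Sum>i\<in>I. f i x) \<in> orth"
proof (induction I rule: infinite_finite_induct)
  case (insert i I)
  then show ?case using orth_add[of "f i"] by simp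
qed (auto simp: orth_def)

lemma orth_cexp: "f \<in> orth \<Longrightarrow> (\<lambda>x. f x * cexp \<eta> x) \<in> orth"
  unfolding orth_def by (auto intro!: continuous_intros simp: mult.assoc cexp_mult)

text \<open>Turns the torus into a compact subset of a Euclidean space, where the polynomial form of
  Stone-Weierstrass applies; polynomials in these coordinates are trigonometric polynomials in
  x.\<close>

definition torus_embed :: "real ^ 'n \<Rightarrow> complex ^ 'n" where
  "torus_embed x = (\<chi> j. cis (x $ j))"

text \<open>Euler's formulas for Re u cos x_j + Im u sin x_j. The basis vectors of
  \<open>complex ^ 'n\<close> have the form \<open>axis j u\<close>, so all coordinates of the
  embedding are covered.\<close>

lemma inner_torus_embed:
  "complex_of_real (torus_embed x \<bullet> axis j u) =
     cnj u / 2 * cexp (axis j 1) x + u / 2 * cexp (- axis j 1) x"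
proof -
  have iv: "int_vec (axis j 1) = axis j (1::real)"
    by (simp add: vec_eq_iff axis_def)
  have "torus_embed x \<bullet> axis j u = Re u * cos (x $ j) + Im u * sin (x $ j)"
    by (simp add: torus_embed_def inner_axis inner_complex_def)
  moreover have "cexp (axis j 1) x = cis (x $ j)" "cexp (- axis j 1) x = cis (- (x $ j))"
    by (simp_all add: cexp_def iv inner_axis)
  ultimately show ?thesis
    by (simp add: complex_eq_iff field_simps)
qed

text \<open>The induction needs arbitrary \<open>f\<close>: in the product case f times p is again a
  member of \<open>orth\<close>, and the hypothesis for q is applied to it.\<close>

lemma orth_real_polynomial:
  assumes "real_polynomial_function p" "f \<in> orth"
  shows "(\<lambda>x. f x * of_real (p (torus_embed x))) \<in> orth"
  using assms
proof (induction arbitrary: f)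
  case (linear p)
  have "p z = (\<Sum>b\<in>Basis. (z \<bullet> b) * p b)" for z
  proof -
    interpret p: bounded_linear p by fact
    have "p z = p (\<Sum>b\<in>Basis. (z \<bullet> b) *\<^sub>R b)" by (simp add: euclidean_representation)
    then show ?thesis by (simp add: p.sum p.scaleR)
  qed
  note p_eq = this
  have eq: "(\<lambda>x. f x * of_real (p (torus_embed x))) =
      (\<lambda>x. \<Sum>b\<in>Basis. p b * (f x * of_real (torus_embed x \<bullet> b)))"
    by (simp only: p_eq[of "torus_embed _"] of_real_sum of_real_mult sum_distrib_left mult_ac)
  have "(\<lambda>x. p b * (f x * of_real (torus_embed x \<bullet> b))) \<in> orth" if b: "b \<in> Basis" for b
  proof -
    obtain j u where b: "b = axis j u" using b by (auto simp: Basis_vec_def)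
    have "(\<lambda>x. f x * of_real (torus_embed x \<bullet> b)) =
       (\<lambda>x. cnj u / 2 * (f x * cexp (axis j 1) x) + u / 2 * (f x * cexp (- axis j 1) x))"
      unfolding b inner_torus_embed by (simp add: algebra_simps)
    also have "\<dots> \<in> orth" by (intro orth_add orth_cmult orth_cexp linear)
    finally show ?thesis by (rule orth_cmult)
  qed
  then show ?case unfolding eq by (rule orth_sum)
next
  case (const c)
  then show ?case using orth_cmult[of f "of_real c"] by (simp add: mult.commute)
next
  case (add p q)
  then show ?case using orth_add[OF add.IH(1)[OF add.prems] add.IH(2)[OF add.prems]] by (simp add: algebra_simps)
next
  case (mult p q)
  then show ?case using mult.IH(2)[OF mult.IH(1)[OF mult.prems]] by (simp add: algebra_simps)
qed

text \<open>A section of \<open>torus_embed\<close> over its image, with values in [0, 2 pi)^N. It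
  jumps, but its composition with a continuous periodic function does not.\<close>

definition torus_chart :: "complex ^ 'n \<Rightarrow> real ^ 'n" where
  "torus_chart z = (\<chi> j. Arg2pi (z $ j))"

lemma periodic_chart:
  assumes "periodic f" shows "f (torus_chart (torus_embed x)) = f x"
proof -
  have "\<exists>n. torus_chart (torus_embed x) $ j = x $ j + 2 * pi * of_int n" for j
  proof -
    have "cis (x $ j) = exp (\<i> * of_real (Arg2pi (cis (x $ j))))"
      using Arg2pi_eq[of "cis (x $ j)"] by simp
    then have "cis (Arg2pi (cis (x $ j))) = cis (x $ j)" by (simp add: cis_conv_exp)
    then have "sin (Arg2pi (cis (x $ j))) = sin (x $ j) \<and> cos (Arg2pi (cis (x $ j))) = cos (x $ j)"
      by (simp add: complex_eq_iff)
    then obtain n :: int where "Arg2pi (cis (x $ j)) = x $ j + 2 * pi * of_int n"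
      unfolding sin_cos_eq_iff by blast
    then show ?thesis by (auto simp: torus_chart_def torus_embed_def)
  qed
  then obtain n where "\<And>j. torus_chart (torus_embed x) $ j = x $ j + 2 * pi * of_int (n j)" by metis
  then have "torus_chart (torus_embed x) = x + (2 * pi) *\<^sub>R int_vec (\<chi> j. n j)"
    by (simp add: vec_eq_iff)
  then show ?thesis using assms by (simp add: periodic_def)
qed

lemma torus_embed_continuous_on: "continuous_on S torus_embed"
  unfolding torus_embed_def by (intro continuous_intros)

text \<open>On the compact box \<open>torus_embed\<close> is a quotient map onto its image. So a set
  in the image is open as soon as its preimage in the box is, and by periodicity that preimage
  belongs to \<open>f\<close> itself.\<close>

lemma continuous_on_torus_chart:
  fixes f :: "real ^ 'n::finite \<Rightarrow> 'b::topological_space"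
  assumes cont: "continuous_on UNIV f" and per: "periodic f"
  shows "continuous_on (torus_embed ` torus_box) (\<lambda>z. f (torus_chart z))"
  unfolding continuous_openin_preimage_eq
proof (intro allI impI)
  fix U :: "'b set" assume U: "open U"
  let ?V = "torus_embed ` torus_box \<inter> (\<lambda>z. f (torus_chart z)) -` U"
  have "torus_box \<inter> torus_embed -` ?V = torus_box \<inter> f -` U"
    by auto (metis periodic_chart[OF per])+
  moreover have "openin (top_of_set torus_box) (torus_box \<inter> f -` U)"
    using continuous_on_subset[OF cont, of torus_box] U by (simp add: continuous_openin_preimage_eq)
  ultimately show "openin (top_of_set (torus_embed ` torus_box)) ?V"
    using Abstract_Topology_2.continuous_imp_quotient_map[OF torus_embed_continuous_on refl compact_cbox, of ?V 0 "\<chi> j. 2 * pi"] by simp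
qed

lemma torus_box_reduce:
  fixes f :: "real ^ 'n::finite \<Rightarrow> 'b"
  assumes "periodic f" 
  obtains y where "y \<in> torus_box" "f y = f x"
proof
  show "torus_chart (torus_embed x) \<in> torus_box"
    using Arg2pi by (auto simp: torus_chart_def mem_box_cart intro: less_imp_le)
  show "f (torus_chart (torus_embed x)) = f x" by (rule periodic_chart[OF assms])
qed

text \<open>With a trigonometric polynomial P close to the conjugate of f, the product f P
  integrates to 0, so the integral of |f|^2 equals that of f (conj f - P), which is small.\<close>

lemma orth_integral_norm_sq:
  assumes f: "f \<in> orth" and per: "periodic f"
  shows "integral torus_box (\<lambda>x. (cmod (f x))\<^sup>2) = 0"
proof -
  have cont: "continuous_on UNIV f" using f by (simp add: orth_def)
  have intgr: "g integrable_on torus_box" if "continuous_on UNIV g" for g :: "real ^ 'a \<Rightarrow> real"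
    by (rule integrable_continuous, rule continuous_on_subset[OF that]) simp
  define K where "K = integral torus_box (\<lambda>x. 2 * cmod (f x))"
  have small: "integral torus_box (\<lambda>x. (cmod (f x))\<^sup>2) \<le> e * K" if e: "e > 0" for e
  proof -
    let ?K = "torus_embed ` torus_box :: (complex ^ 'a) set"
    have comp: "compact ?K" by (intro compact_continuous_image torus_embed_continuous_on) simp
    have cc: "continuous_on ?K (\<lambda>z. f (torus_chart z))"
      by (rule continuous_on_torus_chart[OF cont per])
    obtain p q where p: "real_polynomial_function p" "\<And>z. z \<in> ?K \<Longrightarrow> \<bar>Re (f (torus_chart z)) - p z\<bar> < e"
      and q: "real_polynomial_function q" "\<And>z. z \<in> ?K \<Longrightarrow> \<bar>Im (f (torus_chart z)) - q z\<bar> < e"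
      using Stone_Weierstrass_real_polynomial_function[OF comp continuous_on_Re[OF cc] e]
        Stone_Weierstrass_real_polynomial_function[OF comp continuous_on_Im[OF cc] e] by metis
    \<comment> \<open>The minus sign makes P approximate the conjugate of f, since p and q
      approximate the real and the imaginary part of f.\<close>
    define P where "P = (\<lambda>x. of_real (p (torus_embed x)) - \<i> * of_real (q (torus_embed x)))"
    have "(\<lambda>x. f x * of_real (p (torus_embed x)) + (- \<i>) * (f x * of_real (q (torus_embed x)))) \<in> orth"
      by (intro orth_add orth_cmult orth_real_polynomial p q f)
    then have fP: "(\<lambda>x. f x * P x) \<in> orth" by (simp add: P_def algebra_simps)
    then have fP0: "integral torus_box (\<lambda>x. f x * P x) = 0" and cP: "continuous_on UNIV (\<lambda>x. f x * P x)"
      unfolding orth_def by (auto dest: spec[of _ 0])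
    have diff: "cmod (cnj (f x) - P x) \<le> 2 * e" if x: "x \<in> torus_box" for x
    proof -
      have "\<bar>Re (f x) - p (torus_embed x)\<bar> < e" "\<bar>Im (f x) - q (torus_embed x)\<bar> < e"
        using p(2)[of "torus_embed x"] q(2)[of "torus_embed x"] x by (auto simp: periodic_chart[OF per])
      then show ?thesis using cmod_le[of "cnj (f x) - P x"] by (simp add: P_def)
    qed
    have c1: "continuous_on UNIV (\<lambda>x. f x * cnj (f x))" by (intro continuous_intros cont)
    have "of_real (integral torus_box (\<lambda>x. (cmod (f x))\<^sup>2)) = integral torus_box (\<lambda>x. f x * cnj (f x))"
      using integral_linear[OF intgr bounded_linear_of_real[where 'a = complex], of "\<lambda>x. (cmod (f x))\<^sup>2"]
      by (simp add: complex_norm_square[symmetric] o_def continuous_intros cont)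
    also have "\<dots> = integral torus_box (\<lambda>x. f x * cnj (f x)) - integral torus_box (\<lambda>x. f x * P x)"
      by (simp add: fP0)
    also have "\<dots> = integral torus_box (\<lambda>x. f x * cnj (f x) - f x * P x)"
      by (rule integral_diff[symmetric]) (intro torus_integrable c1 cP)+
    also have "\<dots> = integral torus_box (\<lambda>x. f x * (cnj (f x) - P x))"
      by (simp add: algebra_simps)
    finally have "cmod (of_real (integral torus_box (\<lambda>x. (cmod (f x))\<^sup>2))) = cmod (integral torus_box (\<lambda>x. f x * (cnj (f x) - P x)))"
      by (rule arg_cong)
    then have "\<bar>integral torus_box (\<lambda>x. (cmod (f x))\<^sup>2)\<bar> = cmod (integral torus_box (\<lambda>x. f x * (cnj (f x) - P x)))"
      by (simp only: norm_of_real)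
    also have "\<dots> \<le> integral torus_box (\<lambda>x. e * (2 * cmod (f x)))"
    proof (rule integral_norm_bound_integral)
      show "(\<lambda>x. f x * (cnj (f x) - P x)) integrable_on torus_box"
        using torus_integrable[OF continuous_on_diff[OF c1 cP]] by (simp add: algebra_simps)
      show "(\<lambda>x. e * (2 * cmod (f x))) integrable_on torus_box"
        by (intro intgr continuous_intros cont)
      show "cmod (f x * (cnj (f x) - P x)) \<le> e * (2 * cmod (f x))" if "x \<in> torus_box" for x
        using mult_left_mono[OF diff[OF that], of "cmod (f x)"] by (simp add: norm_mult mult_ac)
    qed
    finally show ?thesis by (simp add: K_def)
  qed
  have "integral torus_box (\<lambda>x. (cmod (f x))\<^sup>2) \<le> 0"
  proof (rule ccontr)
    let ?I = "integral torus_box (\<lambda>x. (cmod (f x))\<^sup>2)"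
    assume "\<not> ?I \<le> 0"
    then have I: "?I > 0" by simp
    have K: "K \<ge> 0" unfolding K_def by (intro integral_nonneg intgr continuous_intros cont) auto
    \<comment> \<open>The choice e = I / (2 (K + 1)) makes e K smaller than I; the summand 1 avoids
      division by 0 when K = 0.\<close>
    have "?I \<le> ?I / (2 * (K + 1)) * K" by (rule small) (use I K in auto)
    also have "\<dots> = ?I * (K / (2 * (K + 1)))" by simp
    also have "\<dots> < ?I * 1" using I K by (intro mult_strict_left_mono) (auto simp: field_simps)
    finally show False by simp
  qed
  moreover have "integral torus_box (\<lambda>x. (cmod (f x))\<^sup>2) \<ge> 0"
    by (intro integral_nonneg intgr continuous_intros cont) auto
  ultimately show ?thesis by linarith
qed

lemma orth_eq_0:
  assumes f: "f \<in> orth" and per: "periodic f"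
  shows "f x = 0"
proof -
  have "continuous_on torus_box (\<lambda>x. (cmod (f x))\<^sup>2)"
    using continuous_on_subset[of UNIV f torus_box] f by (intro continuous_intros) (simp add: orth_def)
  moreover have "box 0 ((\<chi> j. 2 * pi) :: real ^ 'a) \<noteq> {}"
    by (simp add: interval_ne_empty_cart)
  ultimately have "\<forall>x\<in>torus_box. (cmod (f x))\<^sup>2 = 0"
    using orth_integral_norm_sq[OF assms] by (subst (asm) integral_cbox_eq_0_iff) auto
  moreover obtain y where "y \<in> torus_box" "f y = f x" using torus_box_reduce[OF per] .
  ultimately show ?thesis by auto
qed

subsection \<open>Fourier inversion for smooth periodic functions\<close>

lemma content_torus_box: "measure lborel (torus_box :: (real ^ 'n::finite) set) = (2 * pi) ^ CARD('n)"
  by (subst content_cbox_cart) (auto simp: interval_ne_empty_cart)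

text \<open>The M-test gives uniform convergence and hence termwise integration. By orthogonality
  every finite partial sum that contains xi already has the exact integral, so the net of integrals
  is eventually constant.\<close>

lemma fourier_transform_fourier_series:
  fixes c :: "int ^ 'n::finite \<Rightarrow> complex"
  assumes c: "(\<lambda>\<xi>. cmod (c \<xi>)) summable_on UNIV"
  shows "fourier_transform (fourier_series c) \<xi> = c \<xi>"
proof -
  have "uniform_limit torus_box (\<lambda>X x. \<Sum>\<eta>\<in>X. c \<eta> * cexp (\<eta> - \<xi>) x)
     (\<lambda>x. \<Sum>\<^sub>\<infinity>\<eta>. c \<eta> * cexp (\<eta> - \<xi>) x) (finite_subsets_at_top UNIV)"
    by (rule Weierstrass_m_test_general[OF _ c]) (simp add: norm_mult)
  then obtain I J where I: "\<And>X. ((\<lambda>x. \<Sum>\<eta>\<in>X. c \<eta> * cexp (\<eta> - \<xi>) x) has_integral I X) torus_box"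
    and J: "((\<lambda>x. \<Sum>\<^sub>\<infinity>\<eta>. c \<eta> * cexp (\<eta> - \<xi>) x) has_integral J) torus_box"
    and lim: "(I \<longlongrightarrow> J) (finite_subsets_at_top UNIV)"
    by (rule uniform_limit_integral_cbox) (auto intro!: continuous_intros)
  have "eventually (\<lambda>X. I X = c \<xi> * (2 * pi) ^ CARD('n)) (finite_subsets_at_top UNIV)"
    unfolding eventually_finite_subsets_at_top
  proof (intro exI[of _ "{\<xi>}"] conjI allI impI)
    fix X assume X: "finite X \<and> {\<xi>} \<subseteq> X \<and> X \<subseteq> UNIV"
    have "I X = (\<Sum>\<eta>\<in>X. integral torus_box (\<lambda>x. c \<eta> * cexp (\<eta> - \<xi>) x))"
      using X by (subst integral_sum[symmetric]) (auto intro!: torus_integrable continuous_intros integral_unique[OF I, symmetric])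
    also have "\<dots> = (\<Sum>\<eta>\<in>X. if \<eta> = \<xi> then c \<xi> * (2 * pi) ^ CARD('n) else 0)"
      by (intro sum.cong refl) (simp add: integral_cexp)
    also have "\<dots> = c \<xi> * (2 * pi) ^ CARD('n)" using X by simp
    finally show "I X = c \<xi> * (2 * pi) ^ CARD('n)" .
  qed auto
  then have "(I \<longlongrightarrow> c \<xi> * (2 * pi) ^ CARD('n)) (finite_subsets_at_top UNIV)"
    by (rule tendsto_eventually)
  then have "J = c \<xi> * (2 * pi) ^ CARD('n)"
    using tendsto_unique[OF _ lim] by (simp add: finite_subsets_at_top_neq_bot)
  moreover have "fourier_series c x * cexp (- \<xi>) x = (\<Sum>\<^sub>\<infinity>\<eta>. c \<eta> * cexp (\<eta> - \<xi>) x)" for x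
    unfolding fourier_series_def infsum_cmult_left'[symmetric] by (simp add: mult.assoc cexp_mult)
  ultimately show ?thesis
    using integral_unique[OF J] by (simp add: fourier_transform_def)
qed

lemma norm_fourier_transform_le:
  assumes cont: "continuous_on UNIV \<phi>" and le: "\<And>x. cmod (\<phi> x) \<le> M"
  shows "cmod (fourier_transform \<phi> \<xi>) \<le> M"
proof -
  have "cmod (integral torus_box (\<lambda>x. \<phi> x * cexp (- \<xi>) x)) \<le> integral torus_box (\<lambda>x::real ^ 'a. M)"
    by (rule integral_norm_bound_integral)
       (auto intro!: torus_integrable continuous_intros cont simp: norm_mult le)
  then have "cmod (integral torus_box (\<lambda>x. \<phi> x * cexp (- \<xi>) x)) \<le> M * (2 * pi) ^ CARD('a)"
    by (simp only: integral_const content_torus_box scaleR_conv_of_real of_real_eq_id id_apply mult.commute[of M])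
  then show ?thesis
    by (simp add: fourier_transform_def norm_divide norm_power norm_mult pos_divide_le_eq)
qed

lemma fourier_transform_lincomb:
  assumes "continuous_on UNIV f" "continuous_on UNIV g"
  shows "fourier_transform (\<lambda>x. a * f x + b * g x) \<xi> = a * fourier_transform f \<xi> + b * fourier_transform g \<xi>"
proof -
  have "integral torus_box (\<lambda>x. (a * f x + b * g x) * cexp (- \<xi>) x) =
     integral torus_box (\<lambda>x. a * (f x * cexp (- \<xi>) x) + b * (g x * cexp (- \<xi>) x))"
    by (simp add: algebra_simps)
  also have "\<dots> = a * integral torus_box (\<lambda>x. f x * cexp (- \<xi>) x) + b * integral torus_box (\<lambda>x. g x * cexp (- \<xi>) x)"
    by (subst integral_add) (auto intro!: torus_integrable continuous_intros assms)
  finally show ?thesis by (simp add: fourier_transform_def add_divide_distrib)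
qed

lemma torus_fun_lincomb: "\<phi> \<in> torus_fun \<Longrightarrow> \<psi> \<in> torus_fun \<Longrightarrow> (\<lambda>x. a * \<phi> x + b * \<psi> x) \<in> torus_fun"
  unfolding torus_fun_def using smooth_lincomb by auto

lemma torus_fun_cmult: "\<phi> \<in> torus_fun \<Longrightarrow> (\<lambda>x. c * \<phi> x) \<in> torus_fun"
  using torus_fun_lincomb[of \<phi> \<phi> c 0] by simp

lemma dir_deriv_torus_fun:
  assumes "\<phi> \<in> torus_fun" shows "dir_deriv v \<phi> \<in> torus_fun"
proof -
  have sm: "smooth \<phi>" using assms by (rule torus_fun_smooth)
  have "dir_deriv v \<phi> (x + (2 * pi) *\<^sub>R int_vec k) = dir_deriv v \<phi> x" for x k
  proof -
    have "((\<lambda>y. \<phi> (y + (2 * pi) *\<^sub>R int_vec k)) has_derivative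
        (\<lambda>v. dir_deriv v \<phi> (x + (2 * pi) *\<^sub>R int_vec k))) (at x)"
      by (rule has_derivative_compose[where f = "\<lambda>y. y + (2 * pi) *\<^sub>R int_vec k" and g = \<phi>,
            OF _ dir_deriv_has_derivative[OF smooth_differentiable[OF sm]]])
         (auto intro!: derivative_eq_intros)
    moreover have "(\<lambda>y. \<phi> (y + (2 * pi) *\<^sub>R int_vec k)) = \<phi>"
      using torus_fun_periodic[OF assms] by (auto simp: periodic_def)
    ultimately show ?thesis using dir_deriv_eq[of \<phi> _ x v] by auto
  qed
  then show ?thesis using smooth_dir_deriv[OF sm] by (simp add: torus_fun_def)
qed

lemma Dx_torus_fun: "\<phi> \<in> torus_fun \<Longrightarrow> Dx j \<phi> \<in> torus_fun"
  using torus_fun_cmult[OF dir_deriv_torus_fun, of \<phi> "1 / \<i>" "axis j 1"] by (simp add: Dx_def[abs_def])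

text \<open>Integration by parts: phi times \<open>cexp (- \<xi>)\<close> is periodic, so the
  integral of its j-th derivative is 0. The factor i converts \<open>Dx\<close> into that
  derivative.\<close>

lemma fourier_transform_Dx:
  assumes phi: "\<phi> \<in> torus_fun"
  shows "fourier_transform (Dx j \<phi>) \<xi> = of_int (\<xi> $ j) * fourier_transform \<phi> \<xi>"
proof -
  note cont = torus_fun_continuous_on[OF phi] torus_fun_continuous_on[OF Dx_torus_fun[OF phi]]
  have "integral torus_box (\<lambda>x. \<i> * Dx j \<phi> x * cexp (- \<xi>) x + \<phi> x * (- \<i> * of_int (\<xi> $ j) * cexp (- \<xi>) x)) = 0"
  proof (rule integral_torus_deriv[of "\<lambda>x. \<phi> x * cexp (- \<xi>) x"])
    show "periodic (\<lambda>x. \<phi> x * cexp (- \<xi>) x)"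
      using torus_fun_periodic[OF phi] by (simp add: periodic_def cexp_periodic)
    show "continuous_on UNIV (\<lambda>x. \<i> * Dx j \<phi> x * cexp (- \<xi>) x + \<phi> x * (- \<i> * of_int (\<xi> $ j) * cexp (- \<xi>) x))"
      by (intro continuous_intros cont)
    fix x
    have "((\<lambda>x. \<phi> x * cexp (- \<xi>) x) has_derivative
       (\<lambda>v. \<phi> x * (\<i> * of_real (v \<bullet> int_vec (- \<xi>)) * cexp (- \<xi>) x) + dir_deriv v \<phi> x * cexp (- \<xi>) x)) (at x)"
      by (intro has_derivative_mult dir_deriv_has_derivative smooth_differentiable torus_fun_smooth phi cexp_has_derivative)
    then show "\<exists>F. ((\<lambda>x. \<phi> x * cexp (- \<xi>) x) has_derivative F) (at x) \<and>
       F (axis j 1) = \<i> * Dx j \<phi> x * cexp (- \<xi>) x + \<phi> x * (- \<i> * of_int (\<xi> $ j) * cexp (- \<xi>) x)"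
      by (intro exI[of _ "\<lambda>v. \<phi> x * (\<i> * of_real (v \<bullet> int_vec (- \<xi>)) * cexp (- \<xi>) x) + dir_deriv v \<phi> x * cexp (- \<xi>) x"] conjI)
         (simp_all add: Dx_def inner_axis' mult.assoc[symmetric])
  qed
  then have "integral torus_box (\<lambda>x. \<i> * (Dx j \<phi> x * cexp (- \<xi>) x) + (- \<i> * of_int (\<xi> $ j)) * (\<phi> x * cexp (- \<xi>) x)) = 0"
    by (simp add: mult_ac)
  then have "\<i> * integral torus_box (\<lambda>x. Dx j \<phi> x * cexp (- \<xi>) x)
     + (- \<i> * of_int (\<xi> $ j)) * integral torus_box (\<lambda>x. \<phi> x * cexp (- \<xi>) x) = 0"
    by (subst (asm) integral_add) (auto intro!: torus_integrable continuous_intros cont)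
  then have "\<i> * integral torus_box (\<lambda>x. Dx j \<phi> x * cexp (- \<xi>) x)
     = \<i> * (of_int (\<xi> $ j) * integral torus_box (\<lambda>x. \<phi> x * cexp (- \<xi>) x))"
    by (simp add: mult.assoc)
  then show ?thesis by (simp add: fourier_transform_def)
qed

section \<open>Multi-indices and decay of Fourier coefficients\<close>

definition monomial :: "int ^ 'n::finite \<Rightarrow> ('n \<Rightarrow> nat) \<Rightarrow> int" where
  "monomial \<xi> \<alpha> = (\<Prod>j\<in>UNIV. (\<xi> $ j) ^ \<alpha> j)"

lemma prod_list_map_count:
  fixes f :: "'n::finite \<Rightarrow> 'b::comm_monoid_mult"
  shows "prod_list (map f js) = (\<Prod>j\<in>UNIV. f j ^ count_list js j)"
proof (induction js)
  case (Cons a js)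
  have "(\<Prod>j\<in>UNIV. f j ^ count_list (a # js) j) = (\<Prod>j\<in>UNIV. (if j = a then f a else 1) * f j ^ count_list js j)"
    by (intro prod.cong) auto
  with Cons show ?case by (simp add: prod.distrib)
qed simp

lemma ex_list_count: "\<exists>js. \<forall>j::'n::finite. count_list js j = \<alpha> j"
proof -
  have "finite {j. 0 < \<alpha> j}" by simp
  then have "count (Abs_multiset \<alpha>) = \<alpha>" by (simp add: Abs_multiset_inverse)
  moreover obtain js where "mset js = Abs_multiset \<alpha>" using ex_mset by blast
  ultimately show ?thesis by (metis count_mset)
qed

text \<open>Unpacks the choice in \<open>D_multi\<close>. Only the number of occurrences of each
  index in the list matters, because a product of components of xi does not see their order.\<close>

lemma D_multi_list:
  obtains js where "D_multi \<alpha> = foldr Dx js" "monomial \<xi> \<alpha> = prod_list (map (\<lambda>j. \<xi> $ j) js)"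
    "\<And>j. count_list js j = \<alpha> j"
proof
  let ?js = "SOME js. \<forall>j. count_list js j = \<alpha> j"
  have *: "\<forall>j. count_list ?js j = \<alpha> j" by (rule someI_ex[OF ex_list_count])
  show "D_multi \<alpha> = foldr Dx ?js" by (auto simp: D_multi_def)
  show "count_list ?js j = \<alpha> j" for j using * by blast
  show "monomial \<xi> \<alpha> = prod_list (map (\<lambda>j. \<xi> $ j) ?js)"
    unfolding prod_list_map_count monomial_def using * by simp
qed

lemma foldr_Dx_torus_fun: "\<phi> \<in> torus_fun \<Longrightarrow> foldr Dx js \<phi> \<in> torus_fun"
  by (induction js) (auto intro: Dx_torus_fun)

lemma D_multi_torus_fun: "\<phi> \<in> torus_fun \<Longrightarrow> D_multi \<alpha> \<phi> \<in> torus_fun"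
  unfolding D_multi_def by (rule foldr_Dx_torus_fun)

text \<open>On the Fourier side each \<open>Dx\<close> is a factor, so the result depends on the
  multi-index alone, and symmetry of mixed derivatives need not be invoked.\<close>

lemma fourier_transform_D_multi:
  assumes "\<phi> \<in> torus_fun"
  shows "fourier_transform (D_multi \<alpha> \<phi>) \<xi> = of_int (monomial \<xi> \<alpha>) * fourier_transform \<phi> \<xi>"
proof -
  obtain js where js: "D_multi \<alpha> = foldr Dx js" "monomial \<xi> \<alpha> = prod_list (map (\<lambda>j. \<xi> $ j) js)"
    by (rule D_multi_list)
  have "fourier_transform (foldr Dx js \<phi>) \<xi> = of_int (prod_list (map (\<lambda>j. \<xi> $ j) js)) * fourier_transform \<phi> \<xi>"
    by (induction js) (simp_all add: fourier_transform_Dx foldr_Dx_torus_fun assms)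
  then show ?thesis by (simp add: js)
qed

lemma abs_monomial_le: "\<bar>real_of_int (monomial \<xi> \<alpha>)\<bar> \<le> norm (int_vec \<xi>) ^ mi_order \<alpha>"
proof -
  have "\<bar>real_of_int (monomial \<xi> \<alpha>)\<bar> = (\<Prod>j\<in>UNIV. \<bar>int_vec \<xi> $ j\<bar> ^ \<alpha> j)"
    by (simp add: monomial_def abs_prod power_abs)
  also have "\<dots> \<le> (\<Prod>j\<in>UNIV. norm (int_vec \<xi>) ^ \<alpha> j)"
    by (intro prod_mono conjI power_mono component_le_norm_cart) auto
  finally show ?thesis by (simp add: power_sum)
qed

lemma torus_fun_bounded:
  assumes "\<phi> \<in> torus_fun" obtains M where "\<And>x. cmod (\<phi> x) \<le> M"
proof -
  have "bounded (\<phi> ` torus_box)"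
    by (intro compact_imp_bounded compact_continuous_image torus_fun_continuous_on assms) simp
  then obtain M where M: "\<And>x. x \<in> torus_box \<Longrightarrow> cmod (\<phi> x) \<le> M" by (auto simp: bounded_iff)
  show thesis
  proof (rule that)
    fix x obtain y where "y \<in> torus_box" "\<phi> y = \<phi> x"
      by (rule torus_box_reduce[OF torus_fun_periodic[OF assms], of x])
    with M show "cmod (\<phi> x) \<le> M" by metis
  qed
qed

lemma finite_multi_indices: "finite {\<alpha> :: 'n::finite \<Rightarrow> nat. mi_order \<alpha> \<le> m}"
proof (rule finite_subset)
  show "finite (UNIV \<rightarrow>\<^sub>E {..m} :: ('n \<Rightarrow> nat) set)" by (rule finite_PiE) auto
  show "{\<alpha> :: 'n \<Rightarrow> nat. mi_order \<alpha> \<le> m} \<subseteq> UNIV \<rightarrow>\<^sub>E {..m}"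
  proof (safe intro!: PiE_I)
    fix \<alpha> :: "'n \<Rightarrow> nat" and j assume "mi_order \<alpha> \<le> m"
    moreover have "\<alpha> j \<le> mi_order \<alpha>" by (rule member_le_sum) auto
    ultimately show "\<alpha> j \<le> m" by simp
  qed auto
qed

text \<open>The supremum in \<open>test_seminorm\<close> is meaningful because finitely many
  multi-indices occur and each derivative is bounded by compactness of the period box.\<close>

lemma test_seminorm_bdd:
  assumes "\<phi> \<in> torus_fun"
  shows "bdd_above {cmod (D_multi \<alpha> \<phi> x) | \<alpha> x. mi_order \<alpha> \<le> m}"
proof -
  obtain M where M: "\<And>\<alpha> x. cmod (D_multi \<alpha> \<phi> x) \<le> M \<alpha>"
  proof -
    have "\<exists>M. \<forall>x. cmod (D_multi \<alpha> \<phi> x) \<le> M" for \<alpha>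
      using torus_fun_bounded[OF D_multi_torus_fun[OF assms]] by meson
    with that show thesis by metis
  qed
  show ?thesis
  proof (rule bdd_aboveI)
    fix y assume "y \<in> {cmod (D_multi \<alpha> \<phi> x) | \<alpha> x. mi_order \<alpha> \<le> m}"
    then obtain \<alpha> x where y: "y = cmod (D_multi \<alpha> \<phi> x)" "mi_order \<alpha> \<le> m" by blast
    then show "y \<le> Max (M ` {\<alpha>. mi_order \<alpha> \<le> m})"
      by (intro order.trans[OF M[of \<alpha> x, folded y(1)]] Max_ge) (auto simp: finite_multi_indices)
  qed
qed

lemma norm_D_multi_le:
  assumes "\<phi> \<in> torus_fun" "mi_order \<alpha> \<le> m"
  shows "cmod (D_multi \<alpha> \<phi> x) \<le> test_seminorm m \<phi>"
  unfolding test_seminorm_def by (rule cSup_upper[OF _ test_seminorm_bdd[OF assms(1)]]) (use assms in blast)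

lemma test_seminorm_least:
  assumes "\<And>\<alpha> x. mi_order \<alpha> \<le> m \<Longrightarrow> cmod (D_multi \<alpha> \<phi> x) \<le> B"
  shows "test_seminorm m \<phi> \<le> B"
  unfolding test_seminorm_def
proof (rule cSup_least)
  show "{cmod (D_multi \<alpha> \<phi> x) | \<alpha> x. mi_order \<alpha> \<le> m} \<noteq> {}"
    using exI[of "\<lambda>\<alpha>. mi_order \<alpha> \<le> m" "\<lambda>_. 0"] by auto
qed (use assms in auto)

lemma test_seminorm_nonneg: "\<phi> \<in> torus_fun \<Longrightarrow> 0 \<le> test_seminorm m \<phi>"
  using norm_D_multi_le[of \<phi> "\<lambda>_. 0" m undefined] by (metis norm_ge_zero order.trans le0 sum.neutral_const)

lemma test_seminorm_mono: "\<phi> \<in> torus_fun \<Longrightarrow> m \<le> m' \<Longrightarrow> test_seminorm m \<phi> \<le> test_seminorm m' \<phi>"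
  by (intro test_seminorm_least norm_D_multi_le) auto

lemma norm_monomial_fourier_transform_le:
  assumes "\<phi> \<in> torus_fun" "\<And>x. cmod (D_multi \<alpha> \<phi> x) \<le> B"
  shows "\<bar>real_of_int (monomial \<xi> \<alpha>)\<bar> * cmod (fourier_transform \<phi> \<xi>) \<le> B"
  using norm_fourier_transform_le[OF torus_fun_continuous_on[OF D_multi_torus_fun[OF assms(1)]] assms(2), of \<xi>]
  by (simp add: fourier_transform_D_multi assms(1) norm_mult)

text \<open>A component of maximal modulus works, since the Euclidean norm is at most the sum of the
  moduli. It lets derivatives in a single direction control a power of |xi|.\<close>

lemma ex_large_component: "\<exists>j. norm (int_vec \<xi>) \<le> real CARD('n) * \<bar>real_of_int (\<xi> $ j)\<bar>" for \<xi> :: "int ^ 'n::finite"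
proof -
  obtain j where j: "\<And>i. \<bar>\<xi> $ i\<bar> \<le> \<bar>\<xi> $ j\<bar>"
    using Max_in[of "range (\<lambda>i. \<bar>\<xi> $ i\<bar>)"] Max_ge[of "range (\<lambda>i. \<bar>\<xi> $ i\<bar>)"]
    by (metis (mono_tags, lifting) UNIV_not_empty finite finite_imageI image_iff image_is_empty rangeI)
  have "norm (int_vec \<xi>) \<le> (\<Sum>i\<in>UNIV. \<bar>real_of_int (\<xi> $ i)\<bar>)"
    using norm_le_l1_cart[of "int_vec \<xi>"] by simp
  also have "\<dots> \<le> (\<Sum>i\<in>(UNIV::'n set). \<bar>real_of_int (\<xi> $ j)\<bar>)"
    by (intro sum_mono) (metis j of_int_abs of_int_le_iff)
  finally show ?thesis by (auto intro!: exI[of _ j])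
qed

lemma monomial_single: "monomial \<xi> (\<lambda>i. if i = j then k else 0) = (\<xi> $ j) ^ k"
proof -
  have "monomial \<xi> (\<lambda>i. if i = j then k else 0) = (\<Prod>i\<in>UNIV. if i = j then (\<xi> $ j) ^ k else 1)"
    unfolding monomial_def by (intro prod.cong) auto
  then show ?thesis by simp
qed

text \<open>Derivatives of order m in the direction of a dominating component j suffice. If xi_j = 0
  then xi = 0 and the weight is 1; otherwise |xi_j| >= 1 absorbs the summand 1 of
  \<open>japanese\<close>, which explains the base 1 + N.\<close>

lemma norm_fourier_transform_decay:
  fixes \<phi> :: "real ^ 'n::finite \<Rightarrow> complex"
  assumes phi: "\<phi> \<in> torus_fun"
  shows "cmod (fourier_transform \<phi> \<xi>) * japanese \<xi> ^ m \<le> (1 + real CARD('n)) ^ m * test_seminorm m \<phi>"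
proof -
  have *: "\<bar>real_of_int (monomial \<xi> \<alpha>)\<bar> * cmod (fourier_transform \<phi> \<xi>) \<le> test_seminorm m \<phi>" if "mi_order \<alpha> \<le> m" for \<alpha>
    by (intro norm_monomial_fourier_transform_le norm_D_multi_le phi that)
  obtain j where j: "norm (int_vec \<xi>) \<le> real CARD('n) * \<bar>real_of_int (\<xi> $ j)\<bar>"
    using ex_large_component by blast
  show ?thesis
  proof (cases "\<xi> $ j = 0")
    case True
    then have "japanese \<xi> = 1" using j by (simp add: japanese_def)
    moreover have "cmod (fourier_transform \<phi> \<xi>) \<le> test_seminorm m \<phi>"
      using *[of "\<lambda>_. 0"] by (simp add: monomial_def)
    moreover have "test_seminorm m \<phi> \<le> (1 + real CARD('n)) ^ m * test_seminorm m \<phi>"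
      using mult_right_mono[OF one_le_power[of "1 + real CARD('n)" m] test_seminorm_nonneg[OF phi, of m]] by simp
    ultimately show ?thesis by simp
  next
    case False
    then have "1 \<le> \<bar>real_of_int (\<xi> $ j)\<bar>" by linarith
    with j have "japanese \<xi> \<le> (1 + real CARD('n)) * \<bar>real_of_int (\<xi> $ j)\<bar>"
      by (simp add: japanese_def algebra_simps)
    then have "japanese \<xi> ^ m \<le> ((1 + real CARD('n)) * \<bar>real_of_int (\<xi> $ j)\<bar>) ^ m"
      by (intro power_mono) auto
    then have "cmod (fourier_transform \<phi> \<xi>) * japanese \<xi> ^ m
       \<le> cmod (fourier_transform \<phi> \<xi>) * ((1 + real CARD('n)) * \<bar>real_of_int (\<xi> $ j)\<bar>) ^ m"
      by (intro mult_left_mono) auto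
    also have "\<dots> = (1 + real CARD('n)) ^ m * (\<bar>real_of_int (monomial \<xi> (\<lambda>i. if i = j then m else 0))\<bar> * cmod (fourier_transform \<phi> \<xi>))"
      by (simp add: monomial_single power_mult_distrib power_abs)
    also have "\<dots> \<le> (1 + real CARD('n)) ^ m * test_seminorm m \<phi>"
      by (intro mult_left_mono *) auto
    finally show ?thesis .
  qed
qed

section \<open>Summability over the lattice, and Fourier inversion\<close>

lemma summable_on_int_inverse_squares: "(\<lambda>k::int. 1 / (1 + \<bar>real_of_int k\<bar>)\<^sup>2) summable_on UNIV"
proof -
  have "summable (\<lambda>n. inverse (real (Suc n) ^ 2))"
    by (subst summable_Suc_iff) (rule inverse_power_summable, simp)
  then have n: "(\<lambda>n. 1 / (1 + real n)\<^sup>2) summable_on UNIV"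
    by (subst summable_on_UNIV_nonneg_real_iff) (simp_all add: inverse_eq_divide)
  have "(\<lambda>k::int. 1 / (1 + \<bar>real_of_int k\<bar>)\<^sup>2) summable_on (range int \<union> range (\<lambda>n. - int n))"
    by (rule summable_on_union; subst summable_on_reindex) (use n in \<open>auto simp: inj_on_def o_def\<close>)
  moreover have "range int \<union> range (\<lambda>n. - int n) = UNIV"
    by (auto simp: image_iff) (metis int_cases2)
  ultimately show ?thesis by simp
qed

text \<open>The exponent provides a factor (1 + |xi_j|)^(-2) for every coordinate. Enlarging a
  finite set of frequencies to a full grid turns the sum of products into a product of
  one-dimensional sums.\<close>

lemma summable_on_japanese: "(\<lambda>\<xi> :: int ^ 'n::finite. 1 / japanese \<xi> ^ (2 * CARD('n))) summable_on UNIV"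
proof (rule nonneg_bdd_above_summable_on)
  define S where "S = (\<Sum>\<^sub>\<infinity>k::int. 1 / (1 + \<bar>real_of_int k\<bar>)\<^sup>2)"
  show "bdd_above (sum (\<lambda>\<xi> :: int ^ 'n. 1 / japanese \<xi> ^ (2 * CARD('n))) ` {F. F \<subseteq> UNIV \<and> finite F})"
  proof (rule bdd_aboveI2)
    fix F :: "(int ^ 'n) set" assume "F \<in> {F. F \<subseteq> UNIV \<and> finite F}"
    then have F: "finite F" by simp
    define B where "B = (\<lambda>(\<xi>, j). \<xi> $ j) ` (F \<times> UNIV)"
    have B: "finite B" unfolding B_def using F by simp
    have "1 / japanese \<xi> ^ (2 * CARD('n)) \<le> (\<Prod>j\<in>UNIV. 1 / (1 + \<bar>real_of_int (\<xi> $ j)\<bar>)\<^sup>2)" for \<xi> :: "int ^ 'n"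
    proof -
      have "(\<Prod>j\<in>(UNIV::'n set). 1 / (japanese \<xi>)\<^sup>2) \<le> (\<Prod>j\<in>UNIV. 1 / (1 + \<bar>real_of_int (\<xi> $ j)\<bar>)\<^sup>2)"
      proof (intro prod_mono conjI divide_left_mono power_mono)
        show "1 + \<bar>real_of_int (\<xi> $ j)\<bar> \<le> japanese \<xi>" for j
          using component_le_norm_cart[of "int_vec \<xi>" j] by (simp add: japanese_def)
      qed (auto intro!: mult_pos_pos zero_less_power)
      then show ?thesis by (simp add: power_one_over power_mult)
    qed
    then have "(\<Sum>\<xi>\<in>F. 1 / japanese \<xi> ^ (2 * CARD('n))) \<le> (\<Sum>\<xi>\<in>F. \<Prod>j\<in>UNIV. 1 / (1 + \<bar>real_of_int (\<xi> $ j)\<bar>)\<^sup>2)"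
      by (rule sum_mono)
    also have "\<dots> = (\<Sum>f\<in>(\<lambda>\<xi> j. \<xi> $ j) ` F. \<Prod>j\<in>UNIV. 1 / (1 + \<bar>real_of_int (f j)\<bar>)\<^sup>2)"
      by (subst sum.reindex) (auto simp: inj_on_def vec_eq_iff fun_eq_iff)
    also have "\<dots> \<le> (\<Sum>f\<in>(UNIV :: 'n set) \<rightarrow>\<^sub>E B. \<Prod>j\<in>UNIV. 1 / (1 + \<bar>real_of_int (f j)\<bar>)\<^sup>2)"
    proof (rule sum_mono2)
      show "finite (UNIV \<rightarrow>\<^sub>E B :: ('n \<Rightarrow> int) set)" using B by (intro finite_PiE) auto
    qed (auto simp: B_def intro!: prod_nonneg)
    also have "\<dots> = (\<Prod>j\<in>(UNIV::'n set). \<Sum>k\<in>B. 1 / (1 + \<bar>real_of_int k\<bar>)\<^sup>2)"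
      by (rule prod_sum_PiE[symmetric]) (use B in auto)
    also have "\<dots> \<le> (\<Prod>j\<in>(UNIV::'n set). S)"
      unfolding S_def by (intro prod_mono conjI sum_nonneg finite_sum_le_infsum summable_on_int_inverse_squares B) auto
    finally show "(\<Sum>\<xi>\<in>F. 1 / japanese \<xi> ^ (2 * CARD('n))) \<le> (\<Prod>j\<in>(UNIV::'n set). S)" .
  qed
qed auto

lemma rapid_fourier_transform:
  fixes \<phi> :: "real ^ 'n::finite \<Rightarrow> complex"
  assumes "\<phi> \<in> torus_fun" shows "rapid (fourier_transform \<phi>)"
  unfolding rapid_def
proof
  fix m
  \<comment> \<open>The additional 2N powers of decay pay for the summation over the
    lattice.\<close>
  let ?k = "m + 2 * CARD('n)"
  let ?C = "(1 + real CARD('n)) ^ ?k * test_seminorm ?k \<phi>"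
  show "(\<lambda>\<xi>. cmod (fourier_transform \<phi> \<xi>) * japanese \<xi> ^ m) summable_on UNIV"
  proof (rule summable_on_bound)
    show "(\<lambda>\<xi> :: int ^ 'n. ?C * (1 / japanese \<xi> ^ (2 * CARD('n)))) summable_on UNIV"
      by (intro summable_on_cmult_right summable_on_japanese)
    show "norm (cmod (fourier_transform \<phi> \<xi>) * japanese \<xi> ^ m) \<le> ?C * (1 / japanese \<xi> ^ (2 * CARD('n)))" for \<xi>
      using norm_fourier_transform_decay[OF assms, of \<xi> ?k] by (simp add: field_simps power_add)
  qed
qed

text \<open>The function and its Fourier series have the same coefficients, so their difference is a
  periodic member of \<open>orth\<close>.\<close>

lemma fourier_inversion:
  assumes "\<phi> \<in> torus_fun" shows "fourier_series (fourier_transform \<phi>) = \<phi>"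
proof
  fix x
  let ?s = "fourier_series (fourier_transform \<phi>)"
  have r: "rapid (fourier_transform \<phi>)" by (rule rapid_fourier_transform[OF assms])
  have s: "?s \<in> torus_fun" by (rule fourier_series_torus_fun[OF r])
  let ?d = "\<lambda>x. 1 * ?s x + (-1) * \<phi> x"
  have d: "?d \<in> torus_fun" by (rule torus_fun_lincomb[OF s assms])
  have "fourier_transform ?d \<xi> = 0" for \<xi>
    by (subst fourier_transform_lincomb)
       (auto intro!: torus_fun_continuous_on s assms simp: fourier_transform_fourier_series[OF rapid_abs_summable[OF r]])
  then have "integral torus_box (\<lambda>x. ?d x * cexp \<xi> x) = 0" for \<xi>
    using fourier_transform_def[of ?d "- \<xi>"] by simp
  then have "?d \<in> orth" using torus_fun_continuous_on[OF d] by (simp add: orth_def)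
  then have "?d x = 0" by (rule orth_eq_0[OF _ torus_fun_periodic[OF d]])
  then show "?s x = \<phi> x" by simp
qed

subsection \<open>Distributions as polynomially bounded sequences\<close>

text \<open>The coefficients of the left side are known from
  \<open>fourier_transform_D_multi\<close>, and inversion recovers the function from them; the list
  hidden in \<open>D_multi\<close> need not be opened again.\<close>

lemma D_multi_fourier_series:
  assumes "rapid c"
  shows "D_multi \<alpha> (fourier_series c) = fourier_series (\<lambda>\<xi>. of_int (monomial \<xi> \<alpha>) * c \<xi>)"
proof -
  have tf: "fourier_series c \<in> torus_fun" by (rule fourier_series_torus_fun[OF assms])
  have "fourier_transform (D_multi \<alpha> (fourier_series c)) = (\<lambda>\<xi>. of_int (monomial \<xi> \<alpha>) * c \<xi>)"
    by (auto simp: fourier_transform_D_multi[OF tf] fourier_transform_fourier_series[OF rapid_abs_summable[OF assms]])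
  then show ?thesis using fourier_inversion[OF D_multi_torus_fun[OF tf, of \<alpha>]] by simp
qed

lemma rapid_monomial:
  assumes "rapid c" shows "rapid (\<lambda>\<xi>. of_int (monomial \<xi> \<alpha>) * c \<xi>)"
proof -
  have "cmod (of_int (monomial \<xi> \<alpha>)) \<le> 1 * japanese \<xi> ^ mi_order \<alpha>" for \<xi>
    using order.trans[OF abs_monomial_le power_mono[OF norm_int_vec_le norm_ge_zero], of \<xi> \<alpha>] by simp
  from rapid_mult[OF assms this] show ?thesis by (simp add: mult.commute)
qed

lemma norm_D_multi_fourier_series_le:
  assumes "rapid c"
  shows "cmod (D_multi \<alpha> (fourier_series c) x) \<le> (\<Sum>\<^sub>\<infinity>\<xi>. norm (int_vec \<xi>) ^ mi_order \<alpha> * cmod (c \<xi>))"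
proof -
  have "cmod (D_multi \<alpha> (fourier_series c) x) \<le> (\<Sum>\<^sub>\<infinity>\<xi>. cmod (of_int (monomial \<xi> \<alpha>) * c \<xi>))"
    unfolding D_multi_fourier_series[OF assms]
    by (rule norm_fourier_series_le[OF rapid_abs_summable[OF rapid_monomial[OF assms]]])
  also have "\<dots> \<le> (\<Sum>\<^sub>\<infinity>\<xi>. norm (int_vec \<xi>) ^ mi_order \<alpha> * cmod (c \<xi>))"
  proof (rule infsum_mono)
    show "(\<lambda>\<xi>. norm (int_vec \<xi>) ^ mi_order \<alpha> * cmod (c \<xi>)) summable_on UNIV"
    proof (rule summable_on_bound)
      show "(\<lambda>\<xi>. cmod (c \<xi>) * japanese \<xi> ^ mi_order \<alpha>) summable_on UNIV"
        using assms by (simp add: rapid_def)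
    qed (auto simp: mult.commute[of "cmod _"] intro!: mult_right_mono power_mono norm_int_vec_le)
  qed (use rapid_abs_summable[OF rapid_monomial[OF assms]] abs_monomial_le in \<open>auto simp: norm_mult intro!: mult_right_mono\<close>)
  finally show ?thesis .
qed

lemma test_seminorm_fourier_series_le:
  assumes "rapid c"
  shows "test_seminorm m (fourier_series c) \<le> (\<Sum>\<^sub>\<infinity>\<xi>. cmod (c \<xi>) * japanese \<xi> ^ m)"
proof (rule test_seminorm_least)
  fix \<alpha> :: "'a \<Rightarrow> nat" and x assume \<alpha>: "mi_order \<alpha> \<le> m"
  have le: "norm (int_vec \<xi>) ^ mi_order \<alpha> \<le> japanese \<xi> ^ m" for \<xi> :: "int ^ 'a"
    using order.trans[OF power_mono[OF norm_int_vec_le norm_ge_zero] power_increasing[OF \<alpha> japanese_ge_1[of \<xi>]]] .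
  have s: "(\<lambda>\<xi>. cmod (c \<xi>) * japanese \<xi> ^ m) summable_on UNIV" using assms by (simp add: rapid_def)
  have le': "norm (int_vec \<xi>) ^ mi_order \<alpha> * cmod (c \<xi>) \<le> cmod (c \<xi>) * japanese \<xi> ^ m" for \<xi>
    using mult_left_mono[OF le[of \<xi>], of "cmod (c \<xi>)"] by (simp add: mult.commute)
  have "(\<Sum>\<^sub>\<infinity>\<xi>. norm (int_vec \<xi>) ^ mi_order \<alpha> * cmod (c \<xi>)) \<le> (\<Sum>\<^sub>\<infinity>\<xi>. cmod (c \<xi>) * japanese \<xi> ^ m)"
    by (rule infsum_mono[OF summable_on_bound[OF s] s]) (use le' in auto)
  with norm_D_multi_fourier_series_le[OF assms]
  show "cmod (D_multi \<alpha> (fourier_series c) x) \<le> (\<Sum>\<^sub>\<infinity>\<xi>. cmod (c \<xi>) * japanese \<xi> ^ m)"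
    by (rule order.trans)
qed

definition poly_bounded :: "(int ^ 'n \<Rightarrow> complex) \<Rightarrow> bool" where
  "poly_bounded b \<longleftrightarrow> (\<exists>C m. \<forall>\<xi>. cmod (b \<xi>) \<le> C * japanese \<xi> ^ m)"

text \<open>The duality pairing: u evaluated at \<open>cexp \<xi>\<close> is the coefficient at -xi,
  whence the reflected index. The value 0 off \<open>torus_fun\<close> matches the normalization of
  distributions.\<close>

definition distr_of_coeffs :: "(int ^ 'n::finite \<Rightarrow> complex) \<Rightarrow> 'n distr" where
  "distr_of_coeffs b \<psi> = (if \<psi> \<in> torus_fun then \<Sum>\<^sub>\<infinity>\<xi>. fourier_transform \<psi> \<xi> * b (- \<xi>) else 0)"

lemma distributionsD:
  assumes "u \<in> distributions"
  shows "\<phi> \<notin> torus_fun \<Longrightarrow> u \<phi> = 0"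
    and "\<phi> \<in> torus_fun \<Longrightarrow> \<psi> \<in> torus_fun \<Longrightarrow> u (\<lambda>x. \<phi> x + \<psi> x) = u \<phi> + u \<psi>"
    and "\<phi> \<in> torus_fun \<Longrightarrow> u (\<lambda>x. c * \<phi> x) = c * u \<phi>"
  using assms unfolding distributions_def by blast+

lemma distributions_bound:
  assumes "u \<in> distributions"
  shows "\<exists>C m. C \<ge> 0 \<and> (\<forall>\<phi>\<in>torus_fun. cmod (u \<phi>) \<le> C * test_seminorm m \<phi>)"
proof -
  obtain C m where C: "\<And>\<phi>. \<phi> \<in> torus_fun \<Longrightarrow> cmod (u \<phi>) \<le> C * test_seminorm m \<phi>"
    using assms unfolding distributions_def by blast
  show ?thesis
  proof (rule exI[of _ "\<bar>C\<bar>"], rule exI[of _ m], intro conjI ballI)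
    fix \<phi> :: "real ^ 'a \<Rightarrow> complex" assume p: "\<phi> \<in> torus_fun"
    show "cmod (u \<phi>) \<le> \<bar>C\<bar> * test_seminorm m \<phi>"
      using C[OF p] mult_right_mono[OF abs_ge_self[of C] test_seminorm_nonneg[OF p, of m]] by linarith
  qed simp
qed

lemma rapid_if: "rapid c \<Longrightarrow> rapid (\<lambda>\<xi>. if \<xi> \<in> S then c \<xi> else 0)"
  using rapid_mult_bounded[of c "\<lambda>\<xi>. if \<xi> \<in> S then 1 else 0" 1] by (simp add: if_distrib cong: if_cong)

lemma fourier_series_add:
  assumes "rapid c" "rapid d"
  shows "fourier_series (\<lambda>\<xi>. c \<xi> + d \<xi>) = (\<lambda>x. fourier_series c x + fourier_series d x)"
  unfolding fourier_series_def distrib_right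
  by (intro ext infsum_add fourier_series_summable rapid_abs_summable assms)

lemma fourier_series_cmult: "fourier_series (\<lambda>\<xi>. a * c \<xi>) = (\<lambda>x. a * fourier_series c x)"
  unfolding fourier_series_def mult.assoc by (simp add: infsum_cmult_right')

lemma distribution_finite_series:
  assumes u: "u \<in> distributions" and "finite S"
  shows "u (fourier_series (\<lambda>\<xi>. if \<xi> \<in> S then c \<xi> else 0)) = (\<Sum>\<xi>\<in>S. c \<xi> * u (cexp \<xi>))"
  using \<open>finite S\<close>
proof induction
  case empty
  have "u (\<lambda>x. 0 * cexp 0 x) = 0 * u (cexp 0)" by (rule distributionsD(3)[OF u cexp_torus_fun])
  then show ?case by (simp add: fourier_series_def[abs_def])
next
  case (insert \<eta> S)
  have r: "rapid (\<lambda>\<xi>. if \<xi> \<in> S then c \<xi> else 0)"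
    by (rule rapid_finite_support, rule finite_subset[OF _ insert(1)]) auto
  have 1: "(\<lambda>\<xi>. if \<xi> \<in> insert \<eta> S then c \<xi> else 0) =
     (\<lambda>\<xi>. c \<eta> * (if \<xi> = \<eta> then 1 else 0) + (if \<xi> \<in> S then c \<xi> else 0))"
    using insert(2) by auto
  have r2: "rapid (\<lambda>\<xi>. c \<eta> * (if \<xi> = \<eta> then 1 else 0))"
    using rapid_single[of \<eta> "c \<eta>"] by (simp add: if_distrib cong: if_cong)
  show ?case
    unfolding 1 fourier_series_add[OF r2 r]
    using insert distributionsD(2,3)[OF u] fourier_series_torus_fun[OF r]
    by (simp add: fourier_series_cmult cexp_eq_fourier_series[symmetric] torus_fun_cmult)
qed

text \<open>Continuity lets a distribution act termwise. The error for a finite set S of frequencies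
  is u applied to the remaining series; it is bounded by a \<open>test_seminorm\<close> of that
  series and so by the tail of a convergent sum.\<close>

lemma distribution_has_sum:
  assumes u: "u \<in> distributions" and c: "rapid c"
  shows "((\<lambda>\<xi>. c \<xi> * u (cexp \<xi>)) has_sum u (fourier_series c)) UNIV"
proof -
  obtain C m where C: "C \<ge> 0" "\<And>\<phi>. \<phi> \<in> torus_fun \<Longrightarrow> cmod (u \<phi>) \<le> C * test_seminorm m \<phi>"
    using distributions_bound[OF u] by blast
  define F where "F = (\<lambda>\<xi>. cmod (c \<xi>) * japanese \<xi> ^ m)"
  have F: "F summable_on UNIV" using c by (simp add: F_def rapid_def)
  have tail: "cmod ((\<Sum>\<xi>\<in>S. c \<xi> * u (cexp \<xi>)) - u (fourier_series c)) \<le> C * (infsum F UNIV - sum F S)"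
    if S: "finite S" for S
  proof -
    let ?c1 = "\<lambda>\<xi>. if \<xi> \<in> S then c \<xi> else 0" and ?c2 = "\<lambda>\<xi>. if \<xi> \<in> - S then c \<xi> else 0"
    have r: "rapid ?c1" "rapid ?c2" by (rule rapid_if[OF c])+
    have "c = (\<lambda>\<xi>. ?c1 \<xi> + ?c2 \<xi>)" by auto
    then have "u (fourier_series c) = u (fourier_series (\<lambda>\<xi>. ?c1 \<xi> + ?c2 \<xi>))" by simp
    also have "\<dots> = u (fourier_series ?c1) + u (fourier_series ?c2)"
      unfolding fourier_series_add[OF r] by (intro distributionsD(2)[OF u] fourier_series_torus_fun r)
    finally have "cmod ((\<Sum>\<xi>\<in>S. c \<xi> * u (cexp \<xi>)) - u (fourier_series c)) = cmod (u (fourier_series ?c2))"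
      by (simp add: distribution_finite_series[OF u S])
    also have "\<dots> \<le> C * test_seminorm m (fourier_series ?c2)"
      by (intro C fourier_series_torus_fun r)
    also have "\<dots> \<le> C * (\<Sum>\<^sub>\<infinity>\<xi>. cmod (?c2 \<xi>) * japanese \<xi> ^ m)"
      by (intro mult_left_mono test_seminorm_fourier_series_le r C)
    also have "(\<Sum>\<^sub>\<infinity>\<xi>. cmod (?c2 \<xi>) * japanese \<xi> ^ m) = infsum F (UNIV - S)"
      unfolding F_def by (rule infsum_cong_neutral) auto
    also have "\<dots> = infsum F UNIV - sum F S"
      using infsum_Diff[OF F summable_on_finite[OF S], of] S by simp
    finally show ?thesis .
  qed
  have "((\<lambda>S. C * (infsum F UNIV - sum F S)) \<longlongrightarrow> C * (infsum F UNIV - infsum F UNIV)) (finite_subsets_at_top UNIV)"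
    by (intro tendsto_intros infsum_tendsto F)
  then have "((\<lambda>S. (\<Sum>\<xi>\<in>S. c \<xi> * u (cexp \<xi>)) - u (fourier_series c)) \<longlongrightarrow> 0) (finite_subsets_at_top UNIV)"
    by (intro Lim_null_comparison[OF eventually_finite_subsets_at_top_weakI[OF tail]]) auto
  then show ?thesis unfolding has_sum_def by (simp add: LIM_zero_cancel)
qed

text \<open>Expanding a test function in its Fourier series shows that the coefficients determine
  the distribution. This reduces equality of distributions to equality of coefficients.\<close>

lemma distribution_eq_distr_of_coeffs:
  assumes u: "u \<in> distributions"
  shows "u = distr_of_coeffs (fourier_coeff u)"
proof
  fix \<psi>
  show "u \<psi> = distr_of_coeffs (fourier_coeff u) \<psi>"
  proof (cases "\<psi> \<in> torus_fun")
    case True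
    have "((\<lambda>\<xi>. fourier_transform \<psi> \<xi> * u (cexp \<xi>)) has_sum u \<psi>) UNIV"
      using distribution_has_sum[OF u rapid_fourier_transform[OF True]] by (simp add: fourier_inversion True)
    then show ?thesis using True by (simp add: distr_of_coeffs_def fourier_coeff_eq infsumI)
  qed (simp add: distr_of_coeffs_def distributionsD[OF u])
qed

lemma distribution_eqI:
  assumes "u \<in> distributions" "v \<in> distributions" "\<And>\<xi>. fourier_coeff u \<xi> = fourier_coeff v \<xi>"
  shows "u = v"
  using distribution_eq_distr_of_coeffs[OF assms(1)] distribution_eq_distr_of_coeffs[OF assms(2)] assms(3) by (metis ext)

lemma distr_of_coeffs_summable:
  assumes "poly_bounded b" "\<psi> \<in> torus_fun"
  shows "(\<lambda>\<xi>. cmod (fourier_transform \<psi> \<xi> * b (- \<xi>))) summable_on UNIV"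
proof -
  obtain C m where C: "\<And>\<xi>. cmod (b \<xi>) \<le> C * japanese \<xi> ^ m" using assms(1) unfolding poly_bounded_def by blast
  have "rapid (\<lambda>\<xi>. fourier_transform \<psi> \<xi> * b (- \<xi>))"
    by (rule rapid_mult[OF rapid_fourier_transform[OF assms(2)]]) (use C[of "- _"] in auto)
  then show ?thesis by (rule rapid_abs_summable)
qed

lemma distr_of_coeffs_distributions:
  fixes b :: "int ^ 'n::finite \<Rightarrow> complex"
  assumes b: "poly_bounded b" shows "distr_of_coeffs b \<in> distributions"
proof -
  note sm = abs_summable_summable[OF distr_of_coeffs_summable[OF b]]
  obtain C m where C: "\<And>\<xi>. cmod (b \<xi>) \<le> C * japanese \<xi> ^ m" using b unfolding poly_bounded_def by blast
  have C0: "C \<ge> 0" using order.trans[OF norm_ge_zero C[of 0]] by (simp add: japanese_def)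
  have lin: "distr_of_coeffs b (\<lambda>x. c * \<phi> x + d * \<psi> x) = c * distr_of_coeffs b \<phi> + d * distr_of_coeffs b \<psi>"
    if "\<phi> \<in> torus_fun" "\<psi> \<in> torus_fun" for \<phi> \<psi> c d
  proof -
    have "distr_of_coeffs b (\<lambda>x. c * \<phi> x + d * \<psi> x) =
      (\<Sum>\<^sub>\<infinity>\<xi>. c * (fourier_transform \<phi> \<xi> * b (- \<xi>)) + d * (fourier_transform \<psi> \<xi> * b (- \<xi>)))"
      using that by (simp add: distr_of_coeffs_def torus_fun_lincomb fourier_transform_lincomb torus_fun_continuous_on algebra_simps)
    also have "\<dots> = c * distr_of_coeffs b \<phi> + d * distr_of_coeffs b \<psi>"
      using that by (subst infsum_add) (auto intro!: summable_on_cmult_right sm simp: infsum_cmult_right' distr_of_coeffs_def)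
    finally show ?thesis .
  qed
  \<comment> \<open>m derivatives compensate the growth of b, and 2N further ones make the sum over
    the frequencies converge.\<close>
  let ?k = "m + 2 * CARD('n)"
  let ?S = "\<Sum>\<^sub>\<infinity>\<xi> :: int ^ 'n. 1 / japanese \<xi> ^ (2 * CARD('n))"
  have bound: "cmod (distr_of_coeffs b \<phi>) \<le> (C * (1 + real CARD('n)) ^ ?k * ?S) * test_seminorm ?k \<phi>"
    if p: "\<phi> \<in> torus_fun" for \<phi>
  proof -
    have "cmod (distr_of_coeffs b \<phi>) = cmod (\<Sum>\<^sub>\<infinity>\<xi>. fourier_transform \<phi> \<xi> * b (- \<xi>))"
      using p by (simp add: distr_of_coeffs_def)
    also have "\<dots> \<le> (\<Sum>\<^sub>\<infinity>\<xi> :: int ^ 'n. (C * (1 + real CARD('n)) ^ ?k * test_seminorm ?k \<phi>) * (1 / japanese \<xi> ^ (2 * CARD('n))))"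
    proof (rule norm_infsum_le_infsum)
      show "(\<lambda>\<xi> :: int ^ 'n. (C * (1 + real CARD('n)) ^ ?k * test_seminorm ?k \<phi>) * (1 / japanese \<xi> ^ (2 * CARD('n)))) summable_on UNIV"
        by (intro summable_on_cmult_right summable_on_japanese)
      fix \<xi> :: "int ^ 'n"
      have "cmod (fourier_transform \<phi> \<xi> * b (- \<xi>)) \<le> cmod (fourier_transform \<phi> \<xi>) * (C * japanese \<xi> ^ m)"
        using C[of "- \<xi>"] by (simp add: norm_mult mult_left_mono)
      also have "\<dots> = C * (cmod (fourier_transform \<phi> \<xi>) * japanese \<xi> ^ ?k) / japanese \<xi> ^ (2 * CARD('n))"
        by (simp add: power_add)
      also have "\<dots> \<le> C * ((1 + real CARD('n)) ^ ?k * test_seminorm ?k \<phi>) / japanese \<xi> ^ (2 * CARD('n))"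
        by (intro divide_right_mono mult_left_mono norm_fourier_transform_decay p C0) auto
      finally show "cmod (fourier_transform \<phi> \<xi> * b (- \<xi>)) \<le> (C * (1 + real CARD('n)) ^ ?k * test_seminorm ?k \<phi>) * (1 / japanese \<xi> ^ (2 * CARD('n)))"
        by (simp add: mult.assoc)
    qed
    also have "\<dots> = (C * (1 + real CARD('n)) ^ ?k * ?S) * test_seminorm ?k \<phi>"
      by (subst infsum_cmult_right') (simp add: mult_ac)
    finally show ?thesis .
  qed
  show ?thesis
    unfolding distributions_def
  proof (intro CollectI conjI allI ballI impI)
    show "distr_of_coeffs b \<phi> = 0" if "\<phi> \<notin> torus_fun" for \<phi> using that by (simp add: distr_of_coeffs_def)
    show "distr_of_coeffs b (\<lambda>x. \<phi> x + \<psi> x) = distr_of_coeffs b \<phi> + distr_of_coeffs b \<psi>"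
      if "\<phi> \<in> torus_fun" "\<psi> \<in> torus_fun" for \<phi> \<psi> using lin[OF that, of 1 1] by simp
    show "distr_of_coeffs b (\<lambda>x. c * \<phi> x) = c * distr_of_coeffs b \<phi>"
      if "\<phi> \<in> torus_fun" for \<phi> c using lin[OF that that, of c 0] by simp
    show "\<exists>C m. \<forall>\<phi>\<in>torus_fun. cmod (distr_of_coeffs b \<phi>) \<le> C * test_seminorm m \<phi>"
      using bound by blast
  qed
qed

lemma fourier_transform_cexp: "fourier_transform (cexp \<xi>) \<eta> = (if \<eta> = \<xi> then 1 else 0)"
  unfolding cexp_eq_fourier_series by (rule fourier_transform_fourier_series[OF rapid_abs_summable[OF rapid_single]])

lemma fourier_coeff_distr_of_coeffs: "fourier_coeff (distr_of_coeffs b) \<xi> = b \<xi>"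
proof -
  have "fourier_coeff (distr_of_coeffs b) \<xi> = (\<Sum>\<^sub>\<infinity>\<eta>. (if \<eta> = - \<xi> then 1 else 0) * b (- \<eta>))"
    by (simp add: fourier_coeff_eq distr_of_coeffs_def fourier_transform_cexp)
  also have "\<dots> = (\<Sum>\<^sub>\<infinity>\<eta>\<in>{- \<xi>}. b (- \<eta>))"
    by (rule infsum_cong_neutral) auto
  finally show ?thesis by simp
qed

lemma fourier_coeff_distr_of: "fourier_coeff (distr_of \<phi>) \<xi> = fourier_transform \<phi> \<xi>"
  by (simp add: fourier_coeff_eq distr_of_def fourier_transform_def)

lemma distributions_lincomb:
  assumes "u \<in> distributions" "v \<in> distributions"
  shows "(\<lambda>\<phi>. a * u \<phi> + b * v \<phi>) \<in> distributions"
proof -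
  obtain C m D k where C: "C \<ge> 0" "\<And>\<phi>. \<phi> \<in> torus_fun \<Longrightarrow> cmod (u \<phi>) \<le> C * test_seminorm m \<phi>"
    and D: "D \<ge> 0" "\<And>\<phi>. \<phi> \<in> torus_fun \<Longrightarrow> cmod (v \<phi>) \<le> D * test_seminorm k \<phi>"
    using distributions_bound[OF assms(1)] distributions_bound[OF assms(2)] by blast
  have "cmod (a * u \<phi> + b * v \<phi>) \<le> (cmod a * C + cmod b * D) * test_seminorm (max m k) \<phi>"
    if p: "\<phi> \<in> torus_fun" for \<phi>
  proof -
    have "cmod (a * u \<phi> + b * v \<phi>) \<le> cmod a * cmod (u \<phi>) + cmod b * cmod (v \<phi>)"
      by (metis norm_mult norm_triangle_ineq)
    also have "\<dots> \<le> cmod a * (C * test_seminorm (max m k) \<phi>) + cmod b * (D * test_seminorm (max m k) \<phi>)"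
    proof (intro add_mono mult_left_mono)
      show "cmod (u \<phi>) \<le> C * test_seminorm (max m k) \<phi>"
        by (rule order.trans[OF C(2)[OF p]]) (intro mult_left_mono test_seminorm_mono p C, simp)
      show "cmod (v \<phi>) \<le> D * test_seminorm (max m k) \<phi>"
        by (rule order.trans[OF D(2)[OF p]]) (intro mult_left_mono test_seminorm_mono p D, simp)
    qed auto
    finally show ?thesis by (simp add: algebra_simps)
  qed
  then have bound: "\<exists>C m. \<forall>\<phi>\<in>torus_fun. cmod (a * u \<phi> + b * v \<phi>) \<le> C * test_seminorm m \<phi>"
    by blast
  show ?thesis
    unfolding distributions_def
    by (intro CollectI conjI bound) (simp_all add: distributionsD[OF assms(1)] distributionsD[OF assms(2)] algebra_simps)
qed

subsection \<open>Sobolev spaces and continuous curves\<close>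

lemma sum_squares_le_L2_set_bound:
  assumes "L2_set h F \<le> B" shows "(\<Sum>\<xi>\<in>F. (h \<xi>)\<^sup>2) \<le> B\<^sup>2"
proof -
  have "(L2_set h F)\<^sup>2 \<le> B\<^sup>2" by (intro power_mono assms L2_set_nonneg)
  then show ?thesis by (simp add: L2_set_def sum_nonneg)
qed

text \<open>Norm inequalities are proved for finite sets of frequencies, where \<open>L2_set\<close>
  satisfies the triangle inequality; a uniform bound over these sets passes to the full
  lattice.\<close>

lemma L2_set_bounded_summable:
  fixes h :: "'a \<Rightarrow> real"
  assumes "\<And>F. finite F \<Longrightarrow> L2_set h F \<le> B"
  shows "(\<lambda>\<xi>. (h \<xi>)\<^sup>2) summable_on UNIV"
  by (intro nonneg_bdd_above_summable_on bdd_aboveI2[of _ _ "B\<^sup>2"])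
     (auto intro: sum_squares_le_L2_set_bound assms)

definition sobolev_coeff :: "real \<Rightarrow> 'n::finite distr \<Rightarrow> int ^ 'n \<Rightarrow> real" where
  "sobolev_coeff r u \<xi> = cmod (fourier_coeff u \<xi>) * japanese \<xi> powr r"

lemma sobolev_coeff_nonneg [simp]: "0 \<le> sobolev_coeff r u \<xi>"
  by (simp add: sobolev_coeff_def)

lemma sobolev_coeff_squared:
  "(cmod (fourier_coeff u \<xi>))\<^sup>2 * (1 + norm (int_vec \<xi>)) powr (2 * r) = (sobolev_coeff r u \<xi>)\<^sup>2"
proof -
  have "japanese \<xi> powr (2 * r) = (japanese \<xi> powr r)\<^sup>2"
    by (simp add: power2_eq_square powr_add[symmetric])
  then show ?thesis by (simp add: sobolev_coeff_def power_mult_distrib japanese_def)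
qed

lemma sobolev_iff: "u \<in> sobolev r \<longleftrightarrow> u \<in> distributions \<and> (\<lambda>\<xi>. (sobolev_coeff r u \<xi>)\<^sup>2) summable_on UNIV"
  by (simp add: sobolev_def sobolev_coeff_squared)

lemma sobolev_norm_eq: "sobolev_norm r u = sqrt (\<Sum>\<^sub>\<infinity>\<xi>. (sobolev_coeff r u \<xi>)\<^sup>2)"
  by (simp add: sobolev_norm_def sobolev_coeff_squared)

lemma sobolev_norm_nonneg [simp]: "0 \<le> sobolev_norm r u"
  by (simp add: sobolev_norm_eq infsum_nonneg)

lemma sobolev_distributions: "u \<in> sobolev r \<Longrightarrow> u \<in> distributions"
  by (simp add: sobolev_iff)

text \<open>Combines membership with the norm bound, so that one estimate over finite sets of
  frequencies yields both.\<close>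

lemma sobolevI_L2_set:
  assumes u: "u \<in> distributions" and B: "\<And>F. finite F \<Longrightarrow> L2_set (sobolev_coeff r u) F \<le> B"
  shows "u \<in> sobolev r" "sobolev_norm r u \<le> B"
proof -
  have B0: "B \<ge> 0" using B[of "{}"] by simp
  have s: "(\<lambda>\<xi>. (sobolev_coeff r u \<xi>)\<^sup>2) summable_on UNIV"
    by (rule L2_set_bounded_summable[OF B])
  then show "u \<in> sobolev r" using u by (simp add: sobolev_iff)
  have "(\<Sum>\<^sub>\<infinity>\<xi>. (sobolev_coeff r u \<xi>)\<^sup>2) \<le> B\<^sup>2"
    by (rule infsum_le_finite_sums[OF s]) (rule sum_squares_le_L2_set_bound[OF B])
  then show "sobolev_norm r u \<le> B"
    unfolding sobolev_norm_eq using B0 real_le_lsqrt by (simp add: real_sqrt_le_iff real_le_lsqrt)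
qed

lemma L2_set_le_sobolev_norm:
  assumes "u \<in> sobolev r" shows "L2_set (sobolev_coeff r u) F \<le> sobolev_norm r u"
proof (cases "finite F")
  case True
  then show ?thesis unfolding L2_set_def sobolev_norm_eq using assms
    by (auto simp: sobolev_iff intro!: finite_sum_le_infsum)
qed simp

lemma sobolev_coeff_le_norm: "u \<in> sobolev r \<Longrightarrow> sobolev_coeff r u \<xi> \<le> sobolev_norm r u"
  using L2_set_le_sobolev_norm[of u r "{\<xi>}"] by simp

lemma fourier_coeff_lincomb: "fourier_coeff (\<lambda>\<phi>. a * u \<phi> + b * v \<phi>) \<xi> = a * fourier_coeff u \<xi> + b * fourier_coeff v \<xi>"
  and fourier_coeff_diff: "fourier_coeff (\<lambda>\<phi>. u \<phi> - v \<phi>) \<xi> = fourier_coeff u \<xi> - fourier_coeff v \<xi>"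
  by (simp_all add: fourier_coeff_def)

lemma sobolev_lincomb:
  assumes "u \<in> sobolev r" "v \<in> sobolev r"
  shows "(\<lambda>\<phi>. a * u \<phi> + b * v \<phi>) \<in> sobolev r"
    and "sobolev_norm r (\<lambda>\<phi>. a * u \<phi> + b * v \<phi>) \<le> cmod a * sobolev_norm r u + cmod b * sobolev_norm r v"
proof -
  let ?w = "\<lambda>\<phi>. a * u \<phi> + b * v \<phi>"
  have d: "?w \<in> distributions" by (intro distributions_lincomb sobolev_distributions[OF assms(1)] sobolev_distributions[OF assms(2)])
  have "L2_set (sobolev_coeff r ?w) F \<le> cmod a * sobolev_norm r u + cmod b * sobolev_norm r v" if "finite F" for F
  proof -
    have "L2_set (sobolev_coeff r ?w) F \<le> L2_set (\<lambda>\<xi>. cmod a * sobolev_coeff r u \<xi> + cmod b * sobolev_coeff r v \<xi>) F"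
    proof (rule L2_set_mono)
      fix \<xi>
      have "cmod (a * fourier_coeff u \<xi> + b * fourier_coeff v \<xi>) \<le> cmod a * cmod (fourier_coeff u \<xi>) + cmod b * cmod (fourier_coeff v \<xi>)"
        by (metis norm_mult norm_triangle_ineq)
      from mult_right_mono[OF this, of "japanese \<xi> powr r"]
      show "sobolev_coeff r ?w \<xi> \<le> cmod a * sobolev_coeff r u \<xi> + cmod b * sobolev_coeff r v \<xi>"
        by (simp add: sobolev_coeff_def fourier_coeff_lincomb algebra_simps)
    qed simp
    also have "\<dots> \<le> L2_set (\<lambda>\<xi>. cmod a * sobolev_coeff r u \<xi>) F + L2_set (\<lambda>\<xi>. cmod b * sobolev_coeff r v \<xi>) F"
      by (rule L2_set_triangle_ineq)
    also have "\<dots> = cmod a * L2_set (sobolev_coeff r u) F + cmod b * L2_set (sobolev_coeff r v) F"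
      by (simp add: L2_set_right_distrib)
    also have "\<dots> \<le> cmod a * sobolev_norm r u + cmod b * sobolev_norm r v"
      by (intro add_mono mult_left_mono L2_set_le_sobolev_norm assms) auto
    finally show ?thesis .
  qed
  from sobolevI_L2_set[OF d this]
  show "?w \<in> sobolev r" "sobolev_norm r ?w \<le> cmod a * sobolev_norm r u + cmod b * sobolev_norm r v" by auto
qed

lemma sobolev_diff:
  assumes "u \<in> sobolev r" "v \<in> sobolev r" shows "(\<lambda>\<phi>. u \<phi> - v \<phi>) \<in> sobolev r"
  using sobolev_lincomb(1)[OF assms, of 1 "-1"] by simp

lemma sobolev_cmult: "u \<in> sobolev r \<Longrightarrow> (\<lambda>\<phi>. c * u \<phi>) \<in> sobolev r"
  using sobolev_lincomb(1)[of u r u c 0] by simp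

lemma sobolev_norm_triangle:
  assumes "u \<in> sobolev r" "v \<in> sobolev r"
  shows "sobolev_norm r (\<lambda>\<phi>. u \<phi> + v \<phi>) \<le> sobolev_norm r u + sobolev_norm r v"
  using sobolev_lincomb(2)[OF assms, of 1 1] by simp

lemma sobolev_norm_cmult: "sobolev_norm r (\<lambda>\<phi>. c * u \<phi>) = cmod c * sobolev_norm r u"
proof -
  have "sobolev_coeff r (\<lambda>\<phi>. c * u \<phi>) \<xi> = cmod c * sobolev_coeff r u \<xi>" for \<xi>
    by (simp add: sobolev_coeff_def fourier_coeff_def norm_mult)
  then show ?thesis
    by (simp add: sobolev_norm_eq power_mult_distrib infsum_cmult_right' real_sqrt_mult)
qed

text \<open>Required before the topology of \<open>sobolev_top\<close> can be unfolded. Definiteness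
  holds because distance 0 forces all coefficients to agree, and these determine a
  distribution.\<close>

lemma sobolev_metric_space: "Metric_space (sobolev r) (\<lambda>u v. sobolev_norm r (\<lambda>\<phi>. u \<phi> - v \<phi>))"
proof
  fix u v w :: "'a distr"
  show "0 \<le> sobolev_norm r (\<lambda>\<phi>. u \<phi> - v \<phi>)" by simp
  show "sobolev_norm r (\<lambda>\<phi>. u \<phi> - v \<phi>) = sobolev_norm r (\<lambda>\<phi>. v \<phi> - u \<phi>)"
    using sobolev_norm_cmult[of r "-1" "\<lambda>\<phi>. v \<phi> - u \<phi>"] by simp
  assume u: "u \<in> sobolev r" and v: "v \<in> sobolev r"
  show "sobolev_norm r (\<lambda>\<phi>. u \<phi> - v \<phi>) = 0 \<longleftrightarrow> u = v"
  proof
    assume 0: "sobolev_norm r (\<lambda>\<phi>. u \<phi> - v \<phi>) = 0"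
    have "fourier_coeff u \<xi> = fourier_coeff v \<xi>" for \<xi>
      using sobolev_coeff_le_norm[OF sobolev_diff[OF u v], of \<xi>] sobolev_coeff_nonneg[of r "\<lambda>\<phi>. u \<phi> - v \<phi>" \<xi>]
      unfolding 0 by (simp add: sobolev_coeff_def fourier_coeff_diff mult_le_0_iff)
    then show "u = v" using distribution_eqI sobolev_distributions u v by blast
  next
    assume "u = v"
    then show "sobolev_norm r (\<lambda>\<phi>. u \<phi> - v \<phi>) = 0"
      by (simp add: sobolev_norm_eq sobolev_coeff_def fourier_coeff_def)
  qed
  assume w: "w \<in> sobolev r"
  show "sobolev_norm r (\<lambda>\<phi>. u \<phi> - w \<phi>) \<le> sobolev_norm r (\<lambda>\<phi>. u \<phi> - v \<phi>) + sobolev_norm r (\<lambda>\<phi>. v \<phi> - w \<phi>)"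
    using sobolev_norm_triangle[OF sobolev_diff[OF u v] sobolev_diff[OF v w]] by simp
qed

section \<open>Convergence in the Sobolev and smooth topologies\<close>

lemma topspace_sobolev_top [simp]: "topspace (sobolev_top r) = sobolev r"
  by (simp add: sobolev_top_def Metric_space.topspace_mtopology[OF sobolev_metric_space])

lemma limitin_sobolev_top:
  "limitin (sobolev_top r) f l F \<longleftrightarrow>
     l \<in> sobolev r \<and> (\<forall>e>0. \<forall>\<^sub>F x in F. f x \<in> sobolev r \<and> sobolev_norm r (\<lambda>\<phi>. f x \<phi> - l \<phi>) < e)"
  unfolding sobolev_top_def by (rule Metric_space.limitin_metric[OF sobolev_metric_space])

lemma atin_top_of_set: "t \<in> S \<Longrightarrow> atin (top_of_set S) t = at t within S"
  unfolding filter_eq_iff atin_subtopology_within eventually_atin_within eventually_at_topological by auto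

lemma C0_curves_iff:
  "u \<in> C0_curves T X \<longleftrightarrow> u \<in> extensional {0..T} \<and> (\<forall>t\<in>{0..T}. limitin X u (u t) (at t within {0..T}))"
  by (simp add: C0_curves_def continuous_map_atin atin_top_of_set)

lemma C0_curvesD: 
  assumes "u \<in> C0_curves T X"
  shows "t \<in> {0..T} \<Longrightarrow> u t \<in> topspace X" "t \<in> {0..T} \<Longrightarrow> limitin X u (u t) (at t within {0..T})" "u \<in> extensional {0..T}"
  using assms by (auto simp: C0_curves_iff dest: limitin_topspace)

text \<open>Convergence may be tested on a subbasis, as the sets that pass the test are stable under
  finite intersections and arbitrary unions. Both \<open>Cinf_top\<close> and
  \<open>gevrey_top\<close> are given by subbases.\<close>

lemma limitin_topology_generated_by:
  "limitin (topology_generated_by S) f l F \<longleftrightarrow> l \<in> \<Union>S \<and> (\<forall>U\<in>S. l \<in> U \<longrightarrow> (\<forall>\<^sub>F x in F. f x \<in> U))"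
proof (intro iffI conjI ballI impI)
  assume *: "limitin (topology_generated_by S) f l F"
  then show "l \<in> \<Union>S" by (auto dest: limitin_topspace)
  show "\<forall>\<^sub>F x in F. f x \<in> U" if "U \<in> S" "l \<in> U" for U
    using * topology_generated_by_Basis[OF that(1)] that(2) by (auto simp: limitin_def)
next
  assume *: "l \<in> \<Union>S \<and> (\<forall>U\<in>S. l \<in> U \<longrightarrow> (\<forall>\<^sub>F x in F. f x \<in> U))"
  have "l \<in> U \<longrightarrow> (\<forall>\<^sub>F x in F. f x \<in> U)" if "generate_topology_on S U" for U
    using that
  proof induction
    case (Int a b)
    then show ?case by (auto elim: eventually_elim2)
  next
    case (UN K)
    show ?case
    proof
      assume "l \<in> \<Union> K"
      then obtain k where k: "k \<in> K" "l \<in> k" by blast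
      then have "\<forall>\<^sub>F x in F. f x \<in> k" using UN by blast
      then show "\<forall>\<^sub>F x in F. f x \<in> \<Union> K" by (rule eventually_mono) (use k in blast)
    qed
  qed (use * in auto)
  then show "limitin (topology_generated_by S) f l F"
    unfolding limitin_def topology_generated_by_topspace openin_topology_generated_by_iff using * by (elim conjE) (intro conjI allI impI, auto)
qed

text \<open>The whole Sobolev space, taken as the open set, shows that the values eventually lie in
  \<open>Cinf\<close>; the other open sets give convergence in each Sobolev norm.\<close>

lemma limitin_Cinf_top:
  "limitin Cinf_top f l F \<longleftrightarrow> l \<in> Cinf \<and> (\<forall>\<^sub>F x in F. f x \<in> Cinf) \<and>
     (\<forall>r. \<forall>e>0. \<forall>\<^sub>F x in F. sobolev_norm r (\<lambda>\<phi>. f x \<phi> - l \<phi>) < e)"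
proof -
  have top: "openin (sobolev_top r) (sobolev r :: 'a distr set)" for r
    using openin_topspace[of "sobolev_top r :: 'a distr topology"] by simp
  have Un: "\<Union> {U \<inter> Cinf | r U. openin (sobolev_top r) U} = (Cinf :: 'a distr set)"
    using top by (auto simp: Cinf_def) 
  have "limitin Cinf_top f l F \<longleftrightarrow> l \<in> Cinf \<and> (\<forall>r U. openin (sobolev_top r) U \<and> l \<in> U \<longrightarrow> (\<forall>\<^sub>F x in F. f x \<in> U \<inter> Cinf))"
    unfolding Cinf_top_def limitin_topology_generated_by Un by blast
  also have "\<dots> \<longleftrightarrow> l \<in> Cinf \<and> (\<forall>\<^sub>F x in F. f x \<in> Cinf) \<and> (\<forall>r. limitin (sobolev_top r) f l F)"
    using top unfolding limitin_def by (fastforce simp: Cinf_def eventually_conj_iff)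
  also have "\<dots> \<longleftrightarrow> l \<in> Cinf \<and> (\<forall>\<^sub>F x in F. f x \<in> Cinf) \<and>
     (\<forall>r. \<forall>e>0. \<forall>\<^sub>F x in F. sobolev_norm r (\<lambda>\<phi>. f x \<phi> - l \<phi>) < e)"
    unfolding limitin_sobolev_top by (auto simp: Cinf_def eventually_conj_iff elim: eventually_mono)
  finally show ?thesis .
qed

lemma limitin_Cinf_sobolev_top: "limitin Cinf_top f l F \<Longrightarrow> limitin (sobolev_top r) f l F"
  unfolding limitin_Cinf_top limitin_sobolev_top by (auto simp: Cinf_def eventually_conj_iff elim: eventually_mono)

lemma C0_curves_Cinf_sobolev: "u \<in> C0_curves T Cinf_top \<Longrightarrow> u \<in> C0_curves T (sobolev_top r)"
  unfolding C0_curves_iff using limitin_Cinf_sobolev_top by blast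

lemma sobolev_mono:
  assumes "u \<in> sobolev r" "r' \<le> r"
  shows "u \<in> sobolev r'" "sobolev_norm r' u \<le> sobolev_norm r u"
proof -
  have "L2_set (sobolev_coeff r' u) F \<le> sobolev_norm r u" for F
  proof -
    have "L2_set (sobolev_coeff r' u) F \<le> L2_set (sobolev_coeff r u) F"
      by (rule L2_set_mono) (auto simp: sobolev_coeff_def intro!: mult_left_mono powr_mono assms)
    also have "\<dots> \<le> sobolev_norm r u" by (rule L2_set_le_sobolev_norm[OF assms(1)])
    finally show ?thesis .
  qed
  from sobolevI_L2_set[OF sobolev_distributions[OF assms(1)] this]
  show "u \<in> sobolev r'" "sobolev_norm r' u \<le> sobolev_norm r u" by auto
qed

lemma limitin_sobolev_mono:
  assumes "limitin (sobolev_top r) f l F" "r' \<le> r" shows "limitin (sobolev_top r') f l F"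
proof -
  have l: "l \<in> sobolev r" using assms(1) by (simp add: limitin_sobolev_top)
  have "\<forall>\<^sub>F x in F. f x \<in> sobolev r' \<and> sobolev_norm r' (\<lambda>\<phi>. f x \<phi> - l \<phi>) < e" if "e > 0" for e
  proof -
    have "\<forall>\<^sub>F x in F. f x \<in> sobolev r \<and> sobolev_norm r (\<lambda>\<phi>. f x \<phi> - l \<phi>) < e"
      using assms(1) that by (simp add: limitin_sobolev_top)
    then show ?thesis
      by (rule eventually_mono) (use sobolev_mono[OF _ assms(2)] sobolev_diff[OF _ l] order.strict_trans1 in blast)
  qed
  then show ?thesis using sobolev_mono[OF l assms(2)] by (simp add: limitin_sobolev_top)
qed

lemma C0_curves_sobolev_mono: "u \<in> C0_curves T (sobolev_top r) \<Longrightarrow> r' \<le> r \<Longrightarrow> u \<in> C0_curves T (sobolev_top r')"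
  unfolding C0_curves_iff using limitin_sobolev_mono by blast

lemma sobolev_distr_of_coeffs:
  fixes b :: "int ^ 'n::finite \<Rightarrow> complex"
  assumes B: "\<And>F. finite F \<Longrightarrow> L2_set (\<lambda>\<xi>. cmod (b \<xi>) * japanese \<xi> powr r) F \<le> B"
  shows "distr_of_coeffs b \<in> sobolev r" "sobolev_norm r (distr_of_coeffs b) \<le> B"
proof -
  have B0: "B \<ge> 0" using B[of "{}"] by simp
  obtain m where m: "- r \<le> real m" using real_arch_simple by blast
  have "cmod (b \<xi>) \<le> B * japanese \<xi> ^ m" for \<xi>
  proof -
    \<comment> \<open>The bound for singletons shows that b grows at most like the power -r of
      \<open>japanese\<close>, so that it defines a distribution at all.\<close>
    have "cmod (b \<xi>) * japanese \<xi> powr r \<le> B" using B[of "{\<xi>}"] by simp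
    then have "cmod (b \<xi>) * japanese \<xi> powr r * japanese \<xi> powr (- r) \<le> B * japanese \<xi> powr (- r)"
      by (rule mult_right_mono) simp
    then have "cmod (b \<xi>) \<le> B * japanese \<xi> powr (- r)"
      by (simp add: mult.assoc powr_add[symmetric])
    also have "\<dots> \<le> B * japanese \<xi> powr (real m)"
      by (intro mult_left_mono powr_mono m B0) auto
    finally show ?thesis by (simp add: powr_realpow)
  qed
  then have d: "distr_of_coeffs b \<in> distributions"
    by (intro distr_of_coeffs_distributions) (auto simp: poly_bounded_def)
  have "L2_set (sobolev_coeff r (distr_of_coeffs b)) F \<le> B" if "finite F" for F
    using B[OF that] by (simp add: sobolev_coeff_def[abs_def] fourier_coeff_distr_of_coeffs)
  from sobolevI_L2_set[OF d this]
  show "distr_of_coeffs b \<in> sobolev r" "sobolev_norm r (distr_of_coeffs b) \<le> B" by auto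
qed

text \<open>A single coefficient is at most \<open>japanese \<xi> powr (- r)\<close> times the
  Sobolev norm, which explains the tolerance e times \<open>japanese \<xi> powr r\<close> in the
  proof.\<close>

lemma C0_curves_fourier_coeff_continuous:
  assumes u: "u \<in> C0_curves T (sobolev_top r)"
  shows "continuous_on {0..T} (\<lambda>t. fourier_coeff (u t) \<xi>)"
  unfolding continuous_on_def
proof
  fix t assume t: "t \<in> {0..T}"
  have lim: "limitin (sobolev_top r) u (u t) (at t within {0..T})" by (rule C0_curvesD(2)[OF u t])
  show "((\<lambda>t. fourier_coeff (u t) \<xi>) \<longlongrightarrow> fourier_coeff (u t) \<xi>) (at t within {0..T})"
  proof (rule tendstoI)
    fix e :: real assume e: "e > 0"
    have "\<forall>\<^sub>F x in at t within {0..T}. u x \<in> sobolev r \<and> sobolev_norm r (\<lambda>\<phi>. u x \<phi> - u t \<phi>) < e * japanese \<xi> powr r"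
      using lim e by (simp add: limitin_sobolev_top)
    then show "\<forall>\<^sub>F x in at t within {0..T}. dist (fourier_coeff (u x) \<xi>) (fourier_coeff (u t) \<xi>) < e"
    proof (rule eventually_mono)
      fix x assume x: "u x \<in> sobolev r \<and> sobolev_norm r (\<lambda>\<phi>. u x \<phi> - u t \<phi>) < e * japanese \<xi> powr r"
      have "(\<lambda>\<phi>. u x \<phi> - u t \<phi>) \<in> sobolev r"
        using x lim by (intro sobolev_diff) (auto simp: limitin_sobolev_top)
      from sobolev_coeff_le_norm[OF this, of \<xi>] x
      show "dist (fourier_coeff (u x) \<xi>) (fourier_coeff (u t) \<xi>) < e"
        by (auto simp: sobolev_coeff_def fourier_coeff_diff dist_norm dest: order.strict_trans1)
    qed
  qed
qed

lemma C0_curves_sobolev_norm_continuous: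
  assumes u: "u \<in> C0_curves T (sobolev_top r)"
  shows "continuous_on {0..T} (\<lambda>t. sobolev_norm r (u t))"
  unfolding continuous_on_def
proof
  fix t assume t: "t \<in> {0..T}"
  have lim: "limitin (sobolev_top r) u (u t) (at t within {0..T})" by (rule C0_curvesD(2)[OF u t])
  show "((\<lambda>t. sobolev_norm r (u t)) \<longlongrightarrow> sobolev_norm r (u t)) (at t within {0..T})"
  proof (rule tendstoI)
    fix e :: real assume e: "e > 0"
    have "\<forall>\<^sub>F x in at t within {0..T}. u x \<in> sobolev r \<and> sobolev_norm r (\<lambda>\<phi>. u x \<phi> - u t \<phi>) < e"
      using lim e by (simp add: limitin_sobolev_top)
    then show "\<forall>\<^sub>F x in at t within {0..T}. dist (sobolev_norm r (u x)) (sobolev_norm r (u t)) < e"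
    proof (rule eventually_mono)
      fix x assume x: "u x \<in> sobolev r \<and> sobolev_norm r (\<lambda>\<phi>. u x \<phi> - u t \<phi>) < e"
      have ut: "u t \<in> sobolev r" using lim by (simp add: limitin_sobolev_top)
      have d: "sobolev_norm r (\<lambda>\<phi>. u t \<phi> - u x \<phi>) = sobolev_norm r (\<lambda>\<phi>. u x \<phi> - u t \<phi>)"
        using sobolev_norm_cmult[of r "-1" "\<lambda>\<phi>. u x \<phi> - u t \<phi>"] by simp
      have "sobolev_norm r (u x) \<le> sobolev_norm r (\<lambda>\<phi>. u x \<phi> - u t \<phi>) + sobolev_norm r (u t)"
        using sobolev_norm_triangle[OF sobolev_diff ut, of "u x" "u t"] x ut by simp
      moreover have "sobolev_norm r (u t) \<le> sobolev_norm r (\<lambda>\<phi>. u t \<phi> - u x \<phi>) + sobolev_norm r (u x)"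
        using sobolev_norm_triangle[OF sobolev_diff, of "u t" r "u x" "u x"] x ut by simp
      ultimately show "dist (sobolev_norm r (u x)) (sobolev_norm r (u t)) < e"
        using x d unfolding dist_real_def by linarith
    qed
  qed
qed

subsection \<open>Test functions in time\<close>

text \<open>One term of the exponential series. The same bound later compares powers of |xi| with
  Gevrey weights.\<close>

lemma power_le_fact_exp: "0 \<le> (y::real) \<Longrightarrow> y ^ k \<le> fact k * exp y"
proof -
  assume y: "0 \<le> y"
  have "(\<Sum>n\<in>{k}. y ^ n /\<^sub>R fact n) \<le> exp y"
    unfolding exp_def using y by (intro sum_le_suminf summable_exp_generic) auto
  then show ?thesis by (simp add: field_simps)
qed

text \<open>The functions x^(-n) exp(-1/x), extended by 0. Powers of 1/x are included so that the
  derivative of \<open>flat n\<close> stays in the linear span of the family.\<close>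

definition flat :: "nat \<Rightarrow> real \<Rightarrow> real" where
  "flat n x = (if x > 0 then (1 / x) ^ n * exp (- (1 / x)) else 0)"

text \<open>From (1/x)^(n+2) <= (n+2)! exp(1/x). The two extra powers of 1/x give quadratic flatness
  at 0, so the derivative there is 0 for every n.\<close>

lemma flat_bound: "\<bar>flat n x\<bar> \<le> fact (n + 2) * x\<^sup>2"
proof (cases "x > 0")
  case True
  have "(1 / x) ^ (n + 2) \<le> fact (n + 2) * exp (1 / x)"
    by (rule power_le_fact_exp) (use True in simp)
  then have "(1 / x) ^ (n + 2) * exp (- (1 / x)) \<le> fact (n + 2) * exp (1 / x) * exp (- (1 / x))"
    by (rule mult_right_mono) simp
  also have "fact (n + 2) * exp (1 / x) * exp (- (1 / x)) = fact (n + 2)"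
    by (simp add: exp_minus)
  finally have "(1 / x) ^ (n + 2) * exp (- (1 / x)) * x\<^sup>2 \<le> fact (n + 2) * x\<^sup>2"
    by (rule mult_right_mono) simp
  moreover have "(1 / x) ^ (n + 2) * exp (- (1 / x)) * x\<^sup>2 = flat n x"
    using True by (simp add: flat_def power_add power_divide power2_eq_square)
  ultimately show ?thesis using True by (simp add: flat_def)
qed (simp add: flat_def)

lemma flat_has_derivative:
  "(flat n has_real_derivative (- real n * flat (n + 1) x + flat (n + 2) x)) (at x)"
proof -
  consider "x > 0" | "x < 0" | "x = 0" by linarith
  then show ?thesis
  proof cases
    case 1
    have "((\<lambda>x. (1 / x) ^ n * exp (- (1 / x))) has_real_derivative
       (- real n * flat (n + 1) x + flat (n + 2) x)) (at x)"
      using 1 by (auto intro!: derivative_eq_intros simp: flat_def field_simps power2_eq_square)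
        (cases n; simp add: field_simps power2_eq_square)
    moreover have "\<forall>\<^sub>F y in nhds x. flat n y = (1 / y) ^ n * exp (- (1 / y))"
      by (rule eventually_nhds_in_open[of "{0<..}", THEN eventually_mono]) (use 1 in \<open>auto simp: flat_def\<close>)
    ultimately show ?thesis by (subst DERIV_cong_ev[OF refl _ refl])
  next
    case 2
    have "\<forall>\<^sub>F y in nhds x. flat n y = 0"
      by (rule eventually_nhds_in_open[of "{..<0}", THEN eventually_mono]) (use 2 in \<open>auto simp: flat_def\<close>)
    moreover have "((\<lambda>_. 0) has_real_derivative (- real n * flat (n + 1) x + flat (n + 2) x)) (at x)"
      using 2 by (simp add: flat_def)
    ultimately show ?thesis by (subst DERIV_cong_ev[OF refl _ refl])
  next
    case 3
    have "((\<lambda>h. (flat n (0 + h) - flat n 0) / h) \<longlongrightarrow> 0) (at 0)"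
    proof (rule Lim_null_comparison)
      show "\<forall>\<^sub>F h in at 0. norm ((flat n (0 + h) - flat n 0) / h) \<le> fact (n + 2) * \<bar>h\<bar>"
      proof (rule always_eventually, rule allI)
        fix h :: real
        show "norm ((flat n (0 + h) - flat n 0) / h) \<le> fact (n + 2) * \<bar>h\<bar>"
          using flat_bound[of n h] by (cases "h = 0") (auto simp: flat_def divide_simps power2_eq_square abs_mult[symmetric] mult.assoc)
      qed
      show "((\<lambda>h::real. fact (n + 2) * \<bar>h\<bar>) \<longlongrightarrow> 0) (at 0)"
        by (intro tendsto_eq_intros) auto
    qed
    then show ?thesis using 3 by (simp add: DERIV_def flat_def)
  qed
qed

text \<open>On the real line the derivative in direction v is v times the ordinary one, so the
  invariant class consists of the real multiples of members of S.\<close>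

lemma smooth_real_coinduct:
  fixes f :: "real \<Rightarrow> complex"
  assumes "f \<in> S" and step: "\<And>f. f \<in> S \<Longrightarrow> \<exists>f'\<in>S. \<forall>x. (f has_vector_derivative f' x) (at x)"
  shows "smooth f"
proof (rule smooth_coinduct)
  show "f \<in> {\<lambda>x. of_real c * f x | c f. f \<in> S}"
    using assms(1) by (auto intro!: exI[of _ 1])
next
  fix g :: "real \<Rightarrow> complex" and x v :: real
  assume "g \<in> {\<lambda>x. of_real c * f x | c f. f \<in> S}"
  then obtain c f where g: "g = (\<lambda>x. of_real c * f x)" "f \<in> S" by blast
  obtain f' where f': "f' \<in> S" "\<And>x. (f has_vector_derivative f' x) (at x)" using step[OF g(2)] by blast
  have d: "(g has_derivative (\<lambda>h. of_real c * (h *\<^sub>R f' x))) (at x)" for x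
    unfolding g by (intro has_derivative_mult_right f'(2)[unfolded has_vector_derivative_def])
  then show "g differentiable (at x)" by (auto simp: differentiable_def)
  have "dir_deriv v g = (\<lambda>x. of_real (c * v) * f' x)"
    using dir_deriv_eq[OF d] by (auto simp: scaleR_conv_of_real mult.assoc)
  then show "dir_deriv v g \<in> {\<lambda>x. of_real c * f x | c f. f \<in> S}" using f'(1) by blast
qed

text \<open>The span of products of a flat function at 0 and a reflected one at 1 is closed under
  differentiation. This makes \<open>bump_step\<close>, a primitive of \<open>bump\<close>, smooth
  by coinduction.\<close>

inductive_set bump_span :: "(real \<Rightarrow> real) set" where
  "(\<lambda>x. flat n x * flat m (1 - x)) \<in> bump_span"
| "f \<in> bump_span \<Longrightarrow> g \<in> bump_span \<Longrightarrow> (\<lambda>x. a * f x + b * g x) \<in> bump_span"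

lemma bump_span_derivative: "f \<in> bump_span \<Longrightarrow> \<exists>f'\<in>bump_span. \<forall>x. (f has_real_derivative f' x) (at x)"
proof (induction rule: bump_span.induct)
  case (1 n m)
  let ?F = "\<lambda>n m x. flat n x * flat m (1 - x)"
  let ?f' = "\<lambda>x. 1 * (- real n * ?F (n + 1) m x + 1 * ?F (n + 2) m x) + 1 * (real m * ?F n (m + 1) x + (-1) * ?F n (m + 2) x)"
  have "?f' \<in> bump_span" by (intro bump_span.intros)
  moreover have "(?F n m has_real_derivative ?f' x) (at x)" for x
    by (rule derivative_eq_intros flat_has_derivative DERIV_chain2[of "flat m"] refl)+ (simp add: algebra_simps)
  ultimately show ?case by (intro bexI[of _ ?f'] allI)
next
  case (2 f g a b)
  then obtain f' g' where "f' \<in> bump_span" "g' \<in> bump_span"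
    "\<And>x. (f has_real_derivative f' x) (at x)" "\<And>x. (g has_real_derivative g' x) (at x)" by blast
  then show ?case
    by (intro bexI[of _ "\<lambda>x. a * f' x + b * g' x"] bump_span.intros) (auto intro!: derivative_eq_intros)
qed

definition bump :: "real \<Rightarrow> real" where
  "bump x = flat 0 x * flat 0 (1 - x)"

lemma bump_in_span: "bump \<in> bump_span"
  unfolding bump_def[abs_def] by (rule bump_span.intros)

lemma bump_nonneg: "0 \<le> bump x"
  by (simp add: bump_def flat_def)

lemma bump_outside: "x \<le> 0 \<or> 1 \<le> x \<Longrightarrow> bump x = 0"
  by (auto simp: bump_def flat_def)

lemma bump_continuous_on: "continuous_on S bump"
  using bump_span_derivative[OF bump_in_span] by (meson DERIV_isCont continuous_at_imp_continuous_on)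

text \<open>A smooth step, constant on either side of [0,1]. It is not normalized: its height
  \<open>bump_step 1\<close>, the mass of \<open>bump\<close>, is carried along and cancelled at the
  end.\<close>

definition bump_step :: "real \<Rightarrow> real" where
  "bump_step x = integral {0..x} bump"

text \<open>The base point can be moved to the left because \<open>bump\<close> vanishes on the
  negative axis; for negative x the interval {0..x} is empty and both sides are 0. This makes x an
  interior point for the fundamental theorem.\<close>

lemma bump_step_eq: "a \<le> 0 \<Longrightarrow> a \<le> x \<Longrightarrow> bump_step x = integral {a..x} bump"
proof (cases "x \<ge> 0")
  case True
  assume a: "a \<le> 0" "a \<le> x"
  have "integral {a..0} bump = integral {a..0} (\<lambda>_. 0)" by (rule integral_cong) (auto simp: bump_outside)
  moreover have "integral {a..0} bump + integral {0..x} bump = integral {a..x} bump"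
    by (rule Henstock_Kurzweil_Integration.integral_combine) (use a True in \<open>auto intro: integrable_continuous_interval bump_continuous_on\<close>)
  ultimately show ?thesis by (simp add: bump_step_def)
next
  case False
  then have "integral {a..x} bump = integral {a..x} (\<lambda>_. 0)" by (intro integral_cong) (auto simp: bump_outside)
  with False show ?thesis by (simp add: bump_step_def)
qed

lemma bump_step_derivative: "(bump_step has_real_derivative bump x) (at x)"
proof -
  define a b where "a = min x 0 - 1" and "b = x + 1"
  have ab: "a < x" "x < b" "a \<le> 0" by (auto simp: a_def b_def)
  have "((\<lambda>u. integral {a..u} bump) has_real_derivative bump x) (at x within {a..b})"
    by (rule integral_has_real_derivative) (use ab in \<open>auto intro: bump_continuous_on\<close>)
  moreover have "at x within {a..b} = at x"
    by (rule at_within_interior) (use ab in auto)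
  ultimately have "((\<lambda>u. integral {a..u} bump) has_real_derivative bump x) (at x)" by simp
  moreover have "\<forall>\<^sub>F y in nhds x. bump_step y = integral {a..y} bump"
    by (rule eventually_nhds_in_open[of "{a<..}", THEN eventually_mono]) (use ab in \<open>auto simp: bump_step_eq\<close>)
  ultimately show ?thesis by (subst DERIV_cong_ev[OF refl _ refl])
qed

lemma bump_step_low: "x \<le> 0 \<Longrightarrow> bump_step x = 0"
  using bump_step_eq[of x x] by simp

lemma bump_step_high: "1 \<le> x \<Longrightarrow> bump_step x = bump_step 1"
proof -
  assume x: "1 \<le> x"
  have "integral {0..1} bump + integral {1..x} bump = integral {0..x} bump"
    by (rule Henstock_Kurzweil_Integration.integral_combine) (use x in \<open>auto intro: integrable_continuous_interval bump_continuous_on\<close>)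
  moreover have "integral {1..x} bump = integral {1..x} (\<lambda>_. 0)" by (rule integral_cong) (auto simp: bump_outside)
  ultimately show ?thesis by (simp add: bump_step_def)
qed

lemma bump_step_pos: "0 < bump_step 1"
proof -
  have "bump_step 1 \<ge> 0" unfolding bump_step_def
    by (intro integral_nonneg integrable_continuous_interval bump_continuous_on bump_nonneg)
  moreover have "bump_step 1 \<noteq> 0"
  proof -
    have "bump (1 / 2) \<noteq> 0" by (simp add: bump_def flat_def)
    then show ?thesis unfolding bump_step_def
      by (subst integral_eq_0_iff) (auto simp: bump_continuous_on bump_nonneg intro!: bexI[of _ "1/2"])
  qed
  ultimately show ?thesis by simp
qed

lemma smooth_affine:
  fixes f :: "real \<Rightarrow> complex"
  assumes "smooth f" shows "smooth (\<lambda>x. f (\<alpha> * x + \<beta>))"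
proof (rule smooth_coinduct)
  show "(\<lambda>x. f (\<alpha> * x + \<beta>)) \<in> {\<lambda>x. f (\<alpha> * x + \<beta>) | f. smooth f}" using assms by blast
next
  fix g :: "real \<Rightarrow> complex" and x v assume "g \<in> {\<lambda>x. f (\<alpha> * x + \<beta>) | f. smooth f}"
  then obtain f where g: "g = (\<lambda>x. f (\<alpha> * x + \<beta>))" "smooth f" by blast
  have d: "(g has_derivative (\<lambda>v. dir_deriv (\<alpha> * v) f (\<alpha> * x + \<beta>))) (at x)" for x
    unfolding g(1)
    by (rule has_derivative_compose[where f = "\<lambda>x. \<alpha> * x + \<beta>" and g = f, OF _ dir_deriv_has_derivative[OF smooth_differentiable[OF g(2)]]])
       (auto intro!: derivative_eq_intros)
  then show "g differentiable (at x)" by (auto simp: differentiable_def)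
  show "dir_deriv v g \<in> {\<lambda>x. f (\<alpha> * x + \<beta>) | f. smooth f}"
    using dir_deriv_eq[OF d] smooth_dir_deriv[OF g(2), of "\<alpha> * v"] by auto
qed

lemma smooth_bump_step: "smooth (\<lambda>x. complex_of_real (bump_step x))"
proof (rule smooth_real_coinduct)
  let ?S = "insert (\<lambda>x. complex_of_real (bump_step x)) ((\<lambda>f x. complex_of_real (f x)) ` bump_span)"
  show "(\<lambda>x. complex_of_real (bump_step x)) \<in> ?S" by simp
  fix f assume "f \<in> ?S"
  then consider "f = (\<lambda>x. complex_of_real (bump_step x))" | g where "g \<in> bump_span" "f = (\<lambda>x. complex_of_real (g x))" by auto
  then show "\<exists>f'\<in>?S. \<forall>x. (f has_vector_derivative f' x) (at x)"
  proof cases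
    case 1
    then show ?thesis using bump_in_span bump_step_derivative
      by (intro bexI[of _ "\<lambda>x. complex_of_real (bump x)"]) (auto intro: has_vector_derivative_of_real simp: has_real_derivative_iff_has_vector_derivative)
  next
    case 2
    obtain g' where "g' \<in> bump_span" "\<And>x. (g has_real_derivative g' x) (at x)" using bump_span_derivative[OF 2(1)] by blast
    then show ?thesis unfolding 2(2)
      by (intro bexI[of _ "\<lambda>x. complex_of_real (g' x)"]) (auto intro: has_vector_derivative_of_real simp: has_real_derivative_iff_has_vector_derivative)
  qed
qed

text \<open>Rises on [a, a+e] and falls on [b, b+e]. The derivative is the difference of two bumps
  of equal mass, concentrated near a and near b.\<close>

definition plateau :: "real \<Rightarrow> real \<Rightarrow> real \<Rightarrow> real \<Rightarrow> complex" where
  "plateau e a b t = of_real (bump_step ((t - a) / e) - bump_step ((t - b) / e))"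

lemma affine_derivative: "((\<lambda>t. (t - c) / e) has_real_derivative 1 / e) (at t within S)"
  by (rule DERIV_cdivide) (auto intro!: derivative_eq_intros)

lemma plateau_derivative:
  "e > 0 \<Longrightarrow> (plateau e a b has_vector_derivative of_real (bump ((t - a) / e) / e - bump ((t - b) / e) / e)) (at t)"
proof -
  assume e: "e > 0"
  have "((\<lambda>t. bump_step ((t - c) / e)) has_real_derivative (bump ((t - c) / e) / e)) (at t)" for c
    using DERIV_chain2[OF bump_step_derivative, of "\<lambda>t. (t - c) / e" "1 / e" t UNIV] affine_derivative
    by simp
  then have "((\<lambda>t. bump_step ((t - a) / e) - bump_step ((t - b) / e)) has_real_derivative (bump ((t - a) / e) / e - bump ((t - b) / e) / e)) (at t)"
    by (intro DERIV_diff)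
  then show ?thesis
    unfolding plateau_def[abs_def]
    by (intro has_vector_derivative_of_real) (simp add: has_real_derivative_iff_has_vector_derivative)
qed

lemma plateau_time_test:
  assumes "0 < a" "a < b" "e > 0" "b + e < T"
  shows "plateau e a b \<in> time_tests T"
proof -
  have "smooth (\<lambda>t. 1 * of_real (bump_step (1 / e * t + - a / e)) + (-1) * of_real (bump_step (1 / e * t + - b / e)) :: complex)"
    by (intro smooth_lincomb smooth_affine[OF smooth_bump_step])
  then have sm: "smooth (plateau e a b)"
    by (simp add: plateau_def[abs_def] diff_divide_distrib)
  have "t \<in> {a..b + e}" if "plateau e a b t \<noteq> 0" for t
  proof (rule ccontr)
    assume "t \<notin> {a..b + e}"
    then consider "t < a" | "t > b + e" by fastforce
    then show False
    proof cases
      case 1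
      then have "bump_step ((t - a) / e) = 0" "bump_step ((t - b) / e) = 0"
        using assms by (auto intro!: bump_step_low simp: divide_simps)
      with that show False by (simp add: plateau_def)
    next
      case 2
      then have "bump_step ((t - a) / e) = bump_step 1" "bump_step ((t - b) / e) = bump_step 1"
        using assms by (auto intro!: bump_step_high simp: divide_simps)
      with that show False by (simp add: plateau_def)
    qed
  qed
  then have "closure {t. plateau e a b t \<noteq> 0} \<subseteq> {a..b + e}"
    by (intro closure_minimal) auto
  moreover from this have "compact (closure {t. plateau e a b t \<noteq> 0})"
    using bounded_subset[OF compact_imp_bounded[OF compact_Icc]] by (auto simp: compact_eq_bounded_closed)
  ultimately show ?thesis using sm assms by (auto simp: time_tests_def)
qed

text \<open>The rescaled bump has mass \<open>bump_step 1\<close> for every e and lives on [c, c+e],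
  so integrating W against it gives the value at c, times the mass, up to the oscillation of W on
  that interval.\<close>

lemma bump_concentrate:
  fixes W :: "real \<Rightarrow> complex"
  assumes cont: "continuous_on {0..T} W" and c: "0 < c" "e > 0" "c + e < T"
    and close: "\<And>t. t \<in> {c..c + e} \<Longrightarrow> cmod (W t - W c) \<le> \<eta>"
  shows "cmod (integral {0..T} (\<lambda>t. W t * of_real (bump ((t - c) / e) / e)) - W c * of_real (bump_step 1)) \<le> \<eta> * bump_step 1"
proof -
  have bc: "continuous_on S (\<lambda>t. bump ((t - c) / e) / e)" for S
    using c by (intro continuous_intros continuous_on_compose2[OF bump_continuous_on[of UNIV]]) auto
  have "((\<lambda>t. bump ((t - c) / e) / e) has_integral (bump_step ((T - c) / e) - bump_step ((0 - c) / e))) {0..T}"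
  proof (rule fundamental_theorem_of_calculus)
    show "((\<lambda>t. bump_step ((t - c) / e)) has_vector_derivative bump ((t - c) / e) / e) (at t within {0..T})" for t
      using DERIV_chain2[OF bump_step_derivative, of "\<lambda>t. (t - c) / e" "1 / e" t "{0..T}"] affine_derivative
      by (simp add: has_real_derivative_iff_has_vector_derivative[symmetric])
  qed (use c in auto)
  moreover have "bump_step ((T - c) / e) = bump_step 1" "bump_step ((0 - c) / e) = 0"
    using c by (auto intro!: bump_step_high bump_step_low simp: divide_simps)
  ultimately have I: "((\<lambda>t. bump ((t - c) / e) / e) has_integral bump_step 1) {0..T}" by simp
  have I2: "((\<lambda>t. W c * of_real (bump ((t - c) / e) / e)) has_integral W c * of_real (bump_step 1)) {0..T}"
    by (intro has_integral_mult_right has_integral_of_real I)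
  have I3: "(\<lambda>t. W t * of_real (bump ((t - c) / e) / e)) integrable_on {0..T}"
    by (intro integrable_continuous_interval continuous_intros cont bc)
  have "integral {0..T} (\<lambda>t. W t * of_real (bump ((t - c) / e) / e)) - W c * of_real (bump_step 1)
     = integral {0..T} (\<lambda>t. (W t - W c) * of_real (bump ((t - c) / e) / e))"
    using integral_diff[OF I3 has_integral_integrable[OF I2]] integral_unique[OF I2] by (simp only: left_diff_distrib)
  also have "cmod \<dots> \<le> integral {0..T} (\<lambda>t. \<eta> * (bump ((t - c) / e) / e))"
  proof (rule integral_norm_bound_integral)
    show "(\<lambda>t. (W t - W c) * of_real (bump ((t - c) / e) / e)) integrable_on {0..T}"
      by (intro integrable_continuous_interval continuous_intros cont bc)
    show "(\<lambda>t. \<eta> * (bump ((t - c) / e) / e)) integrable_on {0..T}"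
      by (intro integrable_continuous_interval continuous_intros bc)
    fix t
    show "cmod ((W t - W c) * of_real (bump ((t - c) / e) / e)) \<le> \<eta> * (bump ((t - c) / e) / e)"
    proof (cases "t \<in> {c..c + e}")
      case True
      have "bump ((t - c) / e) / e \<ge> 0" using bump_nonneg c by simp
      then have "cmod (of_real (bump ((t - c) / e) / e)) = bump ((t - c) / e) / e"
        unfolding norm_of_real by (rule abs_of_nonneg)
      with mult_right_mono[OF close[OF True] \<open>bump ((t - c) / e) / e \<ge> 0\<close>] show ?thesis
        by (simp only: norm_mult)
    next
      case False
      then have "bump ((t - c) / e) = 0" using c by (intro bump_outside) (auto simp: divide_simps)
      then show ?thesis by simp
    qed
  qed
  also have "\<dots> = \<eta> * bump_step 1"
    by (rule integral_unique, rule has_integral_mult_right[OF I])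
  finally show ?thesis .
qed

text \<open>Plateaus are the only test functions needed: for them the hypothesis says that the
  weighted averages of W near a and near b coincide. For narrow bumps these averages are close to W
  a and W b.\<close>

lemma du_bois_reymond_const:
  fixes W :: "real \<Rightarrow> complex"
  assumes cont: "continuous_on {0..T} W" and "T > 0"
    and weak: "\<And>\<phi>. \<phi> \<in> time_tests T \<Longrightarrow> integral {0..T} (\<lambda>t. W t * vector_derivative \<phi> (at t)) = 0"
    and t: "t \<in> {0..T}"
  shows "W t = W 0"
proof -
  have eq: "W a = W b" if ab: "0 < a" "a < b" "b < T" for a b
  proof -
    let ?I = "bump_step 1"
    have "cmod (W a - W b) \<le> 2 * \<eta>" if \<eta>: "\<eta> > 0" for \<eta>
    proof -
      have "uniformly_continuous_on {0..T} W" using compact_uniformly_continuous[OF cont] by simp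
      then obtain d where d: "d > 0" "\<And>x y. x \<in> {0..T} \<Longrightarrow> y \<in> {0..T} \<Longrightarrow> dist y x < d \<Longrightarrow> dist (W y) (W x) < \<eta>"
        using \<eta> unfolding uniformly_continuous_on_def by metis
      \<comment> \<open>d/2 keeps the oscillation of W below eta, and (T - b)/2 keeps the support of
        the plateau inside the open interval.\<close>
      define e where "e = min (d / 2) ((T - b) / 2)"
      have e: "e > 0" "e < d" "b + e < T" using d(1) ab by (auto simp: e_def min_def field_simps)
      have close: "cmod (W t - W c) \<le> \<eta>" if "c \<in> {a, b}" "t \<in> {c..c + e}" for c t
        using d(2)[of c t] that e ab by (auto simp: dist_norm dist_real_def intro: less_imp_le)
      let ?J = "\<lambda>c. integral {0..T} (\<lambda>t. W t * of_real (bump ((t - c) / e) / e))"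
      have intg: "(\<lambda>t. W t * of_real (bump ((t - c) / e) / e)) integrable_on {0..T}" for c
        using e by (intro integrable_continuous_interval continuous_intros cont continuous_on_compose2[OF bump_continuous_on[of UNIV]]) auto
      have "plateau e a b \<in> time_tests T" by (rule plateau_time_test) (use ab e in auto)
      from weak[OF this] have "integral {0..T} (\<lambda>t. W t * of_real (bump ((t - a) / e) / e) - W t * of_real (bump ((t - b) / e) / e)) = 0"
        using vector_derivative_at[OF plateau_derivative[OF e(1)]] by (simp add: right_diff_distrib)
      then have J: "?J a = ?J b" using integral_diff[OF intg intg] by simp
      have conc: "cmod (?J a - W a * of_real ?I) \<le> \<eta> * ?I" "cmod (?J b - W b * of_real ?I) \<le> \<eta> * ?I"
        by (rule bump_concentrate[OF cont]; use ab e close in auto)+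
      have "W a * of_real ?I - W b * of_real ?I = (?J b - W b * of_real ?I) - (?J a - W a * of_real ?I)"
        unfolding J by simp
      then have "cmod (W a * of_real ?I - W b * of_real ?I) \<le> \<eta> * ?I + \<eta> * ?I"
        using order.trans[OF norm_triangle_ineq4 add_mono[OF conc(2,1)]] by (simp only:)
      then have "cmod (W a - W b) * ?I \<le> (2 * \<eta>) * ?I"
        using bump_step_pos by (simp add: left_diff_distrib[symmetric] norm_mult)
      then show ?thesis using bump_step_pos by simp
    qed
    \<comment> \<open>With eta a quarter of the distance, the distance is at most half of
      itself.\<close>
    from this[of "cmod (W a - W b) / 4"] show ?thesis by (cases "W a = W b") auto
  qed
  have const: "W x = W (T / 2)" if "x \<in> {0<..<T}" for x
  proof -
    consider "x < T / 2" | "x = T / 2" | "T / 2 < x" by linarith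
    then show ?thesis
    proof cases
      case 1
      show ?thesis by (rule eq) (use that 1 in auto)
    next
      case 2
      then show ?thesis by (rule arg_cong)
    next
      case 3
      show ?thesis by (rule eq[symmetric]) (use that 3 \<open>T > 0\<close> in auto)
    qed
  qed
  \<comment> \<open>Test functions see only the open interval; the endpoints are reached by
    continuity.\<close>
  have cl: "closure {0<..<T} = {0..T}" using \<open>T > 0\<close> by simp
  have "W x = W (T / 2)" if "x \<in> {0..T}" for x
    by (rule continuous_constant_on_closure[of "{0<..<T}", unfolded cl, OF cont const that])
  from this[OF t] this[of 0] show ?thesis using \<open>T > 0\<close> by simp
qed

lemma time_test_vector_derivative:
  assumes "\<phi> \<in> time_tests T"
  shows "(\<phi> has_vector_derivative vector_derivative \<phi> (at t)) (at t)"
    and "continuous_on S (\<lambda>t. vector_derivative \<phi> (at t))"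
proof -
  have sm: "smooth \<phi>" using assms by (simp add: time_tests_def)
  have der: "(\<phi> has_vector_derivative dir_deriv 1 \<phi> t) (at t)" for t
  proof -
    have d: "(\<phi> has_derivative (\<lambda>v. dir_deriv v \<phi> t)) (at t)"
      by (rule dir_deriv_has_derivative[OF smooth_differentiable[OF sm]])
    have "dir_deriv v \<phi> t = v *\<^sub>R dir_deriv 1 \<phi> t" for v
      using linear_scale[OF has_derivative_linear[OF d], of v 1] by simp
    then have "(\<lambda>v. dir_deriv v \<phi> t) = (\<lambda>v. v *\<^sub>R dir_deriv 1 \<phi> t)" by (rule ext)
    from has_derivative_eq_rhs[OF d this] show ?thesis unfolding has_vector_derivative_def .
  qed
  then have eq: "vector_derivative \<phi> (at t) = dir_deriv 1 \<phi> t" for t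
    by (rule vector_derivative_at)
  show "(\<phi> has_vector_derivative vector_derivative \<phi> (at t)) (at t)" using der[of t] unfolding eq .
  show "continuous_on S (\<lambda>t. vector_derivative \<phi> (at t))"
    unfolding eq by (rule smooth_continuous_on[OF smooth_dir_deriv[OF sm]])
qed

lemma time_test_continuous_on: "\<phi> \<in> time_tests T \<Longrightarrow> continuous_on S \<phi>"
  by (rule smooth_continuous_on) (simp add: time_tests_def)

lemma time_test_boundary: "\<phi> \<in> time_tests T \<Longrightarrow> t \<notin> {0<..<T} \<Longrightarrow> \<phi> t = 0"
  using closure_subset[of "{t. \<phi> t \<noteq> 0}"] unfolding time_tests_def by auto

lemma time_test_by_parts:
  fixes w h :: "real \<Rightarrow> complex"
  assumes \<phi>: "\<phi> \<in> time_tests T" and T: "T > 0"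
    and der: "\<And>t. t \<in> {0..T} \<Longrightarrow> (w has_vector_derivative h t) (at t within {0..T})"
    and h: "continuous_on {0..T} h"
  shows "integral {0..T} (\<lambda>t. w t * vector_derivative \<phi> (at t)) = - integral {0..T} (\<lambda>t. h t * \<phi> t)"
proof -
  have w: "continuous_on {0..T} w"
    using der by (rule continuous_on_vector_derivative)
  have "((\<lambda>t. w t * vector_derivative \<phi> (at t) + h t * \<phi> t) has_integral (w T * \<phi> T - w 0 * \<phi> 0)) {0..T}"
  proof (rule fundamental_theorem_of_calculus)
    show "((\<lambda>t. w t * \<phi> t) has_vector_derivative w t * vector_derivative \<phi> (at t) + h t * \<phi> t) (at t within {0..T})"
      if "t \<in> {0..T}" for t
      by (intro has_vector_derivative_mult der that has_vector_derivative_at_within[OF time_test_vector_derivative(1)[OF \<phi>]])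
  qed (use T in simp)
  then have "integral {0..T} (\<lambda>t. w t * vector_derivative \<phi> (at t) + h t * \<phi> t) = 0"
    using time_test_boundary[OF \<phi>, of 0] time_test_boundary[OF \<phi>, of T] by (simp add: integral_unique)
  moreover have "integral {0..T} (\<lambda>t. w t * vector_derivative \<phi> (at t) + h t * \<phi> t)
     = integral {0..T} (\<lambda>t. w t * vector_derivative \<phi> (at t)) + integral {0..T} (\<lambda>t. h t * \<phi> t)"
    by (intro integral_add integrable_continuous_interval continuous_intros w h
        time_test_vector_derivative[OF \<phi>] time_test_continuous_on[OF \<phi>])
  ultimately show ?thesis by (simp add: eq_neg_iff_add_eq_0)
qed

text \<open>The primitive H of h satisfies the same weak identity by partial integration, so w - H
  has vanishing weak derivative. The conclusion includes one-sided derivatives at 0 and T.\<close>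

lemma du_bois_reymond:
  fixes w h :: "real \<Rightarrow> complex"
  assumes w: "continuous_on {0..T} w" and h: "continuous_on {0..T} h" and T: "T > 0"
    and weak: "\<And>\<phi>. \<phi> \<in> time_tests T \<Longrightarrow>
      integral {0..T} (\<lambda>t. w t * vector_derivative \<phi> (at t)) = - integral {0..T} (\<lambda>t. h t * \<phi> t)"
    and t: "t \<in> {0..T}"
  shows "(w has_vector_derivative h t) (at t within {0..T})"
proof -
  define H where "H t = integral {0..t} h" for t
  have H: "(H has_vector_derivative h t) (at t within {0..T})" if "t \<in> {0..T}" for t
    unfolding H_def[abs_def] by (rule integral_has_vector_derivative[OF h that])
  have Hc: "continuous_on {0..T} H"
    using H by (rule continuous_on_vector_derivative)
  have "w t - H t = w 0 - H 0" if t: "t \<in> {0..T}" for t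
  proof (rule du_bois_reymond_const[OF _ T _ t])
    show "continuous_on {0..T} (\<lambda>t. w t - H t)" by (intro continuous_intros w Hc)
    fix \<phi> assume \<phi>: "\<phi> \<in> time_tests T"
    have "integral {0..T} (\<lambda>t. w t * vector_derivative \<phi> (at t) - H t * vector_derivative \<phi> (at t))
      = integral {0..T} (\<lambda>t. w t * vector_derivative \<phi> (at t)) - integral {0..T} (\<lambda>t. H t * vector_derivative \<phi> (at t))"
      by (intro integral_diff integrable_continuous_interval continuous_intros w Hc time_test_vector_derivative[OF \<phi>])
    also have "\<dots> = 0" using weak[OF \<phi>] time_test_by_parts[OF \<phi> T H h] by simp
    finally show "integral {0..T} (\<lambda>t. (w t - H t) * vector_derivative \<phi> (at t)) = 0"
      by (simp add: left_diff_distrib)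
  qed
  then have eq: "w x = H x + (w 0 - H 0)" if "x \<in> {0..T}" for x using that by (simp add: algebra_simps)
  show ?thesis
    by (rule has_vector_derivative_transform[OF t eq]) (auto intro!: derivative_eq_intros H t)
qed

subsection \<open>The ordinary differential equations for the Fourier coefficients\<close>

text \<open>Variation of constants for u' = q u + F with initial value g.\<close>

definition linear_ode_solution :: "(real \<Rightarrow> complex) \<Rightarrow> (real \<Rightarrow> complex) \<Rightarrow> complex \<Rightarrow> real \<Rightarrow> complex" where
  "linear_ode_solution q F g t =
     exp (integral {0..t} q) * (g + integral {0..t} (\<lambda>s. exp (- integral {0..s} q) * F s))"

lemma integral_continuous_on:
  fixes q :: "real \<Rightarrow> complex"
  assumes "continuous_on {0..T} q" shows "continuous_on {0..T} (\<lambda>t. integral {0..t} q)"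
  by (rule continuous_on_vector_derivative[OF integral_has_vector_derivative[OF assms]])

lemma exp_integral_derivative:
  fixes q :: "real \<Rightarrow> complex"
  assumes q: "continuous_on {0..T} q" and t: "t \<in> {0..T}"
  shows "((\<lambda>t. exp (c * integral {0..t} q)) has_vector_derivative c * q t * exp (c * integral {0..t} q)) (at t within {0..T})"
proof -
  have "((\<lambda>t. c * integral {0..t} q) has_vector_derivative c * q t) (at t within {0..T})"
    by (intro has_vector_derivative_mult_right integral_has_vector_derivative q t)
  from field_vector_diff_chain_within[OF this, of exp "exp (c * integral {0..t} q)"]
  show ?thesis by (simp add: o_def DERIV_exp has_field_derivative_at_within mult.commute)
qed

lemma linear_ode_solution_derivative:
  assumes q: "continuous_on {0..T} q" and F: "continuous_on {0..T} F" and t: "t \<in> {0..T}"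
  shows "(linear_ode_solution q F g has_vector_derivative q t * linear_ode_solution q F g t + F t) (at t within {0..T})"
proof -
  have c: "continuous_on {0..T} (\<lambda>s. exp (- integral {0..s} q) * F s)"
    by (intro continuous_intros integral_continuous_on q F)
  have "((\<lambda>t. exp (1 * integral {0..t} q) * (g + integral {0..t} (\<lambda>s. exp (- integral {0..s} q) * F s))) has_vector_derivative
     exp (1 * integral {0..t} q) * (0 + exp (- integral {0..t} q) * F t) +
     1 * q t * exp (1 * integral {0..t} q) * (g + integral {0..t} (\<lambda>s. exp (- integral {0..s} q) * F s))) (at t within {0..T})"
    by (intro has_vector_derivative_mult exp_integral_derivative q t has_vector_derivative_add has_vector_derivative_const
        integral_has_vector_derivative c)
  then show ?thesis
    by (simp add: linear_ode_solution_def[abs_def] exp_minus algebra_simps)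
qed

lemma linear_ode_solution_0: "linear_ode_solution q F g 0 = g"
  by (simp add: linear_ode_solution_def)

text \<open>The inhomogeneity cancels in u - v, and the integrating factor exp(- integral of q)
  turns the remaining equation into the vanishing of a derivative.\<close>

lemma linear_ode_unique:
  fixes u v q F :: "real \<Rightarrow> complex"
  assumes q: "continuous_on {0..T} q" and t: "t \<in> {0..T}"
    and u: "\<And>t. t \<in> {0..T} \<Longrightarrow> (u has_vector_derivative q t * u t + F t) (at t within {0..T})"
    and v: "\<And>t. t \<in> {0..T} \<Longrightarrow> (v has_vector_derivative q t * v t + F t) (at t within {0..T})"
    and 0: "u 0 = v 0"
  shows "u t = v t"
proof -
  let ?D = "\<lambda>t. exp (- 1 * integral {0..t} q) * (u t - v t)"
  have "(?D has_vector_derivative 0) (at x within {0..T})" if "x \<in> {0..T}" for x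
    by (rule has_vector_derivative_eq_rhs[OF has_vector_derivative_mult[OF exp_integral_derivative[OF q that] has_vector_derivative_diff[OF u[OF that] v[OF that]]]])
       (simp add: algebra_simps)
  then have "(?D has_derivative (\<lambda>_. 0)) (at x within {0..T})" if "x \<in> {0..T}" for x
    using that by (simp add: has_vector_derivative_def)
  then have "\<exists>c. \<forall>x\<in>{0..T}. ?D x = c"
    by (rule has_derivative_zero_constant[OF convex_real_interval(5)])
  then obtain c where c: "\<And>x. x \<in> {0..T} \<Longrightarrow> ?D x = c" by blast
  have "?D t = ?D 0" by (rule trans[OF c c[symmetric]]) (use t in auto)
  then show ?thesis using 0 by simp
qed

text \<open>q enters only through an upper bound of its real part; this is what later makes the
  estimate uniform in the frequency.\<close>

lemma linear_ode_solution_bound: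
  assumes q: "continuous_on {0..T} q" and F: "continuous_on {0..T} F" and t: "t \<in> {0..T}"
    and K: "K \<ge> 0" "\<And>s. s \<in> {0..T} \<Longrightarrow> Re (q s) \<le> K"
  shows "cmod (linear_ode_solution q F g t) \<le> exp (K * T) * (cmod g + integral {0..T} (\<lambda>s. cmod (F s)))"
proof -
  have T: "0 \<le> t" "t \<le> T" using t by auto
  have qi: "q integrable_on {a..b}" if "0 \<le> a" "b \<le> T" for a b
    by (rule integrable_continuous_interval, rule continuous_on_subset[OF q]) (use that in auto)
  have Fi: "(\<lambda>s. cmod (F s)) integrable_on {a..b}" if "0 \<le> a" "b \<le> T" for a b
    by (rule integrable_continuous_interval, rule continuous_on_subset[OF continuous_on_norm[OF F]]) (use that in auto)
  have re: "Re (integral {s..t} q) \<le> K * T" if s: "0 \<le> s" "s \<le> t" for s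
  proof -
    have "Re (integral {s..t} q) = integral {s..t} (\<lambda>x. Re (q x))"
      using integral_linear[OF qi bounded_linear_Re, of s t] s T by (simp add: o_def)
    also have "\<dots> \<le> integral {s..t} (\<lambda>_. K)"
      using s T K by (intro integral_le integrable_continuous_interval continuous_intros continuous_on_subset[OF q]) auto
    also have "\<dots> = K * (t - s)" using s by simp
    also have "\<dots> \<le> K * T" using s T K by (intro mult_left_mono) auto
    finally show ?thesis .
  qed
  \<comment> \<open>The two factors must be merged before estimating: exp(- integral of q over
    [0,s]) alone is huge when Re q is very negative, whereas the propagator from s to t has modulus
    at most exp(K T).\<close>
  have split: "exp (integral {0..t} q) * exp (- integral {0..s} q) = exp (integral {s..t} q)" if s: "0 \<le> s" "s \<le> t" for s
  proof -
    have "integral {0..s} q + integral {s..t} q = integral {0..t} q"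
      by (rule Henstock_Kurzweil_Integration.integral_combine) (use s T qi in auto)
    then have "integral {0..t} q + - integral {0..s} q = integral {s..t} q" by (simp add: algebra_simps)
    then show ?thesis by (simp only: exp_add[symmetric])
  qed
  have c: "continuous_on {0..t} (\<lambda>s. exp (- integral {0..s} q) * F s)"
    by (rule continuous_on_subset[of "{0..T}"]) (use T in \<open>auto intro!: continuous_intros integral_continuous_on q F\<close>)
  have "cmod (linear_ode_solution q F g t) \<le> cmod (exp (integral {0..t} q) * g)
     + cmod (exp (integral {0..t} q) * integral {0..t} (\<lambda>s. exp (- integral {0..s} q) * F s))"
    unfolding linear_ode_solution_def distrib_left by (rule norm_triangle_ineq)
  also have "cmod (exp (integral {0..t} q) * g) \<le> exp (K * T) * cmod g"
    using re[of 0] T by (auto simp: norm_mult intro!: mult_right_mono)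
  also have "exp (integral {0..t} q) * integral {0..t} (\<lambda>s. exp (- integral {0..s} q) * F s)
      = integral {0..t} (\<lambda>s. exp (integral {0..t} q) * (exp (- integral {0..s} q) * F s))"
    by simp
  also have "cmod \<dots> \<le> integral {0..t} (\<lambda>s. exp (K * T) * cmod (F s))"
  proof (rule integral_norm_bound_integral)
    show "(\<lambda>s. exp (integral {0..t} q) * (exp (- integral {0..s} q) * F s)) integrable_on {0..t}"
      by (intro integrable_continuous_interval continuous_on_mult_left c)
    show "(\<lambda>s. exp (K * T) * cmod (F s)) integrable_on {0..t}"
      by (intro integrable_on_mult_right Fi) (use T in auto)
    fix s assume s: "s \<in> {0..t}"
    have "exp (integral {0..t} q) * (exp (- integral {0..s} q) * F s) = exp (integral {s..t} q) * F s"
      using split[of s] s by (simp add: mult.assoc[symmetric])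
    then show "cmod (exp (integral {0..t} q) * (exp (- integral {0..s} q) * F s)) \<le> exp (K * T) * cmod (F s)"
      using re[of s] s unfolding \<open>exp (integral {0..t} q) * (exp (- integral {0..s} q) * F s) = exp (integral {s..t} q) * F s\<close>
      by (auto simp: norm_mult intro!: mult_right_mono)
  qed
  also have "\<dots> = exp (K * T) * integral {0..t} (\<lambda>s. cmod (F s))" by simp
  also have "\<dots> \<le> exp (K * T) * integral {0..T} (\<lambda>s. cmod (F s))"
    by (intro mult_left_mono integral_subset_le Fi) (use T in auto)
  finally show ?thesis by (simp add: algebra_simps)
qed

subsection \<open>Curves with prescribed Fourier coefficients\<close>

text \<open>Minkowski's integral inequality, by testing against the integrals themselves.\<close>

lemma L2_set_integral_le:
  fixes h :: "'a \<Rightarrow> real \<Rightarrow> real"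
  assumes cont: "\<And>\<xi>. continuous_on {a..b} (h \<xi>)" and ab: "a \<le> b"
    and M: "\<And>t. t \<in> {a..b} \<Longrightarrow> L2_set (\<lambda>\<xi>. h \<xi> t) F \<le> M" 
  shows "L2_set (\<lambda>\<xi>. integral {a..b} (h \<xi>)) F \<le> (b - a) * M"
proof -
  define I where "I = (\<lambda>\<xi>. integral {a..b} (h \<xi>))"
  have M0: "0 \<le> M" using order.trans[OF L2_set_nonneg M[of a]] ab by simp
  have hi: "h \<xi> integrable_on {a..b}" for \<xi> by (intro integrable_continuous_interval cont)
  have "(L2_set I F)\<^sup>2 = (\<Sum>\<xi>\<in>F. (I \<xi>)\<^sup>2)"
    by (simp add: L2_set_def sum_nonneg)
  also have "\<dots> = (\<Sum>\<xi>\<in>F. integral {a..b} (\<lambda>t. I \<xi> * h \<xi> t))"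
    by (simp add: I_def power2_eq_square)
  also have "\<dots> = integral {a..b} (\<lambda>t. \<Sum>\<xi>\<in>F. I \<xi> * h \<xi> t)"
  proof (cases "finite F")
    case True
    then show ?thesis by (intro integral_sum[symmetric] integrable_on_mult_right hi)
  qed simp
  also have "\<dots> \<le> integral {a..b} (\<lambda>t. L2_set I F * M)"
  proof (rule integral_le)
    show "(\<lambda>t. \<Sum>\<xi>\<in>F. I \<xi> * h \<xi> t) integrable_on {a..b}"
      by (intro integrable_continuous_interval continuous_intros cont)
    fix t assume t: "t \<in> {a..b}"
    have "(\<Sum>\<xi>\<in>F. I \<xi> * h \<xi> t) \<le> (\<Sum>\<xi>\<in>F. \<bar>I \<xi>\<bar> * \<bar>h \<xi> t\<bar>)"
      by (intro sum_mono) (simp add: abs_mult[symmetric])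
    also have "\<dots> \<le> L2_set I F * L2_set (\<lambda>\<xi>. h \<xi> t) F" by (rule L2_set_mult_ineq)
    also have "\<dots> \<le> L2_set I F * M" by (intro mult_left_mono M t L2_set_nonneg)
    finally show "(\<Sum>\<xi>\<in>F. I \<xi> * h \<xi> t) \<le> L2_set I F * M" .
  qed (rule integrable_const_ivl)
  also have "\<dots> = L2_set I F * ((b - a) * M)" using ab by simp
  finally have "L2_set I F * L2_set I F \<le> L2_set I F * ((b - a) * M)"
    by (simp add: power2_eq_square)
  \<comment> \<open>Cancelling the norm of I is possible unless it is 0, and then the right side is
    nonnegative.\<close>
  then have "L2_set I F \<le> (b - a) * M"
    using M0 ab L2_set_nonneg[of I F] by (cases "L2_set I F = 0") auto
  then show ?thesis by (simp add: I_def)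
qed

text \<open>Outside a finite set S of indices the majorant M sums to less than e/2, and on S
  finitely many pointwise limits are combined.\<close>

lemma infsum_dominated_tendsto_0:
  fixes g :: "'a \<Rightarrow> 'b \<Rightarrow> real"
  assumes M: "M summable_on UNIV"
    and dom: "\<forall>\<^sub>F x in F. \<forall>\<xi>. \<bar>g \<xi> x\<bar> \<le> M \<xi>"
    and lim: "\<And>\<xi>. ((g \<xi>) \<longlongrightarrow> 0) F"
  shows "((\<lambda>x. \<Sum>\<^sub>\<infinity>\<xi>. g \<xi> x) \<longlongrightarrow> 0) F"
proof (rule tendstoI)
  fix e :: real assume e: "e > 0"
  have "\<forall>\<^sub>F S in finite_subsets_at_top UNIV. dist (sum M S) (infsum M UNIV) < e / 2"
    using tendstoD[OF infsum_tendsto[OF M], of "e / 2"] e by simp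
  then obtain S where S: "finite S" "dist (sum M S) (infsum M UNIV) < e / 2"
    unfolding eventually_finite_subsets_at_top by blast
  have "((\<lambda>x. \<Sum>\<xi>\<in>S. \<bar>g \<xi> x\<bar>) \<longlongrightarrow> (\<Sum>\<xi>\<in>S. 0)) F"
    by (intro tendsto_sum tendsto_rabs_zero lim)
  then have "\<forall>\<^sub>F x in F. dist (\<Sum>\<xi>\<in>S. \<bar>g \<xi> x\<bar>) 0 < e / 2"
    using e by (intro tendstoD) auto
  with dom show "\<forall>\<^sub>F x in F. dist (\<Sum>\<^sub>\<infinity>\<xi>. g \<xi> x) 0 < e"
  proof eventually_elim
    case (elim x)
    have sg: "(\<lambda>\<xi>. g \<xi> x) summable_on A" for A
      by (rule summable_on_bound[OF summable_on_subset[OF M]]) (use elim in auto)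
    have "\<bar>\<Sum>\<^sub>\<infinity>\<xi>. g \<xi> x\<bar> = \<bar>(\<Sum>\<xi>\<in>S. g \<xi> x) + (\<Sum>\<^sub>\<infinity>\<xi>\<in>UNIV - S. g \<xi> x)\<bar>"
      using infsum_Diff[OF sg sg, of S UNIV] S(1) by simp
    also have "\<dots> \<le> \<bar>\<Sum>\<xi>\<in>S. g \<xi> x\<bar> + \<bar>\<Sum>\<^sub>\<infinity>\<xi>\<in>UNIV - S. g \<xi> x\<bar>" by (rule abs_triangle_ineq)
    also have "\<bar>\<Sum>\<xi>\<in>S. g \<xi> x\<bar> \<le> (\<Sum>\<xi>\<in>S. \<bar>g \<xi> x\<bar>)" by (rule sum_abs)
    also have "\<bar>\<Sum>\<^sub>\<infinity>\<xi>\<in>UNIV - S. g \<xi> x\<bar> \<le> infsum M (UNIV - S)"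
      using norm_infsum_le_infsum[OF summable_on_subset[OF M], of "UNIV - S" "\<lambda>\<xi>. g \<xi> x"] elim by simp
    also have "infsum M (UNIV - S) = infsum M UNIV - sum M S"
      using infsum_Diff[OF M summable_on_finite[OF S(1)]] S(1) by simp
    finally show ?case using S(2) elim(2) unfolding dist_real_def by linarith
  qed
qed

lemma tendsto_sobolev_norm_dominated:
  fixes c :: "'b \<Rightarrow> 'n::finite distr"
  assumes m: "(\<lambda>\<xi>. (m \<xi> * japanese \<xi> powr r)\<^sup>2) summable_on UNIV"
    and dom: "\<forall>\<^sub>F x in F. \<forall>\<xi>. cmod (fourier_coeff (c x) \<xi>) \<le> m \<xi>"
    and lim: "\<And>\<xi>. ((\<lambda>x. fourier_coeff (c x) \<xi>) \<longlongrightarrow> 0) F"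
  shows "((\<lambda>x. sobolev_norm r (c x)) \<longlongrightarrow> 0) F"
proof -
  have "((\<lambda>x. \<Sum>\<^sub>\<infinity>\<xi>. (sobolev_coeff r (c x) \<xi>)\<^sup>2) \<longlongrightarrow> 0) F"
  proof (rule infsum_dominated_tendsto_0[OF m])
    show "\<forall>\<^sub>F x in F. \<forall>\<xi>. \<bar>(sobolev_coeff r (c x) \<xi>)\<^sup>2\<bar> \<le> (m \<xi> * japanese \<xi> powr r)\<^sup>2"
      using dom by (rule eventually_mono) (auto simp: sobolev_coeff_def intro!: power_mono mult_right_mono)
    show "((\<lambda>x. (sobolev_coeff r (c x) \<xi>)\<^sup>2) \<longlongrightarrow> 0) F" for \<xi>
      unfolding sobolev_coeff_def by (rule tendsto_eq_intros lim refl | simp)+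
  qed
  then have "((\<lambda>x. sqrt (\<Sum>\<^sub>\<infinity>\<xi>. (sobolev_coeff r (c x) \<xi>)\<^sup>2)) \<longlongrightarrow> sqrt 0) F"
    by (rule tendsto_real_sqrt)
  then show ?thesis by (simp add: sobolev_norm_eq)
qed

text \<open>The pairing with psi sums its rapidly decreasing coefficients against coefficients whose
  growth the Sobolev norm controls. Convergence in any \<open>sobolev_top\<close> therefore implies
  convergence of the values at each test function.\<close>

lemma sobolev_eval_bound:
  assumes \<psi>: "\<psi> \<in> torus_fun"
  shows "\<exists>C. \<forall>u\<in>sobolev r. cmod (u \<psi>) \<le> C * sobolev_norm r u"
proof -
  obtain m where m: "- r \<le> real m" using real_arch_simple by blast
  have s: "(\<lambda>\<xi>. cmod (fourier_transform \<psi> \<xi>) * japanese \<xi> ^ m) summable_on UNIV"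
    using rapid_fourier_transform[OF \<psi>] by (simp add: rapid_def)
  have "cmod (u \<psi>) \<le> (\<Sum>\<^sub>\<infinity>\<xi>. cmod (fourier_transform \<psi> \<xi>) * japanese \<xi> ^ m) * sobolev_norm r u" if u: "u \<in> sobolev r" for u
  proof -
    have le: "cmod (fourier_coeff u \<xi>) \<le> sobolev_norm r u * japanese \<xi> ^ m" for \<xi>
    proof -
      have "cmod (fourier_coeff u \<xi>) * japanese \<xi> powr r * japanese \<xi> powr (- r) \<le> sobolev_norm r u * japanese \<xi> powr (- r)"
        using sobolev_coeff_le_norm[OF u, of \<xi>] by (intro mult_right_mono) (auto simp: sobolev_coeff_def)
      then have "cmod (fourier_coeff u \<xi>) \<le> sobolev_norm r u * japanese \<xi> powr (- r)"
        by (simp add: mult.assoc powr_add[symmetric])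
      also have "\<dots> \<le> sobolev_norm r u * japanese \<xi> powr (real m)"
        by (intro mult_left_mono powr_mono m) auto
      finally show ?thesis by (simp add: powr_realpow)
    qed
    have "u \<psi> = (\<Sum>\<^sub>\<infinity>\<xi>. fourier_transform \<psi> \<xi> * fourier_coeff u (- \<xi>))"
      using distribution_eq_distr_of_coeffs[OF sobolev_distributions[OF u]] \<psi> by (metis distr_of_coeffs_def)
    also have "cmod \<dots> \<le> (\<Sum>\<^sub>\<infinity>\<xi>. (cmod (fourier_transform \<psi> \<xi>) * japanese \<xi> ^ m) * sobolev_norm r u)"
    proof (rule norm_infsum_le_infsum)
      show "(\<lambda>\<xi>. (cmod (fourier_transform \<psi> \<xi>) * japanese \<xi> ^ m) * sobolev_norm r u) summable_on UNIV"
        by (intro summable_on_cmult_left s)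
      show "cmod (fourier_transform \<psi> \<xi> * fourier_coeff u (- \<xi>)) \<le> (cmod (fourier_transform \<psi> \<xi>) * japanese \<xi> ^ m) * sobolev_norm r u" for \<xi>
        using mult_left_mono[OF le[of "- \<xi>"], of "cmod (fourier_transform \<psi> \<xi>)"] by (simp add: norm_mult mult_ac)
    qed
    also have "\<dots> = (\<Sum>\<^sub>\<infinity>\<xi>. cmod (fourier_transform \<psi> \<xi>) * japanese \<xi> ^ m) * sobolev_norm r u"
      by (rule infsum_cmult_left')
    finally show ?thesis .
  qed
  then show ?thesis by blast
qed

lemma limitin_sobolev_eval:
  assumes lim: "limitin (sobolev_top r) f l F" and \<psi>: "\<psi> \<in> torus_fun"
  shows "((\<lambda>x. f x \<psi>) \<longlongrightarrow> l \<psi>) F"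
proof -
  obtain C0 where C0: "\<And>u. u \<in> sobolev r \<Longrightarrow> cmod (u \<psi>) \<le> C0 * sobolev_norm r u"
    using sobolev_eval_bound[OF \<psi>] by blast
  define C where "C = \<bar>C0\<bar> + 1"
  have C: "cmod (u \<psi>) \<le> C * sobolev_norm r u" "C > 0" if "u \<in> sobolev r" for u
    using order.trans[OF C0[OF that] mult_right_mono[of C0 C]] by (auto simp: C_def)
  have l: "l \<in> sobolev r" using lim by (simp add: limitin_sobolev_top)
  show ?thesis
  proof (rule tendstoI)
    fix e :: real assume "e > 0"
    then have "\<forall>\<^sub>F x in F. f x \<in> sobolev r \<and> sobolev_norm r (\<lambda>\<phi>. f x \<phi> - l \<phi>) < e / C"
      using lim C(2)[OF l] by (simp add: limitin_sobolev_top)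
    then show "\<forall>\<^sub>F x in F. dist (f x \<psi>) (l \<psi>) < e"
    proof (rule eventually_mono)
      fix x assume x: "f x \<in> sobolev r \<and> sobolev_norm r (\<lambda>\<phi>. f x \<phi> - l \<phi>) < e / C"
      have "cmod (f x \<psi> - l \<psi>) \<le> C * sobolev_norm r (\<lambda>\<phi>. f x \<phi> - l \<phi>)"
        using x l by (intro C(1)[of "\<lambda>\<phi>. f x \<phi> - l \<phi>"] sobolev_diff) auto
      also have "\<dots> < e" using x C(2)[OF l] by (simp add: field_simps)
      finally show "dist (f x \<psi>) (l \<psi>) < e" by (simp add: dist_norm)
    qed
  qed
qed

lemma has_vector_derivativeI_quotient:
  fixes w :: "real \<Rightarrow> complex"
  assumes "((\<lambda>\<tau>. (w \<tau> - w t) / of_real (\<tau> - t)) \<longlongrightarrow> d) (at t within S)"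
  shows "(w has_vector_derivative d) (at t within S)"
proof -
  have "((\<lambda>\<tau>. (w \<tau> - w t) / of_real (\<tau> - t) - d) \<longlongrightarrow> 0) (at t within S)"
    using assms by (rule LIM_zero)
  then have "((\<lambda>\<tau>. norm ((w \<tau> - w t) / of_real (\<tau> - t) - d)) \<longlongrightarrow> 0) (at t within S)"
    by (rule tendsto_norm_zero)
  then have "((\<lambda>\<tau>. norm (w \<tau> - w t - (\<tau> - t) *\<^sub>R d) / norm (\<tau> - t)) \<longlongrightarrow> 0) (at t within S)"
  proof (rule Lim_transform_eventually)
    show "\<forall>\<^sub>F \<tau> in at t within S. norm ((w \<tau> - w t) / of_real (\<tau> - t) - d) = norm (w \<tau> - w t - (\<tau> - t) *\<^sub>R d) / norm (\<tau> - t)"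
      unfolding eventually_at_filter
    proof (rule always_eventually, intro allI impI)
      fix \<tau> assume "\<tau> \<noteq> t" "\<tau> \<in> S"
      then have "(w \<tau> - w t) / of_real (\<tau> - t) - d = (w \<tau> - w t - (\<tau> - t) *\<^sub>R d) / of_real (\<tau> - t)"
        by (simp add: scaleR_conv_of_real field_simps)
      then show "norm ((w \<tau> - w t) / of_real (\<tau> - t) - d) = norm (w \<tau> - w t - (\<tau> - t) *\<^sub>R d) / norm (\<tau> - t)"
        by (simp only: norm_divide norm_of_real real_norm_def)
    qed
  qed
  then show ?thesis
    unfolding has_vector_derivative_def has_derivative_iff_norm by (simp add: bounded_linear_scaleR_left)
qed

text \<open>Lifts derivatives of single coefficients to a derivative in H^r. On coefficients, the
  difference quotient minus V(t) is the mean of V(s) - V(t) over s between t and tau, so Minkowski's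
  integral inequality bounds its norm by the largest norm of V(s) - V(t).\<close>

lemma limitin_sobolev_quotient:
  fixes u V :: "real \<Rightarrow> 'n::finite distr"
  assumes u: "\<And>t. t \<in> {0..T} \<Longrightarrow> u t \<in> sobolev r" and V: "V \<in> C0_curves T (sobolev_top r)"
    and der: "\<And>t \<xi>. t \<in> {0..T} \<Longrightarrow> ((\<lambda>t. fourier_coeff (u t) \<xi>) has_vector_derivative fourier_coeff (V t) \<xi>) (at t within {0..T})"
    and t: "t \<in> {0..T}"
  shows "limitin (sobolev_top r) (\<lambda>\<tau> \<psi>. (u \<tau> \<psi> - u t \<psi>) / of_real (\<tau> - t)) (V t) (at t within {0..T})"
  unfolding limitin_sobolev_top
proof (intro conjI allI impI)
  have Vs: "V t \<in> sobolev r" if "t \<in> {0..T}" for t using C0_curvesD(1)[OF V that] by simp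
  show "V t \<in> sobolev r" by (rule Vs[OF t])
  fix e :: real assume e: "e > 0"
  let ?q = "\<lambda>\<tau> \<psi>. (u \<tau> \<psi> - u t \<psi>) / of_real (\<tau> - t)"
  have q: "?q \<tau> \<in> sobolev r" if "\<tau> \<in> {0..T}" for \<tau>
    using sobolev_cmult[OF sobolev_diff[OF u[OF that] u[OF t]], of "1 / of_real (\<tau> - t)"] by simp
  have lim: "limitin (sobolev_top r) V (V t) (at t within {0..T})" by (rule C0_curvesD(2)[OF V t])
  \<comment> \<open>Half of e, because bounds over finite sets of frequencies pass to the norm only
    as weak inequalities.\<close>
  have "e / 2 > 0" using e by simp
  with lim have "\<forall>\<^sub>F x in at t within {0..T}. V x \<in> sobolev r \<and> sobolev_norm r (\<lambda>\<phi>. V x \<phi> - V t \<phi>) < e / 2"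
    unfolding limitin_sobolev_top by blast
  then obtain d where d: "d > 0" "\<And>x. x \<in> {0..T} \<Longrightarrow> x \<noteq> t \<Longrightarrow> dist x t < d \<Longrightarrow> sobolev_norm r (\<lambda>\<phi>. V x \<phi> - V t \<phi>) < e / 2"
    unfolding eventually_at by auto
  have d': "sobolev_norm r (\<lambda>\<phi>. V x \<phi> - V t \<phi>) \<le> e / 2" if "x \<in> {0..T}" "dist x t < d" for x
  proof (cases "x = t")
    case True
    then show ?thesis using e by (simp add: sobolev_norm_eq sobolev_coeff_def fourier_coeff_def)
  qed (use d that in \<open>auto intro: less_imp_le\<close>)
  have Vc: "continuous_on {0..T} (\<lambda>t. fourier_coeff (V t) \<xi>)" for \<xi>
    by (rule C0_curves_fourier_coeff_continuous[OF V])
  have main: "?q \<tau> \<in> sobolev r \<and> sobolev_norm r (\<lambda>\<psi>. ?q \<tau> \<psi> - V t \<psi>) < e"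
    if \<tau>: "\<tau> \<in> {0..T}" "\<tau> \<noteq> t" "dist \<tau> t < d" for \<tau>
  proof
    show "?q \<tau> \<in> sobolev r" by (rule q[OF \<tau>(1)])
    \<comment> \<open>tau may lie on either side of t, while the integrals run over the ordered
      interval.\<close>
    define a b where "a = min t \<tau>" and "b = max t \<tau>"
    have ab: "a < b" "b - a = \<bar>\<tau> - t\<bar>" "{a..b} \<subseteq> {0..T}" "\<And>x. x \<in> {a..b} \<Longrightarrow> dist x t < d" "t \<in> {a..b}" "\<tau> \<in> {a..b}"
      using \<tau> t by (auto simp: a_def b_def dist_real_def min_def max_def split: if_splits)
    let ?h = "\<lambda>\<xi> s. cmod (fourier_coeff (V s) \<xi> - fourier_coeff (V t) \<xi>) * japanese \<xi> powr r"
    have hc: "continuous_on {a..b} (?h \<xi>)" for \<xi>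
      by (intro continuous_intros continuous_on_subset[OF Vc ab(3)])
    have incr: "cmod (fourier_coeff (u \<tau>) \<xi> - fourier_coeff (u t) \<xi> - of_real (\<tau> - t) * fourier_coeff (V t) \<xi>)
        \<le> integral {a..b} (\<lambda>s. cmod (fourier_coeff (V s) \<xi> - fourier_coeff (V t) \<xi>))" for \<xi>
    proof -
      \<comment> \<open>Subtracting the linear function with slope V(t) leaves V(s) - V(t) as
        derivative.\<close>
      let ?w = "\<lambda>s. fourier_coeff (u s) \<xi> - of_real (s - t) * fourier_coeff (V t) \<xi>"
      have "((\<lambda>s. fourier_coeff (V s) \<xi> - fourier_coeff (V t) \<xi>) has_integral (?w b - ?w a)) {a..b}"
      proof (rule fundamental_theorem_of_calculus)
        fix s assume s: "s \<in> {a..b}"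
        have "((\<lambda>s. fourier_coeff (u s) \<xi>) has_vector_derivative fourier_coeff (V s) \<xi>) (at s within {a..b})"
          using has_vector_derivative_within_subset[OF der ab(3)] s ab(3) by blast
        then show "(?w has_vector_derivative fourier_coeff (V s) \<xi> - fourier_coeff (V t) \<xi>) (at s within {a..b})"
          by (auto intro!: derivative_eq_intros simp: has_real_derivative_iff_has_vector_derivative)
      qed (use ab in simp)
      then have "?w b - ?w a = integral {a..b} (\<lambda>s. fourier_coeff (V s) \<xi> - fourier_coeff (V t) \<xi>)"
        by (rule integral_unique[symmetric])
      moreover have "cmod (integral {a..b} (\<lambda>s. fourier_coeff (V s) \<xi> - fourier_coeff (V t) \<xi>))
          \<le> integral {a..b} (\<lambda>s. cmod (fourier_coeff (V s) \<xi> - fourier_coeff (V t) \<xi>))"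
        by (intro integral_norm_bound_integral integrable_continuous_interval continuous_intros
            continuous_on_subset[OF Vc ab(3)]) simp
      ultimately have "cmod (?w b - ?w a) \<le> integral {a..b} (\<lambda>s. cmod (fourier_coeff (V s) \<xi> - fourier_coeff (V t) \<xi>))"
        by (simp only:)
      moreover have "cmod (?w b - ?w a) = cmod (?w \<tau> - ?w t)"
        by (auto simp: a_def b_def min_def max_def norm_minus_commute)
      ultimately show ?thesis by (simp add: algebra_simps)
    qed
    have "L2_set (sobolev_coeff r (\<lambda>\<psi>. ?q \<tau> \<psi> - V t \<psi>)) F \<le> e / 2" if "finite F" for F
    proof -
      have pos: "\<bar>\<tau> - t\<bar> > 0" using \<tau> by simp
      have "\<bar>\<tau> - t\<bar> * L2_set (sobolev_coeff r (\<lambda>\<psi>. ?q \<tau> \<psi> - V t \<psi>)) F = L2_set (\<lambda>\<xi>. \<bar>\<tau> - t\<bar> * sobolev_coeff r (\<lambda>\<psi>. ?q \<tau> \<psi> - V t \<psi>) \<xi>) F"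
        using pos by (simp add: L2_set_right_distrib)
      also have "\<dots> \<le> L2_set (\<lambda>\<xi>. integral {a..b} (?h \<xi>)) F"
      proof (rule L2_set_mono)
        fix \<xi>
        have "of_real (\<tau> - t) * fourier_coeff (\<lambda>\<psi>. ?q \<tau> \<psi> - V t \<psi>) \<xi>
          = fourier_coeff (u \<tau>) \<xi> - fourier_coeff (u t) \<xi> - of_real (\<tau> - t) * fourier_coeff (V t) \<xi>"
          using \<tau>(2) by (simp add: fourier_coeff_def field_simps)
        from arg_cong[OF this, of cmod]
        have "\<bar>\<tau> - t\<bar> * cmod (fourier_coeff (\<lambda>\<psi>. ?q \<tau> \<psi> - V t \<psi>) \<xi>)
          = cmod (fourier_coeff (u \<tau>) \<xi> - fourier_coeff (u t) \<xi> - of_real (\<tau> - t) * fourier_coeff (V t) \<xi>)"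
          by (simp only: norm_mult norm_of_real)
        with incr[of \<xi>] have "\<bar>\<tau> - t\<bar> * cmod (fourier_coeff (\<lambda>\<psi>. ?q \<tau> \<psi> - V t \<psi>) \<xi>)
          \<le> integral {a..b} (\<lambda>s. cmod (fourier_coeff (V s) \<xi> - fourier_coeff (V t) \<xi>))" by simp
        from mult_right_mono[OF this, of "japanese \<xi> powr r"]
        show "\<bar>\<tau> - t\<bar> * sobolev_coeff r (\<lambda>\<psi>. ?q \<tau> \<psi> - V t \<psi>) \<xi> \<le> integral {a..b} (?h \<xi>)"
          by (simp add: sobolev_coeff_def mult.assoc)
      qed simp
      also have "\<dots> \<le> (b - a) * (e / 2)"
      proof (rule L2_set_integral_le[OF hc])
        fix s assume s: "s \<in> {a..b}"
        then have s': "s \<in> {0..T}" using ab by blast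
        have "L2_set (\<lambda>\<xi>. ?h \<xi> s) F = L2_set (sobolev_coeff r (\<lambda>\<phi>. V s \<phi> - V t \<phi>)) F"
          by (simp add: sobolev_coeff_def[abs_def] fourier_coeff_diff)
        also have "\<dots> \<le> sobolev_norm r (\<lambda>\<phi>. V s \<phi> - V t \<phi>)"
          by (rule L2_set_le_sobolev_norm[OF sobolev_diff[OF Vs[OF s'] Vs[OF t]]])
        also have "\<dots> \<le> e / 2" by (rule d'[OF s' ab(4)[OF s]])
        finally show "L2_set (\<lambda>\<xi>. ?h \<xi> s) F \<le> e / 2" .
      qed (use ab in simp)
      finally show ?thesis using pos unfolding ab(2) by (simp only: mult_le_cancel_left_pos)
    qed
    from sobolevI_L2_set(2)[OF sobolev_distributions[OF sobolev_diff[OF q[OF \<tau>(1)] Vs[OF t]]] this]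
    show "sobolev_norm r (\<lambda>\<psi>. ?q \<tau> \<psi> - V t \<psi>) < e" using e by linarith
  qed
  show "\<forall>\<^sub>F \<tau> in at t within {0..T}. ?q \<tau> \<in> sobolev r \<and> sobolev_norm r (\<lambda>\<psi>. ?q \<tau> \<psi> - V t \<psi>) < e"
    unfolding eventually_at using d(1) main by blast
qed

lemma continuous_on_Icc_bounded:
  fixes h :: "real \<Rightarrow> real"
  assumes "continuous_on {a..b} h" shows "\<exists>M. \<forall>t\<in>{a..b}. h t \<le> M"
proof -
  have "bdd_above (h ` {a..b})"
    by (intro bounded_imp_bdd_above compact_imp_bounded compact_continuous_image assms) simp
  then show ?thesis by (auto simp: bdd_above_def)
qed

subsection \<open>The Cauchy problem on the Fourier side\<close>

lemma laplacian_cexp: "laplacian (cexp \<xi>) = (\<lambda>x. of_real (- (norm (int_vec \<xi>))\<^sup>2) * cexp \<xi> x)"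
proof -
  have "(\<lambda>\<eta>. (if \<eta> = \<xi> then 1 else 0) * of_real (- (norm (int_vec \<eta>))\<^sup>2))
     = (\<lambda>\<eta>. of_real (- (norm (int_vec \<xi>))\<^sup>2) * (if \<eta> = \<xi> then 1 else 0 :: complex))" by auto
  then show ?thesis
    using laplacian_fourier_series[OF rapid_single, of \<xi> 1]
    by (simp only: fourier_series_cmult cexp_eq_fourier_series[symmetric])
qed

lemma Dx_cexp: "Dx j (cexp \<xi>) = (\<lambda>x. of_int (\<xi> $ j) * cexp \<xi> x)"
proof -
  have "(\<lambda>\<eta>. (if \<eta> = \<xi> then 1 else 0) * of_int (\<eta> $ j))
     = (\<lambda>\<eta>. of_int (\<xi> $ j) * (if \<eta> = \<xi> then 1 else 0 :: complex))" by auto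
  then show ?thesis
    using Dx_fourier_series[OF rapid_single, of j \<xi> 1]
    by (simp only: fourier_series_cmult cexp_eq_fourier_series[symmetric])
qed

locale parabolic_problem =
  fixes T :: real and a2 a0 :: "real \<Rightarrow> complex" and a1 :: "'n::finite \<Rightarrow> real \<Rightarrow> complex"
  assumes T_pos: "T > 0"
    and a2_cont: "continuous_on {0..T} a2"
    and a1_cont: "\<And>j. continuous_on {0..T} (a1 j)"
    and a0_cont: "continuous_on {0..T} a0"
    and Im_a2: "\<And>t. t \<in> {0..T} \<Longrightarrow> Im (a2 t) < 0"
begin

text \<open>Multiplying D_t u + (a2 |xi|^2 + sum_j a1_j xi_j + a0) u = f by i gives u' = symbol u +
  i f. Since Re(-i z) = Im z, the sign of Im a2 governs the growth.\<close>

definition symbol :: "int ^ 'n \<Rightarrow> real \<Rightarrow> complex" where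
  "symbol \<xi> t = - \<i> * (a2 t * of_real ((norm (int_vec \<xi>))\<^sup>2) + (\<Sum>j\<in>UNIV. a1 j t * of_int (\<xi> $ j)) + a0 t)"

lemma symbol_continuous: "continuous_on {0..T} (symbol \<xi>)"
  unfolding symbol_def[abs_def] by (intro continuous_intros a2_cont a1_cont a0_cont)

lemma coefficients_bound:
  "\<exists>A\<ge>0. \<forall>t\<in>{0..T}. cmod (a2 t) \<le> A \<and> cmod (a0 t) \<le> A \<and> (\<Sum>j\<in>UNIV. cmod (a1 j t)) \<le> A"
proof -
  let ?g = "\<lambda>t. cmod (a2 t) + cmod (a0 t) + (\<Sum>j\<in>UNIV. cmod (a1 j t))"
  have "continuous_on {0..T} ?g" by (intro continuous_intros a2_cont a1_cont a0_cont)
  then obtain A where le: "\<And>t. t \<in> {0..T} \<Longrightarrow> ?g t \<le> A" using continuous_on_Icc_bounded by blast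
  have nn: "0 \<le> (\<Sum>j\<in>UNIV. cmod (a1 j t))" for t by (simp add: sum_nonneg)
  show ?thesis
  proof (intro exI[of _ A] conjI ballI)
    have "0 \<in> {0..T}" using T_pos by simp
    from le[OF this] nn[of 0] norm_ge_zero[of "a2 0"] norm_ge_zero[of "a0 0"]
    show "A \<ge> 0" by linarith
    fix t assume "t \<in> {0..T}"
    from le[OF this] nn[of t] norm_ge_zero[of "a2 t"] norm_ge_zero[of "a0 t"]
    show "cmod (a2 t) \<le> A" "cmod (a0 t) \<le> A" "(\<Sum>j\<in>UNIV. cmod (a1 j t)) \<le> A" by linarith+
  qed
qed

text \<open>The symbol has order 2, which is the source of the loss from r to r - 2 in the time
  derivative. The terms of order 2, 1 and 0 contribute A each.\<close>

lemma symbol_bound: "\<exists>M\<ge>0. \<forall>t\<in>{0..T}. \<forall>\<xi>. cmod (symbol \<xi> t) \<le> M * (japanese \<xi>)\<^sup>2"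
proof -
  obtain A where A: "A \<ge> 0" "\<And>t. t \<in> {0..T} \<Longrightarrow> cmod (a2 t) \<le> A" "\<And>t. t \<in> {0..T} \<Longrightarrow> cmod (a0 t) \<le> A"
    "\<And>t. t \<in> {0..T} \<Longrightarrow> (\<Sum>j\<in>UNIV. cmod (a1 j t)) \<le> A" using coefficients_bound by blast
  have "cmod (symbol \<xi> t) \<le> (3 * A) * (japanese \<xi>)\<^sup>2" if t: "t \<in> {0..T}" for t \<xi>
  proof -
    have J: "japanese \<xi> \<le> (japanese \<xi>)\<^sup>2" "1 \<le> (japanese \<xi>)\<^sup>2"
      using power_increasing[of 1 2 "japanese \<xi>"] by (auto simp: one_le_power)
    have "cmod (symbol \<xi> t) = cmod (a2 t * of_real ((norm (int_vec \<xi>))\<^sup>2) + (\<Sum>j\<in>UNIV. a1 j t * of_int (\<xi> $ j)) + a0 t)"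
      by (simp add: symbol_def norm_mult)
    also have "\<dots> \<le> cmod (a2 t * of_real ((norm (int_vec \<xi>))\<^sup>2)) + cmod (\<Sum>j\<in>UNIV. a1 j t * of_int (\<xi> $ j)) + cmod (a0 t)"
      by (intro norm_triangle_mono order.refl)
    also have "cmod (a2 t * of_real ((norm (int_vec \<xi>))\<^sup>2)) \<le> A * (japanese \<xi>)\<^sup>2"
      unfolding norm_mult norm_of_real
      by (intro mult_mono A t) (auto simp: norm_int_vec_le intro!: power_mono A)
    also have "cmod (\<Sum>j\<in>UNIV. a1 j t * of_int (\<xi> $ j)) \<le> (\<Sum>j\<in>UNIV. cmod (a1 j t) * japanese \<xi>)"
      by (rule order.trans[OF norm_sum]) (auto intro!: sum_mono mult_left_mono component_le_japanese simp: norm_mult)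
    also have "\<dots> \<le> A * (japanese \<xi>)\<^sup>2"
      unfolding sum_distrib_right[symmetric] by (intro mult_mono A t J) (auto intro!: sum_nonneg)
    also have "cmod (a0 t) \<le> A * (japanese \<xi>)\<^sup>2"
      using mult_mono[OF A(3)[OF t] J(2)] A(1) by simp
    finally show ?thesis by simp
  qed
  then show ?thesis using A(1) by (intro exI[of _ "3 * A"]) auto
qed

text \<open>This is where the sign condition on the leading coefficient enters.\<close>

lemma Re_symbol_bound: "\<exists>K\<ge>0. \<forall>t\<in>{0..T}. \<forall>\<xi>. Re (symbol \<xi> t) \<le> K"
proof -
  obtain A where A: "A \<ge> 0" "\<And>t. t \<in> {0..T} \<Longrightarrow> cmod (a2 t) \<le> A" "\<And>t. t \<in> {0..T} \<Longrightarrow> cmod (a0 t) \<le> A"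
    "\<And>t. t \<in> {0..T} \<Longrightarrow> (\<Sum>j\<in>UNIV. cmod (a1 j t)) \<le> A" using coefficients_bound by blast
  \<comment> \<open>Compactness turns the pointwise sign condition into a gap c > 0 that is uniform
    in t.\<close>
  obtain t0 where t0: "t0 \<in> {0..T}" "\<And>t. t \<in> {0..T} \<Longrightarrow> Im (a2 t) \<le> Im (a2 t0)"
    using continuous_attains_sup[of "{0..T}" "\<lambda>t. Im (a2 t)"] T_pos continuous_on_Im[OF a2_cont] by auto
  define c where "c = - Im (a2 t0)"
  have c: "c > 0" using Im_a2[OF t0(1)] by (simp add: c_def)
  have "Re (symbol \<xi> t) \<le> A\<^sup>2 / (4 * c) + A" if t: "t \<in> {0..T}" for t \<xi>
  proof -
    define x where "x = norm (int_vec \<xi>)"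
    have "Re (symbol \<xi> t) = Im (a2 t) * x\<^sup>2 + (\<Sum>j\<in>UNIV. Im (a1 j t) * of_int (\<xi> $ j)) + Im (a0 t)"
      unfolding symbol_def x_def by simp
    also have "Im (a2 t) * x\<^sup>2 \<le> - c * x\<^sup>2"
      using t0(2)[OF t] by (intro mult_right_mono) (auto simp: c_def)
    also have "(\<Sum>j\<in>UNIV. Im (a1 j t) * of_int (\<xi> $ j)) \<le> (\<Sum>j\<in>UNIV. cmod (a1 j t) * x)"
    proof (rule sum_mono)
      fix j
      have "Im (a1 j t) * of_int (\<xi> $ j) \<le> \<bar>Im (a1 j t)\<bar> * \<bar>of_int (\<xi> $ j)\<bar>"
        by (simp add: abs_mult[symmetric])
      also have "\<dots> \<le> cmod (a1 j t) * x"
        unfolding x_def using component_le_norm_cart[of "int_vec \<xi>" j] by (intro mult_mono abs_Im_le_cmod) auto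
      finally show "Im (a1 j t) * of_int (\<xi> $ j) \<le> cmod (a1 j t) * x" .
    qed
    also have "\<dots> \<le> A * x"
      unfolding sum_distrib_right[symmetric] by (intro mult_right_mono A t) (simp add: x_def)
    also have "Im (a0 t) \<le> A" using abs_Im_le_cmod[of "a0 t"] A(3)[OF t] by linarith
    finally have 1: "Re (symbol \<xi> t) \<le> - c * x\<^sup>2 + A * x + A" by simp
    \<comment> \<open>Completing the square: A x - c x^2 is at most A^2 / (4 c) for all x, so the
      leading term absorbs the first-order one at every frequency.\<close>
    have "0 \<le> (2 * c * x - A)\<^sup>2" by simp
    then have "4 * c * (A * x - c * x\<^sup>2) \<le> A\<^sup>2" by (simp add: power2_eq_square algebra_simps)
    then have "A * x - c * x\<^sup>2 \<le> A\<^sup>2 / (4 * c)" using c by (simp add: field_simps)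
    with 1 show ?thesis by simp
  qed
  moreover have "A\<^sup>2 / (4 * c) + A \<ge> 0" using c A(1) by simp
  ultimately show ?thesis by blast
qed

lemma spatial_part_cexp:
  assumes "u t \<in> distributions"
  shows "spatial_part a2 a1 a0 u t (cexp (- \<xi>)) = \<i> * symbol \<xi> t * fourier_coeff (u t) \<xi>"
proof -
  have "distr_laplacian (u t) (cexp (- \<xi>)) = of_real (- (norm (int_vec \<xi>))\<^sup>2) * fourier_coeff (u t) \<xi>"
    using distributionsD(3)[OF assms cexp_torus_fun, of "of_real (- (norm (int_vec \<xi>))\<^sup>2)" "- \<xi>"]
    by (simp add: distr_laplacian_def laplacian_cexp fourier_coeff_eq)
  moreover have "distr_Dx j (u t) (cexp (- \<xi>)) = of_int (\<xi> $ j) * fourier_coeff (u t) \<xi>" for j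
    using distributionsD(3)[OF assms cexp_torus_fun, of "- of_int (\<xi> $ j)" "- \<xi>"]
    by (simp add: distr_Dx_def Dx_cexp fourier_coeff_eq)
  ultimately show ?thesis
    by (simp add: spatial_part_def symbol_def fourier_coeff_eq sum_distrib_left sum_distrib_right algebra_simps)
qed

text \<open>Evaluated at the test function \<open>cexp (- \<xi>)\<close>, the equation becomes a
  scalar weak equation in t, which du Bois-Reymond makes classical. The Sobolev orders of u and f
  may be unrelated.\<close>

lemma solves_CP_fourier_coeff:
  assumes sol: "solves_CP T a2 a1 a0 f g u" and f: "f \<in> C0_curves T (sobolev_top r)" and t: "t \<in> {0..T}"
  shows "((\<lambda>t. fourier_coeff (u t) \<xi>) has_vector_derivative
    symbol \<xi> t * fourier_coeff (u t) \<xi> + \<i> * fourier_coeff (f t) \<xi>) (at t within {0..T})"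
proof -
  obtain \<rho> where u: "u \<in> C0_curves T (sobolev_top \<rho>)" using sol unfolding solves_CP_def by blast
  have ud: "u t \<in> distributions" if "t \<in> {0..T}" for t
    using C0_curvesD(1)[OF u that] sobolev_distributions by auto
  have uc: "continuous_on {0..T} (\<lambda>t. fourier_coeff (u t) \<xi>)" and fc: "continuous_on {0..T} (\<lambda>t. fourier_coeff (f t) \<xi>)"
    by (rule C0_curves_fourier_coeff_continuous[OF u], rule C0_curves_fourier_coeff_continuous[OF f])
  show ?thesis
  proof (rule du_bois_reymond[OF uc _ T_pos _ t])
    show "continuous_on {0..T} (\<lambda>t. symbol \<xi> t * fourier_coeff (u t) \<xi> + \<i> * fourier_coeff (f t) \<xi>)"
      by (intro continuous_intros uc fc symbol_continuous)
    fix \<phi> assume \<phi>: "\<phi> \<in> time_tests T"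
    let ?I = "\<lambda>h. integral {0..T} h"
    let ?u = "\<lambda>t. fourier_coeff (u t) \<xi>" and ?f = "\<lambda>t. fourier_coeff (f t) \<xi>"
    have int1: "(\<lambda>t. symbol \<xi> t * ?u t * \<phi> t) integrable_on {0..T}" and int2: "(\<lambda>t. ?f t * \<phi> t) integrable_on {0..T}"
      by (intro integrable_continuous_interval continuous_intros uc fc symbol_continuous time_test_continuous_on[OF \<phi>])+
    have "(\<lambda>\<psi>. weak_Dt T u \<phi> \<psi> + distr_integral T (\<lambda>t \<psi>. spatial_part a2 a1 a0 u t \<psi> * \<phi> t) \<psi>)
        = distr_integral T (\<lambda>t \<psi>. f t \<psi> * \<phi> t)"
      using sol \<phi> unfolding solves_CP_def by blast
    from fun_cong[OF this, of "cexp (- \<xi>)"]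
    have "?I (\<lambda>t. ?u t * (- ((1 / \<i>) * vector_derivative \<phi> (at t)))) + ?I (\<lambda>t. spatial_part a2 a1 a0 u t (cexp (- \<xi>)) * \<phi> t)
       = ?I (\<lambda>t. ?f t * \<phi> t)"
      by (simp add: weak_Dt_def distr_integral_def fourier_coeff_eq)
    moreover have "?I (\<lambda>t. spatial_part a2 a1 a0 u t (cexp (- \<xi>)) * \<phi> t) = ?I (\<lambda>t. \<i> * (symbol \<xi> t * ?u t * \<phi> t))"
      by (rule integral_cong) (simp add: spatial_part_cexp[OF ud])
    moreover have "?I (\<lambda>t. ?u t * (- ((1 / \<i>) * vector_derivative \<phi> (at t)))) = ?I (\<lambda>t. \<i> * (?u t * vector_derivative \<phi> (at t)))"
      by (rule integral_cong) simp
    ultimately have "\<i> * ?I (\<lambda>t. ?u t * vector_derivative \<phi> (at t)) + \<i> * ?I (\<lambda>t. symbol \<xi> t * ?u t * \<phi> t) = ?I (\<lambda>t. ?f t * \<phi> t)"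
      by simp
    then have "- \<i> * (\<i> * ?I (\<lambda>t. ?u t * vector_derivative \<phi> (at t)) + \<i> * ?I (\<lambda>t. symbol \<xi> t * ?u t * \<phi> t)) = - \<i> * ?I (\<lambda>t. ?f t * \<phi> t)"
      by (rule arg_cong)
    then have "?I (\<lambda>t. ?u t * vector_derivative \<phi> (at t)) = - (?I (\<lambda>t. symbol \<xi> t * ?u t * \<phi> t) + \<i> * ?I (\<lambda>t. ?f t * \<phi> t))"
      by (simp add: algebra_simps)
    also have "?I (\<lambda>t. symbol \<xi> t * ?u t * \<phi> t) + \<i> * ?I (\<lambda>t. ?f t * \<phi> t)
       = ?I (\<lambda>t. symbol \<xi> t * ?u t * \<phi> t + \<i> * (?f t * \<phi> t))"
      using integral_add[OF int1 integrable_on_mult_right[OF int2, of \<i>]] by simp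
    finally show "?I (\<lambda>t. ?u t * vector_derivative \<phi> (at t)) = - ?I (\<lambda>t. (symbol \<xi> t * ?u t + \<i> * ?f t) * \<phi> t)"
      by (simp add: algebra_simps)
  qed
qed

text \<open>The two solutions may live in Sobolev spaces of different orders, so they are compared
  coefficient by coefficient. Extensionality settles the values outside [0,T].\<close>

lemma solves_CP_unique:
  assumes u: "solves_CP T a2 a1 a0 f g u" and v: "solves_CP T a2 a1 a0 f g v" and f: "f \<in> C0_curves T (sobolev_top r)"
  shows "u = v"
proof -
  obtain \<rho> where u': "u \<in> C0_curves T (sobolev_top \<rho>)" using u unfolding solves_CP_def by blast
  obtain \<rho>' where v': "v \<in> C0_curves T (sobolev_top \<rho>')" using v unfolding solves_CP_def by blast
  show ?thesis
  proof (rule extensionalityI[OF C0_curvesD(3)[OF u'] C0_curvesD(3)[OF v']])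
    fix t assume t: "t \<in> {0..T}"
    show "u t = v t"
    proof (rule distribution_eqI)
      show "u t \<in> distributions" "v t \<in> distributions"
        using C0_curvesD(1)[OF u' t] C0_curvesD(1)[OF v' t] sobolev_distributions by auto
      have "u 0 = v 0" using u v by (simp add: solves_CP_def)
      then show "fourier_coeff (u t) \<xi> = fourier_coeff (v t) \<xi>" for \<xi>
        by (intro linear_ode_unique[OF symbol_continuous[of \<xi>] t
              solves_CP_fourier_coeff[OF u f] solves_CP_fourier_coeff[OF v f]]) auto
    qed
  qed
qed

section \<open>The candidate solution and bounds for its coefficients\<close>

definition solution_coeff :: "(real \<Rightarrow> 'n distr) \<Rightarrow> 'n distr \<Rightarrow> int ^ 'n \<Rightarrow> real \<Rightarrow> complex" where
  "solution_coeff f g \<xi> = linear_ode_solution (symbol \<xi>) (\<lambda>s. \<i> * fourier_coeff (f s) \<xi>) (fourier_coeff g \<xi>)"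

definition solution :: "(real \<Rightarrow> 'n distr) \<Rightarrow> 'n distr \<Rightarrow> real \<Rightarrow> 'n distr" where
  "solution f g = restrict (\<lambda>t. distr_of_coeffs (\<lambda>\<xi>. solution_coeff f g \<xi> t)) {0..T}"

text \<open>The time derivative as dictated by the equation. The part given by the symbol and the
  source i f are kept apart because they are continuous curves for different reasons; the factor 1
  fits the lemmas on linear combinations.\<close>

definition solution_deriv :: "(real \<Rightarrow> 'n distr) \<Rightarrow> 'n distr \<Rightarrow> real \<Rightarrow> 'n distr" where
  "solution_deriv f g = restrict (\<lambda>t \<psi>. 1 * distr_of_coeffs (\<lambda>\<xi>. symbol \<xi> t * solution_coeff f g \<xi> t) \<psi> + \<i> * f t \<psi>) {0..T}"

lemma fourier_coeff_solution: "t \<in> {0..T} \<Longrightarrow> fourier_coeff (solution f g t) \<xi> = solution_coeff f g \<xi> t"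
  by (simp add: solution_def fourier_coeff_distr_of_coeffs)

lemma fourier_coeff_solution_deriv:
  "t \<in> {0..T} \<Longrightarrow> fourier_coeff (solution_deriv f g t) \<xi> = symbol \<xi> t * solution_coeff f g \<xi> t + \<i> * fourier_coeff (f t) \<xi>"
  unfolding solution_deriv_def restrict_apply
  by (simp only: if_True fourier_coeff_lincomb) (simp add: fourier_coeff_distr_of_coeffs)

lemma solution_coeff_derivative:
  assumes f: "f \<in> C0_curves T (sobolev_top r)" and t: "t \<in> {0..T}"
  shows "(solution_coeff f g \<xi> has_vector_derivative
    symbol \<xi> t * solution_coeff f g \<xi> t + \<i> * fourier_coeff (f t) \<xi>) (at t within {0..T})"
  unfolding solution_coeff_def
  by (intro linear_ode_solution_derivative symbol_continuous t continuous_intros C0_curves_fourier_coeff_continuous[OF f])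

lemma solution_coeff_continuous:
  assumes f: "f \<in> C0_curves T (sobolev_top r)" shows "continuous_on {0..T} (solution_coeff f g \<xi>)"
  by (rule continuous_on_vector_derivative[OF solution_coeff_derivative[OF f]])

lemma solution_coeff_bound:
  assumes f: "f \<in> C0_curves T (sobolev_top r)"
  shows "\<exists>K\<ge>0. \<forall>g \<xi>. \<forall>t\<in>{0..T}. cmod (solution_coeff f g \<xi> t) \<le>
     K * (cmod (fourier_coeff g \<xi>) + integral {0..T} (\<lambda>s. cmod (fourier_coeff (f s) \<xi>)))"
proof -
  obtain K where K: "K \<ge> 0" "\<And>t \<xi>. t \<in> {0..T} \<Longrightarrow> Re (symbol \<xi> t) \<le> K" using Re_symbol_bound by blast
  have "cmod (solution_coeff f g \<xi> t) \<le> exp (K * T) * (cmod (fourier_coeff g \<xi>) + integral {0..T} (\<lambda>s. cmod (fourier_coeff (f s) \<xi>)))"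
    if t: "t \<in> {0..T}" for g \<xi> t
  proof -
    have "cmod (solution_coeff f g \<xi> t) \<le> exp (K * T) * (cmod (fourier_coeff g \<xi>) + integral {0..T} (\<lambda>s. cmod (\<i> * fourier_coeff (f s) \<xi>)))"
      unfolding solution_coeff_def
      by (intro linear_ode_solution_bound symbol_continuous t K continuous_intros C0_curves_fourier_coeff_continuous[OF f])
    then show ?thesis by (simp add: norm_mult)
  qed
  then show ?thesis by (intro exI[of _ "exp (K * T)"]) auto
qed

text \<open>The majorant is independent of t because the source enters through its time integral,
  and Minkowski's inequality puts it into the weighted l2 space. The supremum over t of the
  coefficients of f would not do, as it need not be square summable.\<close>

lemma solution_coeff_majorant:
  assumes f: "f \<in> C0_curves T (sobolev_top r)" and g: "g \<in> sobolev r"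
  shows "\<exists>m B. (\<forall>\<xi>. \<forall>t\<in>{0..T}. cmod (solution_coeff f g \<xi> t) \<le> m \<xi>) \<and>
    (\<forall>F. finite F \<longrightarrow> L2_set (\<lambda>\<xi>. m \<xi> * japanese \<xi> powr r) F \<le> B) \<and> (\<forall>\<xi>. 0 \<le> m \<xi>)"
proof -
  obtain K where K: "K \<ge> 0" "\<And>\<xi> t. t \<in> {0..T} \<Longrightarrow> cmod (solution_coeff f g \<xi> t) \<le>
     K * (cmod (fourier_coeff g \<xi>) + integral {0..T} (\<lambda>s. cmod (fourier_coeff (f s) \<xi>)))"
    using solution_coeff_bound[OF f] by blast
  have fc: "continuous_on {0..T} (\<lambda>s. fourier_coeff (f s) \<xi>)" for \<xi> by (rule C0_curves_fourier_coeff_continuous[OF f])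
  obtain M where M: "\<And>t. t \<in> {0..T} \<Longrightarrow> sobolev_norm r (f t) \<le> M"
    using continuous_on_Icc_bounded[OF C0_curves_sobolev_norm_continuous[OF f]] by blast
  define m where "m \<xi> = K * (cmod (fourier_coeff g \<xi>) + integral {0..T} (\<lambda>s. cmod (fourier_coeff (f s) \<xi>)))" for \<xi>
  show ?thesis
  proof (intro exI[of _ m] exI[of _ "K * (sobolev_norm r g + (T - 0) * M)"] conjI allI ballI impI)
    show "cmod (solution_coeff f g \<xi> t) \<le> m \<xi>" if "t \<in> {0..T}" for \<xi> t using K(2)[OF that] by (simp add: m_def)
    show "0 \<le> m \<xi>" for \<xi> unfolding m_def
      by (intro mult_nonneg_nonneg add_nonneg_nonneg K integral_nonneg integrable_continuous_interval continuous_intros fc) auto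
    fix F :: "(int ^ 'n) set" assume "finite F"
    let ?h = "\<lambda>\<xi> s. sobolev_coeff r (f s) \<xi>"
    have eq: "m \<xi> * japanese \<xi> powr r = K * (sobolev_coeff r g \<xi> + integral {0..T} (?h \<xi>))" for \<xi>
      by (simp add: m_def sobolev_coeff_def algebra_simps)
    have "L2_set (\<lambda>\<xi>. m \<xi> * japanese \<xi> powr r) F = K * L2_set (\<lambda>\<xi>. sobolev_coeff r g \<xi> + integral {0..T} (?h \<xi>)) F"
      unfolding eq by (simp add: L2_set_right_distrib K)
    also have "\<dots> \<le> K * (L2_set (sobolev_coeff r g) F + L2_set (\<lambda>\<xi>. integral {0..T} (?h \<xi>)) F)"
      by (intro mult_left_mono L2_set_triangle_ineq K)
    also have "\<dots> \<le> K * (sobolev_norm r g + (T - 0) * M)"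
    proof (intro mult_left_mono add_mono L2_set_le_sobolev_norm g K L2_set_integral_le)
      show "continuous_on {0..T} (?h \<xi>)" for \<xi> unfolding sobolev_coeff_def by (intro continuous_intros fc)
      show "L2_set (\<lambda>\<xi>. ?h \<xi> t) F \<le> M" if "t \<in> {0..T}" for t
        using order.trans[OF L2_set_le_sobolev_norm M[OF that]] C0_curvesD(1)[OF f that] by auto
    qed (use T_pos in auto)
    finally show "L2_set (\<lambda>\<xi>. m \<xi> * japanese \<xi> powr r) F \<le> K * (sobolev_norm r g + (T - 0) * M)" .
  qed
qed

end

subsection \<open>Existence in Sobolev spaces and in the smooth category\<close>

lemma eventually_at_within_mem: "\<forall>\<^sub>F x in at t within S. x \<in> S"
  by (simp add: eventually_at_filter)

lemma limitin_sobolevI: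
  assumes "l \<in> sobolev r" "\<And>x. x \<in> S \<Longrightarrow> f x \<in> sobolev r"
    and lim: "((\<lambda>x. sobolev_norm r (\<lambda>\<phi>. f x \<phi> - l \<phi>)) \<longlongrightarrow> 0) (at t within S)"
  shows "limitin (sobolev_top r) f l (at t within S)"
  unfolding limitin_sobolev_top
proof (intro conjI allI impI assms(1))
  fix e :: real assume "e > 0"
  from order_tendstoD(2)[OF lim this] eventually_at_within_mem[of S t]
  show "\<forall>\<^sub>F x in at t within S. f x \<in> sobolev r \<and> sobolev_norm r (\<lambda>\<phi>. f x \<phi> - l \<phi>) < e"
    by eventually_elim (use assms(2) in auto)
qed

lemma C0_curves_sobolevI:
  assumes ext: "u \<in> extensional {0..T}" and distr: "\<And>t. t \<in> {0..T} \<Longrightarrow> u t \<in> distributions"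
    and dom: "\<And>t \<xi>. t \<in> {0..T} \<Longrightarrow> cmod (fourier_coeff (u t) \<xi>) \<le> m \<xi>"
    and m: "\<And>F. finite F \<Longrightarrow> L2_set (\<lambda>\<xi>. m \<xi> * japanese \<xi> powr r) F \<le> B"
    and cont: "\<And>\<xi>. continuous_on {0..T} (\<lambda>t. fourier_coeff (u t) \<xi>)"
  shows "u \<in> C0_curves T (sobolev_top r)"
  unfolding C0_curves_iff
proof (intro conjI ballI ext limitin_sobolevI)
  have s: "u t \<in> sobolev r" if "t \<in> {0..T}" for t
  proof (rule sobolevI_L2_set(1)[OF distr[OF that]])
    fix F :: "(int ^ 'a) set" assume F: "finite F"
    have "L2_set (sobolev_coeff r (u t)) F \<le> L2_set (\<lambda>\<xi>. m \<xi> * japanese \<xi> powr r) F"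
      by (rule L2_set_mono) (auto simp: sobolev_coeff_def intro!: mult_right_mono dom that)
    also have "\<dots> \<le> B" by (rule m[OF F])
    finally show "L2_set (sobolev_coeff r (u t)) F \<le> B" .
  qed
  fix t assume t: "t \<in> {0..T}"
  show "u t \<in> sobolev r" by (rule s[OF t])
  show "u x \<in> sobolev r" if "x \<in> {0..T}" for x by (rule s[OF that])
  show "((\<lambda>x. sobolev_norm r (\<lambda>\<phi>. u x \<phi> - u t \<phi>)) \<longlongrightarrow> 0) (at t within {0..T})"
  proof (rule tendsto_sobolev_norm_dominated)
    have "(\<lambda>\<xi>. 4 * (m \<xi> * japanese \<xi> powr r)\<^sup>2) summable_on UNIV"
      by (intro summable_on_cmult_right L2_set_bounded_summable[OF m])
    then show "(\<lambda>\<xi>. (2 * m \<xi> * japanese \<xi> powr r)\<^sup>2) summable_on UNIV"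
      by (simp add: power_mult_distrib mult.assoc)
    show "\<forall>\<^sub>F x in at t within {0..T}. \<forall>\<xi>. cmod (fourier_coeff (\<lambda>\<phi>. u x \<phi> - u t \<phi>) \<xi>) \<le> 2 * m \<xi>"
      using eventually_at_within_mem
    proof (rule eventually_mono, intro allI)
      fix x \<xi> assume x: "x \<in> {0..T}"
      have "cmod (fourier_coeff (u x) \<xi> - fourier_coeff (u t) \<xi>) \<le> m \<xi> + m \<xi>"
        by (rule order.trans[OF norm_triangle_ineq4 add_mono[OF dom[OF x] dom[OF t]]])
      then show "cmod (fourier_coeff (\<lambda>\<phi>. u x \<phi> - u t \<phi>) \<xi>) \<le> 2 * m \<xi>" by (simp add: fourier_coeff_diff)
    qed
    show "((\<lambda>x. fourier_coeff (\<lambda>\<phi>. u x \<phi> - u t \<phi>) \<xi>) \<longlongrightarrow> 0) (at t within {0..T})" for \<xi>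
      using cont[of \<xi>] t unfolding fourier_coeff_diff continuous_on_def by (intro LIM_zero) blast
  qed
qed

lemma C0_curves_sobolev_lincomb:
  assumes u: "u \<in> C0_curves T (sobolev_top r)" and v: "v \<in> C0_curves T (sobolev_top r)"
  shows "restrict (\<lambda>t \<phi>. a * u t \<phi> + b * v t \<phi>) {0..T} \<in> C0_curves T (sobolev_top r)"
  unfolding C0_curves_iff
proof (intro conjI ballI limitin_sobolevI)
  have us: "u t \<in> sobolev r" and vs: "v t \<in> sobolev r" if "t \<in> {0..T}" for t
    using C0_curvesD(1)[OF u that] C0_curvesD(1)[OF v that] by auto
  let ?w = "restrict (\<lambda>t \<phi>. a * u t \<phi> + b * v t \<phi>) {0..T}"
  show "?w \<in> extensional {0..T}" by simp
  fix t assume t: "t \<in> {0..T}"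
  show "?w x \<in> sobolev r" if "x \<in> {0..T}" for x using sobolev_lincomb(1)[OF us vs, of x x a b] that by simp
  then show "?w t \<in> sobolev r" using t by blast
  have norm_lim: "((\<lambda>x. sobolev_norm r (\<lambda>\<phi>. w x \<phi> - w t \<phi>)) \<longlongrightarrow> 0) (at t within {0..T})"
    if "w \<in> C0_curves T (sobolev_top r)" for w
    using C0_curvesD(2)[OF that t] unfolding limitin_sobolev_top
    by (intro tendstoI) (auto simp: eventually_conj_iff)
  have "((\<lambda>x. cmod a * sobolev_norm r (\<lambda>\<phi>. u x \<phi> - u t \<phi>) + cmod b * sobolev_norm r (\<lambda>\<phi>. v x \<phi> - v t \<phi>)) \<longlongrightarrow>
      cmod a * 0 + cmod b * 0) (at t within {0..T})"
    by (intro tendsto_intros norm_lim u v)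
  then have lim: "((\<lambda>x. cmod a * sobolev_norm r (\<lambda>\<phi>. u x \<phi> - u t \<phi>) + cmod b * sobolev_norm r (\<lambda>\<phi>. v x \<phi> - v t \<phi>)) \<longlongrightarrow> 0) (at t within {0..T})"
    by simp
  show "((\<lambda>x. sobolev_norm r (\<lambda>\<phi>. ?w x \<phi> - ?w t \<phi>)) \<longlongrightarrow> 0) (at t within {0..T})"
  proof (rule Lim_null_comparison[OF eventually_mono[OF eventually_at_within_mem] lim])
    fix x assume x: "x \<in> {0..T}"
    have "(\<lambda>\<phi>. ?w x \<phi> - ?w t \<phi>) = (\<lambda>\<phi>. a * (u x \<phi> - u t \<phi>) + b * (v x \<phi> - v t \<phi>))"
      using x t by (simp add: algebra_simps)
    then show "norm (sobolev_norm r (\<lambda>\<phi>. ?w x \<phi> - ?w t \<phi>)) \<le>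
        cmod a * sobolev_norm r (\<lambda>\<phi>. u x \<phi> - u t \<phi>) + cmod b * sobolev_norm r (\<lambda>\<phi>. v x \<phi> - v t \<phi>)"
      using sobolev_lincomb(2)[OF sobolev_diff[OF us[OF x] us[OF t]] sobolev_diff[OF vs[OF x] vs[OF t]], of a b]
      by simp
  qed
qed

lemma C1_curvesI:
  assumes "u \<in> C0_curves T X" "V \<in> C0_curves T X"
    "\<And>t. t \<in> {0..T} \<Longrightarrow> limitin X (\<lambda>\<tau> \<psi>. (u \<tau> \<psi> - u t \<psi>) / of_real (\<tau> - t)) (V t) (at t within {0..T})"
  shows "u \<in> C1_curves T X"
  unfolding C1_curves_def using assms by blast

lemma Cinf_sobolev: "u \<in> Cinf \<Longrightarrow> u \<in> sobolev r"
  by (auto simp: Cinf_def)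

lemma CinfI: "(\<And>r. u \<in> sobolev r) \<Longrightarrow> u \<in> Cinf"
  by (auto simp: Cinf_def)

lemma limitin_CinfI:
  assumes "\<And>r. limitin (sobolev_top r) h l (at t within S)" "\<And>x. x \<in> S \<Longrightarrow> h x \<in> Cinf"
  shows "limitin Cinf_top h l (at t within S)"
  unfolding limitin_Cinf_top
proof (intro conjI allI impI)
  show "l \<in> Cinf" using assms(1) by (auto intro!: CinfI simp: limitin_sobolev_top)
  show "\<forall>\<^sub>F x in at t within S. h x \<in> Cinf"
    using eventually_at_within_mem by (rule eventually_mono) (rule assms(2))
  show "\<forall>\<^sub>F x in at t within S. sobolev_norm r (\<lambda>\<phi>. h x \<phi> - l \<phi>) < e" if "e > 0" for r e
    using assms(1)[of r] that by (auto simp: limitin_sobolev_top eventually_conj_iff)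
qed

lemma C0_curves_CinfI:
  assumes "\<And>r. u \<in> C0_curves T (sobolev_top r)" shows "u \<in> C0_curves T Cinf_top"
  unfolding C0_curves_iff
proof (intro conjI ballI limitin_CinfI)
  show "u \<in> extensional {0..T}" by (rule C0_curvesD(3)[OF assms])
  show "limitin (sobolev_top r) u (u t) (at t within {0..T})" if "t \<in> {0..T}" for t r
    by (rule C0_curvesD(2)[OF assms that])
  show "u x \<in> Cinf" if "x \<in> {0..T}" for x
    by (intro CinfI) (use C0_curvesD(1)[OF assms that] in simp)
qed

lemma distribution_has_sum_derivatives:
  assumes u: "u \<in> distributions" and \<psi>: "\<psi> \<in> torus_fun"
  shows "((\<lambda>\<xi>. fourier_transform \<psi> \<xi> * fourier_coeff u (- \<xi>)) has_sum u \<psi>) UNIV"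
    and "((\<lambda>\<xi>. fourier_transform \<psi> \<xi> * of_int (\<xi> $ j) * fourier_coeff u (- \<xi>)) has_sum u (Dx j \<psi>)) UNIV"
    and "((\<lambda>\<xi>. fourier_transform \<psi> \<xi> * of_real (- (norm (int_vec \<xi>))\<^sup>2) * fourier_coeff u (- \<xi>)) has_sum u (laplacian \<psi>)) UNIV"
proof -
  let ?c = "fourier_transform \<psi>"
  have r: "rapid ?c" by (rule rapid_fourier_transform[OF \<psi>])
  show "((\<lambda>\<xi>. ?c \<xi> * fourier_coeff u (- \<xi>)) has_sum u \<psi>) UNIV"
    using distribution_has_sum[OF u r] by (simp add: fourier_inversion \<psi> fourier_coeff_eq)
  show "((\<lambda>\<xi>. ?c \<xi> * of_int (\<xi> $ j) * fourier_coeff u (- \<xi>)) has_sum u (Dx j \<psi>)) UNIV"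
    using distribution_has_sum[OF u rapid_component[OF r, of j]] Dx_fourier_series[OF r, of j]
    by (simp add: fourier_inversion \<psi> fourier_coeff_eq)
  have "cmod (of_real (- (norm (int_vec \<xi>))\<^sup>2)) \<le> 1 * japanese \<xi> ^ 2" for \<xi> :: "int ^ 'a"
    using power_mono[OF norm_int_vec_le[of \<xi>], of 2] by (simp add: norm_power)
  from rapid_mult[OF r this]
  show "((\<lambda>\<xi>. ?c \<xi> * of_real (- (norm (int_vec \<xi>))\<^sup>2) * fourier_coeff u (- \<xi>)) has_sum u (laplacian \<psi>)) UNIV"
    using distribution_has_sum[OF u, of "\<lambda>\<xi>. ?c \<xi> * of_real (- (norm (int_vec \<xi>))\<^sup>2)"] laplacian_fourier_series[OF r]
    by (simp add: fourier_inversion \<psi> fourier_coeff_eq)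
qed

context parabolic_problem
begin

lemma solution_C0:
  assumes f: "f \<in> C0_curves T (sobolev_top r)" and g: "g \<in> sobolev r"
  shows "solution f g \<in> C0_curves T (sobolev_top r)"
proof -
  obtain m B where m: "\<And>\<xi> t. t \<in> {0..T} \<Longrightarrow> cmod (solution_coeff f g \<xi> t) \<le> m \<xi>"
    "\<And>F. finite F \<Longrightarrow> L2_set (\<lambda>\<xi>. m \<xi> * japanese \<xi> powr r) F \<le> B" "\<And>\<xi>. 0 \<le> m \<xi>"
    using solution_coeff_majorant[OF f g] by metis
  show ?thesis
  proof (rule C0_curves_sobolevI[OF _ _ _ m(2)])
    show "solution f g \<in> extensional {0..T}" by (simp add: solution_def)
    fix t assume t: "t \<in> {0..T}"
    have "L2_set (\<lambda>\<xi>. cmod (solution_coeff f g \<xi> t) * japanese \<xi> powr r) F \<le> B" if "finite F" for F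
      by (rule order.trans[OF L2_set_mono m(2)[OF that]]) (auto intro!: mult_right_mono m(1) t)
    from sobolev_distr_of_coeffs(1)[OF this] show "solution f g t \<in> distributions"
      using t sobolev_distributions by (auto simp: solution_def)
    show "cmod (fourier_coeff (solution f g t) \<xi>) \<le> m \<xi>" for \<xi>
      using m(1)[OF t] t by (simp add: fourier_coeff_solution)
  next
    show "continuous_on {0..T} (\<lambda>t. fourier_coeff (solution f g t) \<xi>)" for \<xi>
      using solution_coeff_continuous[OF f, of g \<xi>]
      by (rule continuous_on_eq) (simp add: fourier_coeff_solution)
  qed
qed

text \<open>The symbol part has the majorant of the solution times M (1 + |xi|)^2, at the cost of
  two orders. The coefficients of f need have no such majorant, so f is added afterwards as a curve
  that is continuous by hypothesis.\<close>

lemma solution_deriv_C0: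
  assumes f: "f \<in> C0_curves T (sobolev_top r)" and g: "g \<in> sobolev r"
  shows "solution_deriv f g \<in> C0_curves T (sobolev_top (r - 2))"
proof -
  obtain m B where m: "\<And>\<xi> t. t \<in> {0..T} \<Longrightarrow> cmod (solution_coeff f g \<xi> t) \<le> m \<xi>"
    "\<And>F. finite F \<Longrightarrow> L2_set (\<lambda>\<xi>. m \<xi> * japanese \<xi> powr r) F \<le> B" "\<And>\<xi>. 0 \<le> m \<xi>"
    using solution_coeff_majorant[OF f g] by metis
  obtain M where M: "M \<ge> 0" "\<And>t \<xi>. t \<in> {0..T} \<Longrightarrow> cmod (symbol \<xi> t) \<le> M * (japanese \<xi>)\<^sup>2"
    using symbol_bound by blast
  define P where "P = restrict (\<lambda>t. distr_of_coeffs (\<lambda>\<xi>. symbol \<xi> t * solution_coeff f g \<xi> t)) {0..T}"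
  have jp: "(japanese \<xi>)\<^sup>2 * japanese \<xi> powr (r - 2) = japanese \<xi> powr r" for \<xi> :: "int ^ 'n"
    using powr_add[of "japanese \<xi>" 2 "r - 2"] by (simp add: powr_numeral)
  define m' where "m' \<xi> = M * (japanese \<xi>)\<^sup>2 * m \<xi>" for \<xi>
  have le: "cmod (symbol \<xi> t * solution_coeff f g \<xi> t) \<le> m' \<xi>" if "t \<in> {0..T}" for t \<xi>
    unfolding norm_mult m'_def by (intro mult_mono M m that) (auto simp: M)
  have m': "L2_set (\<lambda>\<xi>. m' \<xi> * japanese \<xi> powr (r - 2)) F \<le> M * B" if "finite F" for F
  proof -
    have "L2_set (\<lambda>\<xi>. m' \<xi> * japanese \<xi> powr (r - 2)) F = M * L2_set (\<lambda>\<xi>. m \<xi> * japanese \<xi> powr r) F"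
      by (simp add: m'_def L2_set_right_distrib M(1) jp[symmetric] mult_ac)
    also have "\<dots> \<le> M * B" by (intro mult_left_mono m that M)
    finally show ?thesis .
  qed
  have P: "P \<in> C0_curves T (sobolev_top (r - 2))"
  proof (rule C0_curves_sobolevI[OF _ _ _ m'])
    show "P \<in> extensional {0..T}" by (simp add: P_def)
    fix t assume t: "t \<in> {0..T}"
    have "L2_set (\<lambda>\<xi>. cmod (symbol \<xi> t * solution_coeff f g \<xi> t) * japanese \<xi> powr (r - 2)) F \<le> M * B" if "finite F" for F
      by (rule order.trans[OF L2_set_mono m'[OF that]]) (auto intro!: mult_right_mono le t)
    from sobolev_distr_of_coeffs(1)[OF this] show "P t \<in> distributions"
      using t sobolev_distributions by (auto simp: P_def)
    show "cmod (fourier_coeff (P t) \<xi>) \<le> m' \<xi>" for \<xi>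
      using le[OF t] t by (simp add: P_def fourier_coeff_distr_of_coeffs)
  next
    show "continuous_on {0..T} (\<lambda>t. fourier_coeff (P t) \<xi>)" for \<xi>
      using continuous_on_mult[OF symbol_continuous solution_coeff_continuous[OF f, of g \<xi>], of \<xi>]
      by (rule continuous_on_eq) (simp add: P_def fourier_coeff_distr_of_coeffs)
  qed
  have "solution_deriv f g = restrict (\<lambda>t \<phi>. 1 * P t \<phi> + \<i> * f t \<phi>) {0..T}"
    by (auto simp: solution_deriv_def P_def restrict_def)
  also have "\<dots> \<in> C0_curves T (sobolev_top (r - 2))"
    by (intro C0_curves_sobolev_lincomb P C0_curves_sobolev_mono[OF f]) simp
  finally show ?thesis .
qed

lemma solution_quotient:
  assumes f: "f \<in> C0_curves T (sobolev_top r)" and g: "g \<in> sobolev r" and t: "t \<in> {0..T}"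
  shows "limitin (sobolev_top (r - 2)) (\<lambda>\<tau> \<psi>. (solution f g \<tau> \<psi> - solution f g t \<psi>) / of_real (\<tau> - t))
    (solution_deriv f g t) (at t within {0..T})"
proof (rule limitin_sobolev_quotient[OF _ solution_deriv_C0[OF f g] _ t])
  show "solution f g t \<in> sobolev (r - 2)" if "t \<in> {0..T}" for t
    using C0_curvesD(1)[OF solution_C0[OF f g] that] by (auto intro: sobolev_mono(1))
  show "((\<lambda>t. fourier_coeff (solution f g t) \<xi>) has_vector_derivative fourier_coeff (solution_deriv f g t) \<xi>) (at t within {0..T})"
    if t: "t \<in> {0..T}" for t \<xi>
    unfolding fourier_coeff_solution_deriv[OF t]
    by (rule has_vector_derivative_transform[OF t _ solution_coeff_derivative[OF f t]])
       (simp add: fourier_coeff_solution)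
qed

lemma solution_C1:
  assumes f: "f \<in> C0_curves T (sobolev_top r)" and g: "g \<in> sobolev r"
  shows "solution f g \<in> C1_curves T (sobolev_top (r - 2))"
  by (rule C1_curvesI[OF C0_curves_sobolev_mono[OF solution_C0[OF f g]] solution_deriv_C0[OF f g] solution_quotient[OF f g]]) auto

lemma solution_0:
  assumes "g \<in> distributions" shows "solution f g 0 = g"
  using T_pos distribution_eq_distr_of_coeffs[OF assms]
  by (simp add: solution_def solution_coeff_def linear_ode_solution_0)

text \<open>By construction the equation holds for coefficients. Expanding every term in the Fourier
  coefficients of psi extends it to all test functions, as the weak formulation demands.\<close>

lemma solution_deriv_eq:
  assumes f: "f \<in> C0_curves T (sobolev_top r)" and g: "g \<in> sobolev r" and t: "t \<in> {0..T}" and \<psi>: "\<psi> \<in> torus_fun"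
  shows "solution_deriv f g t \<psi> = - \<i> * spatial_part a2 a1 a0 (solution f g) t \<psi> + \<i> * f t \<psi>"
proof -
  let ?u = "solution f g t" and ?c = "fourier_transform \<psi>"
  have u: "?u \<in> distributions" and ft: "f t \<in> distributions" and V: "solution_deriv f g t \<in> distributions"
    using C0_curvesD(1)[OF solution_C0[OF f g] t] C0_curvesD(1)[OF f t] C0_curvesD(1)[OF solution_deriv_C0[OF f g] t] sobolev_distributions
    by auto
  have "((\<lambda>\<xi>. - \<i> * (- a2 t * (?c \<xi> * of_real (- (norm (int_vec \<xi>))\<^sup>2) * fourier_coeff ?u (- \<xi>))
       + (\<Sum>j\<in>UNIV. a1 j t * - (?c \<xi> * of_int (\<xi> $ j) * fourier_coeff ?u (- \<xi>)))
       + a0 t * (?c \<xi> * fourier_coeff ?u (- \<xi>))) + \<i> * (?c \<xi> * fourier_coeff (f t) (- \<xi>)))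
     has_sum (- \<i> * (- a2 t * ?u (laplacian \<psi>) + (\<Sum>j\<in>UNIV. a1 j t * - ?u (Dx j \<psi>)) + a0 t * ?u \<psi>) + \<i> * f t \<psi>)) UNIV"
    by (intro has_sum_add has_sum_cmult_right has_sum_sum has_sum_uminusI distribution_has_sum_derivatives u ft \<psi>)
  moreover have "((\<lambda>\<xi>. ?c \<xi> * fourier_coeff (solution_deriv f g t) (- \<xi>)) has_sum solution_deriv f g t \<psi>) UNIV"
    by (rule distribution_has_sum_derivatives(1)[OF V \<psi>])
  moreover have "?c \<xi> * fourier_coeff (solution_deriv f g t) (- \<xi>) = - \<i> * (- a2 t * (?c \<xi> * of_real (- (norm (int_vec \<xi>))\<^sup>2) * fourier_coeff ?u (- \<xi>))
       + (\<Sum>j\<in>UNIV. a1 j t * - (?c \<xi> * of_int (\<xi> $ j) * fourier_coeff ?u (- \<xi>)))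
       + a0 t * (?c \<xi> * fourier_coeff ?u (- \<xi>))) + \<i> * (?c \<xi> * fourier_coeff (f t) (- \<xi>))" for \<xi>
    unfolding fourier_coeff_solution_deriv[OF t] fourier_coeff_solution[OF t, symmetric] symbol_def
    by (simp add: sum_distrib_left sum_distrib_right sum_negf algebra_simps)
  ultimately have "solution_deriv f g t \<psi> = - \<i> * (- a2 t * ?u (laplacian \<psi>) + (\<Sum>j\<in>UNIV. a1 j t * - ?u (Dx j \<psi>)) + a0 t * ?u \<psi>) + \<i> * f t \<psi>"
    by (auto intro: has_sum_unique)
  then show ?thesis
    using \<psi> by (simp add: spatial_part_def distr_laplacian_def distr_Dx_def)
qed

text \<open>For fixed psi the pairing with the solution is classically differentiable in t, since
  Sobolev convergence implies convergence of values; the weak time derivative is then integration by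
  parts.\<close>

lemma solution_solves_CP:
  assumes f: "f \<in> C0_curves T (sobolev_top r)" and g: "g \<in> sobolev r"
  shows "solves_CP T a2 a1 a0 f g (solution f g)"
  unfolding solves_CP_def
proof (intro conjI ballI)
  let ?u = "solution f g" and ?V = "solution_deriv f g" and ?P = "spatial_part a2 a1 a0 (solution f g)"
  show "\<exists>\<rho>. ?u \<in> C0_curves T (sobolev_top \<rho>)" using solution_C0[OF f g] by blast
  show "?u 0 = g" by (rule solution_0[OF sobolev_distributions[OF g]])
  fix \<phi> assume \<phi>: "\<phi> \<in> time_tests T"
  show "(\<lambda>\<psi>. weak_Dt T ?u \<phi> \<psi> + distr_integral T (\<lambda>t \<psi>. ?P t \<psi> * \<phi> t) \<psi>)
        = distr_integral T (\<lambda>t \<psi>. f t \<psi> * \<phi> t)"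
  proof
    fix \<psi>
    show "weak_Dt T ?u \<phi> \<psi> + distr_integral T (\<lambda>t \<psi>. ?P t \<psi> * \<phi> t) \<psi> = distr_integral T (\<lambda>t \<psi>. f t \<psi> * \<phi> t) \<psi>"
    proof (cases "\<psi> \<in> torus_fun")
      \<comment> \<open>Off the test functions every distribution is 0 by normalization; the
        identity of functionals has to hold there too.\<close>
      case False
      have z: "?u t \<psi> = 0" "f t \<psi> = 0" if "t \<in> {0..T}" for t
        using C0_curvesD(1)[OF solution_C0[OF f g] that] C0_curvesD(1)[OF f that] sobolev_distributions distributionsD(1) False
        by auto
      have "integral {0..T} (\<lambda>t. ?u t \<psi> * (- ((1 / \<i>) * vector_derivative \<phi> (at t)))) = integral {0..T} (\<lambda>_. 0)"
        "integral {0..T} (\<lambda>t. ?P t \<psi> * \<phi> t) = integral {0..T} (\<lambda>_. 0)"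
        "integral {0..T} (\<lambda>t. f t \<psi> * \<phi> t) = integral {0..T} (\<lambda>_. 0)"
        by (rule integral_cong, simp add: z False spatial_part_def distr_laplacian_def distr_Dx_def)+
      then show ?thesis by (simp add: weak_Dt_def distr_integral_def)
    next
      case True
      have eval: "continuous_on {0..T} (\<lambda>t. w t \<psi>)" if "w \<in> C0_curves T (sobolev_top \<rho>)" for w \<rho>
        using limitin_sobolev_eval[OF C0_curvesD(2)[OF that] True] by (simp add: continuous_on_def)
      have Vc: "continuous_on {0..T} (\<lambda>t. ?V t \<psi>)" by (rule eval[OF solution_deriv_C0[OF f g]])
      have fc: "continuous_on {0..T} (\<lambda>t. f t \<psi>)" by (rule eval[OF f])
      have uc: "continuous_on {0..T} (\<lambda>t. ?u t \<psi>)" by (rule eval[OF solution_C0[OF f g]])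
      have der: "((\<lambda>t. ?u t \<psi>) has_vector_derivative ?V t \<psi>) (at t within {0..T})" if "t \<in> {0..T}" for t
        by (rule has_vector_derivativeI_quotient[OF limitin_sobolev_eval[OF solution_quotient[OF f g that] True]])
      have "weak_Dt T ?u \<phi> \<psi> = integral {0..T} (\<lambda>t. \<i> * (?u t \<psi> * vector_derivative \<phi> (at t)))"
        unfolding weak_Dt_def distr_integral_def by (rule integral_cong) simp
      also have "\<dots> = \<i> * - integral {0..T} (\<lambda>t. ?V t \<psi> * \<phi> t)"
        using time_test_by_parts[OF \<phi> T_pos der Vc] by simp
      finally have 1: "weak_Dt T ?u \<phi> \<psi> = integral {0..T} (\<lambda>t. - \<i> * (?V t \<psi> * \<phi> t))" by simp
      have 2: "integral {0..T} (\<lambda>t. ?P t \<psi> * \<phi> t) = integral {0..T} (\<lambda>t. \<i> * (?V t \<psi> * \<phi> t) + f t \<psi> * \<phi> t)"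
        by (rule integral_cong) (simp add: solution_deriv_eq[OF f g _ True] algebra_simps)
      have "integral {0..T} (\<lambda>t. - \<i> * (?V t \<psi> * \<phi> t)) + integral {0..T} (\<lambda>t. \<i> * (?V t \<psi> * \<phi> t) + f t \<psi> * \<phi> t)
         = integral {0..T} (\<lambda>t. - \<i> * (?V t \<psi> * \<phi> t) + (\<i> * (?V t \<psi> * \<phi> t) + f t \<psi> * \<phi> t))"
        by (intro integral_add[symmetric] integrable_continuous_interval continuous_intros Vc fc time_test_continuous_on[OF \<phi>])
      then show ?thesis using 1 2 by (simp add: distr_integral_def)
    qed
  qed
qed

lemma sobolev_well_posed:
  assumes f: "f \<in> C0_curves T (sobolev_top r)" and g: "g \<in> sobolev r"
  shows "\<exists>!u. u \<in> C0_curves T (sobolev_top r) \<inter> C1_curves T (sobolev_top (r - 2)) \<and> solves_CP T a2 a1 a0 f g u"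
  using solution_C0[OF f g] solution_C1[OF f g] solution_solves_CP[OF f g] solves_CP_unique[OF _ _ f]
  by (intro ex1I[of _ "solution f g"]) auto

lemma Cinf_well_posed:
  assumes f: "f \<in> C0_curves T Cinf_top" and g: "g \<in> Cinf"
  shows "\<exists>!u. u \<in> C1_curves T Cinf_top \<and> solves_CP T a2 a1 a0 f g u"
proof (rule ex1I[of _ "solution f g"])
  have fr: "f \<in> C0_curves T (sobolev_top r)" for r by (rule C0_curves_Cinf_sobolev[OF f])
  have gr: "g \<in> sobolev r" for r by (rule Cinf_sobolev[OF g])
  have C0: "solution f g \<in> C0_curves T Cinf_top"
    by (intro C0_curves_CinfI solution_C0 fr gr)
  \<comment> \<open>Data of order r + 2 give the derivative in order r, and for smooth data this
    reaches every r.\<close>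
  have V: "solution_deriv f g \<in> C0_curves T Cinf_top"
    using solution_deriv_C0[OF fr gr, of "_ + 2"] by (intro C0_curves_CinfI) simp
  have "limitin Cinf_top (\<lambda>\<tau> \<psi>. (solution f g \<tau> \<psi> - solution f g t \<psi>) / of_real (\<tau> - t)) (solution_deriv f g t) (at t within {0..T})"
    if t: "t \<in> {0..T}" for t
  proof (rule limitin_CinfI)
    show "limitin (sobolev_top r) (\<lambda>\<tau> \<psi>. (solution f g \<tau> \<psi> - solution f g t \<psi>) / of_real (\<tau> - t)) (solution_deriv f g t) (at t within {0..T})" for r
      using solution_quotient[OF fr gr t, of "r + 2"] by simp
    fix x assume x: "x \<in> {0..T}"
    have "(\<lambda>\<psi>. 1 / of_real (x - t) * (solution f g x \<psi> - solution f g t \<psi>)) \<in> sobolev r" for r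
      using C0_curvesD(1)[OF solution_C0[OF fr gr] x, of r] C0_curvesD(1)[OF solution_C0[OF fr gr] t, of r]
      by (intro sobolev_cmult sobolev_diff) auto
    then show "(\<lambda>\<psi>. (solution f g x \<psi> - solution f g t \<psi>) / of_real (x - t)) \<in> Cinf"
      by (intro CinfI) simp
  qed
  then show "solution f g \<in> C1_curves T Cinf_top \<and> solves_CP T a2 a1 a0 f g (solution f g)"
    by (intro conjI C1_curvesI[OF C0 V] solution_solves_CP[OF fr gr])
  show "u = solution f g" if "u \<in> C1_curves T Cinf_top \<and> solves_CP T a2 a1 a0 f g u" for u
    using solves_CP_unique[OF conjunct2[OF that] solution_solves_CP[OF fr gr] fr] .
qed

end

subsection \<open>Gevrey regularity and decay of the Fourier coefficients\<close>

text \<open>Gevrey regularity of order s corresponds to coefficients of size exp(-epsilon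
  |xi|^(1/s)). The parameter is used with both signs, as growth and as decay.\<close>

definition gevrey_weight :: "real \<Rightarrow> real \<Rightarrow> int ^ 'n \<Rightarrow> real" where
  "gevrey_weight s \<epsilon> \<xi> = exp (\<epsilon> * norm (int_vec \<xi>) powr (1 / s))"

lemma gevrey_weight_pos [simp]: "0 < gevrey_weight s \<epsilon> \<xi>" "0 \<le> gevrey_weight s \<epsilon> \<xi>"
  by (simp_all add: gevrey_weight_def)

lemma gevrey_weight_add: "gevrey_weight s (a + b) \<xi> = gevrey_weight s a \<xi> * gevrey_weight s b \<xi>"
  by (simp add: gevrey_weight_def distrib_right exp_add)

lemma gevrey_weight_mono: "a \<le> b \<Longrightarrow> gevrey_weight s a \<xi> \<le> gevrey_weight s b \<xi>"
  by (simp add: gevrey_weight_def mult_right_mono)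

lemma gevrey_weight_ge_1: "0 \<le> a \<Longrightarrow> 1 \<le> gevrey_weight s a \<xi>"
  by (simp add: gevrey_weight_def)

lemma gevrey_weight_minus: "gevrey_weight s a \<xi> * gevrey_weight s (- a) \<xi> = 1"
  using gevrey_weight_add[of s a "- a" \<xi>] by (simp add: gevrey_weight_def)

text \<open>Polynomial factors, such as those of the symbol or of the lattice sum, cost only an
  arbitrarily small part of a decay rate.\<close>

lemma japanese_power_le_gevrey_weight:
  assumes s: "s \<ge> 1" and e: "\<epsilon> > 0"
  shows "\<exists>C\<ge>0. \<forall>\<xi>. japanese \<xi> ^ m \<le> C * gevrey_weight s \<epsilon> \<xi>"
proof -
  \<comment> \<open>As n >= s m, for |xi| >= 1 the power |xi|^m is at most the n-th power of
    |xi|^(1/s), which one term of the exponential series controls.\<close>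
  define n where "n = nat \<lceil>s * real m\<rceil>"
  have n: "s * real m \<le> real n" unfolding n_def by linarith
  define C where "C = 2 ^ m * (1 + fact n / \<epsilon> ^ n)"
  have "japanese \<xi> ^ m \<le> C * gevrey_weight s \<epsilon> \<xi>" for \<xi> :: "int ^ 'a"
  proof -
    define x where "x = norm (int_vec \<xi>)"
    have x0: "x \<ge> 0" by (simp add: x_def)
    have "japanese \<xi> \<le> 2 * max 1 x" by (simp add: japanese_def x_def)
    then have "japanese \<xi> ^ m \<le> (2 * max 1 x) ^ m" by (rule power_mono) simp
    also have "\<dots> = 2 ^ m * max 1 x ^ m" by (simp add: power_mult_distrib)
    also have "max 1 x ^ m \<le> (1 + fact n / \<epsilon> ^ n) * gevrey_weight s \<epsilon> \<xi>"
    proof (cases "x \<le> 1")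
      case True
      have "1 * 1 \<le> (1 + fact n / \<epsilon> ^ n) * gevrey_weight s \<epsilon> \<xi>"
        using e by (intro mult_mono gevrey_weight_ge_1) auto
      with True show ?thesis by simp
    next
      case False
      then have x: "x > 1" by simp
      have "max 1 x ^ m = x powr (real m)" using x by (simp add: powr_realpow)
      also have "\<dots> \<le> x powr (1 / s * real n)"
        using n s x by (intro powr_mono) (auto simp: field_simps)
      also have "\<dots> = (x powr (1 / s)) ^ n" using x by (simp add: powr_realpow[symmetric] powr_powr)
      also have "\<dots> = (\<epsilon> * x powr (1 / s)) ^ n / \<epsilon> ^ n" using e by (simp add: power_mult_distrib)
      also have "\<dots> \<le> (fact n * exp (\<epsilon> * x powr (1 / s))) / \<epsilon> ^ n"
        using e by (intro divide_right_mono power_le_fact_exp) auto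
      also have "\<dots> = fact n / \<epsilon> ^ n * gevrey_weight s \<epsilon> \<xi>" by (simp add: gevrey_weight_def x_def)
      also have "\<dots> \<le> (1 + fact n / \<epsilon> ^ n) * gevrey_weight s \<epsilon> \<xi>"
        by (intro mult_right_mono) auto
      finally show ?thesis .
    qed
    finally show ?thesis by (simp add: C_def mult.assoc)
  qed
  moreover have "C \<ge> 0" using e by (simp add: C_def)
  ultimately show ?thesis by blast
qed

lemma summable_gevrey_weight:
  assumes s: "s \<ge> 1" and e: "\<epsilon> > 0"
  shows "(\<lambda>\<xi> :: int ^ 'n::finite. gevrey_weight s (- \<epsilon>) \<xi>) summable_on UNIV"
proof -
  obtain C where C: "C \<ge> 0" "\<And>\<xi> :: int ^ 'n. japanese \<xi> ^ (2 * CARD('n)) \<le> C * gevrey_weight s \<epsilon> \<xi>"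
    using japanese_power_le_gevrey_weight[OF s e] by blast
  show ?thesis
  proof (rule summable_on_bound)
    show "(\<lambda>\<xi> :: int ^ 'n. C * (1 / japanese \<xi> ^ (2 * CARD('n)))) summable_on UNIV"
      by (intro summable_on_cmult_right summable_on_japanese)
    fix \<xi> :: "int ^ 'n"
    have "japanese \<xi> ^ (2 * CARD('n)) * gevrey_weight s (- \<epsilon>) \<xi> \<le> C * gevrey_weight s \<epsilon> \<xi> * gevrey_weight s (- \<epsilon>) \<xi>"
      by (intro mult_right_mono C) simp
    then have "japanese \<xi> ^ (2 * CARD('n)) * gevrey_weight s (- \<epsilon>) \<xi> \<le> C"
      by (simp add: mult.assoc gevrey_weight_minus)
    then show "norm (gevrey_weight s (- \<epsilon>) \<xi>) \<le> C * (1 / japanese \<xi> ^ (2 * CARD('n)))"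
      by (simp add: field_simps)
  qed
qed

text \<open>The decay rate that factorial bounds with constant h produce:
  \<open>factorial_powr_decay\<close> is applied with z = |xi| / (N h), where N comes from replacing
  |xi| by a dominating component, and s/2 is the factor in that lemma.\<close>

definition gevrey_rate :: "nat \<Rightarrow> real \<Rightarrow> real \<Rightarrow> real" where
  "gevrey_rate N s h = s / 2 * (1 / (real N * h)) powr (1 / s)"

lemma gevrey_rate_pos: "N > 0 \<Longrightarrow> s \<ge> 1 \<Longrightarrow> h > 0 \<Longrightarrow> gevrey_rate N s h > 0"
  by (simp add: gevrey_rate_def)

text \<open>Taking the power \<open>1/s\<close> of the estimates turns them into bounds for the terms of an exponential series.\<close>

lemma factorial_powr_decay:
  fixes z c G s :: real
  assumes s: "s \<ge> 1" and z: "z \<ge> 0" and c: "c \<ge> 0" and G: "G \<ge> 0"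
    and le: "\<And>k::nat. z ^ k * c \<le> G * fact k powr s"
  shows "c * exp (s / 2 * z powr (1 / s)) \<le> 2 powr s * G"
proof -
  define y where "y = z powr (1 / s)"
  have y0: "y \<ge> 0" by (simp add: y_def)
  define \<kappa> where "\<kappa> = c powr (1 / s)"
  define \<Gamma> where "\<Gamma> = G powr (1 / s)"
  \<comment> \<open>Halving the argument supplies the geometric factor (1/2)^k, without which the
    termwise bounds could not be summed.\<close>
  have coeff_le: "(y / 2) ^ k /\<^sub>R fact k * \<kappa> \<le> \<Gamma> * (1 / 2) ^ k" for k
  proof -
    have "(z ^ k * c) powr (1 / s) \<le> (G * fact k powr s) powr (1 / s)"
      using s z c le[of k] by (intro powr_mono2) auto
    also have "(z ^ k * c) powr (1 / s) = y ^ k * \<kappa>"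
    proof -
      have "(z ^ k) powr (1 / s) = y ^ k"
      proof (cases "z = 0")
        case True
        then show ?thesis using s by (cases k) (auto simp: y_def)
      next
        case False
        then show ?thesis using z by (simp add: y_def powr_realpow[symmetric] powr_powr mult.commute)
      qed
      then show ?thesis using z c by (simp add: powr_mult \<kappa>_def)
    qed
    also have "(G * fact k powr s) powr (1 / s) = \<Gamma> * fact k"
      using G s by (simp add: powr_mult powr_powr \<Gamma>_def)
    finally have "y ^ k * \<kappa> \<le> \<Gamma> * fact k" .
    then show ?thesis by (simp add: field_simps power_divide)
  qed
  have "(\<lambda>k. (y / 2) ^ k /\<^sub>R fact k * \<kappa>) sums (exp (y / 2) * \<kappa>)"
    by (intro sums_mult2 exp_converges)
  moreover have "(\<lambda>k. \<Gamma> * (1 / 2) ^ k) sums (\<Gamma> * (1 / (1 - 1 / 2)))"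
    by (intro sums_mult geometric_sums) simp
  ultimately have "exp (y / 2) * \<kappa> \<le> \<Gamma> * (1 / (1 - 1 / 2))"
    by (rule sums_le[OF coeff_le])
  then have "exp (y / 2) * \<kappa> \<le> 2 * \<Gamma>" by simp
  \<comment> \<open>The power s undoes the initial root, and the sum 2 of the geometric series
    becomes 2^s.\<close>
  then have "(exp (y / 2) * \<kappa>) powr s \<le> (2 * \<Gamma>) powr s"
    using s by (intro powr_mono2) (auto simp: \<kappa>_def)
  moreover have "(exp (y / 2) * \<kappa>) powr s = exp (s / 2 * y) * c"
    using s c by (simp add: powr_mult \<kappa>_def powr_powr exp_powr_real mult.commute)
  moreover have "(2 * \<Gamma>) powr s = 2 powr s * G"
    using s G by (simp add: powr_mult \<Gamma>_def powr_powr)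
  ultimately show ?thesis by (simp add: y_def mult.commute)
qed

lemma gevrey_quotient_le:
  assumes "\<phi> \<in> gevrey_step h s" "h > 0"
  shows "cmod (D_multi \<alpha> \<phi> x) \<le> gevrey_norm h s \<phi> * (h ^ mi_order \<alpha> * fact (mi_order \<alpha>) powr s)"
proof -
  have "cmod (D_multi \<alpha> \<phi> x) / (h ^ mi_order \<alpha> * fact (mi_order \<alpha>) powr s) \<in> gevrey_quotients h s \<phi>"
    by (auto simp: gevrey_quotients_def)
  then have "cmod (D_multi \<alpha> \<phi> x) / (h ^ mi_order \<alpha> * fact (mi_order \<alpha>) powr s) \<le> gevrey_norm h s \<phi>"
    unfolding gevrey_norm_def by (rule cSup_upper) (use assms in \<open>simp add: gevrey_step_def\<close>)
  then show ?thesis using assms(2) by (simp add: pos_divide_le_eq)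
qed

lemma gevrey_norm_nonneg: "\<phi> \<in> gevrey_step h s \<Longrightarrow> h > 0 \<Longrightarrow> 0 \<le> gevrey_norm h s \<phi>"
  using order.trans[OF norm_ge_zero gevrey_quotient_le[of \<phi> h s "\<lambda>_. 0" undefined]] by simp

text \<open>Derivatives of all orders k in one dominating direction j are used. The scaling of z
  makes z h at most |xi_j|, which removes h^k from the estimate.\<close>

lemma fourier_transform_gevrey_decay:
  fixes \<phi> :: "real ^ 'n::finite \<Rightarrow> complex"
  assumes phi: "\<phi> \<in> gevrey_step h s" and h: "h > 0" and s: "s \<ge> 1"
  shows "cmod (fourier_transform \<phi> \<xi>) \<le> 2 powr s * gevrey_norm h s \<phi> * gevrey_weight s (- gevrey_rate CARD('n) s h) \<xi>"
proof -
  let ?N = "real CARD('n)" and ?c = "cmod (fourier_transform \<phi> \<xi>)" and ?G = "gevrey_norm h s \<phi>"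
  have tf: "\<phi> \<in> torus_fun" using phi by (simp add: gevrey_step_def)
  obtain j where j: "norm (int_vec \<xi>) \<le> ?N * \<bar>real_of_int (\<xi> $ j)\<bar>" using ex_large_component by blast
  define z where "z = norm (int_vec \<xi>) / (?N * h)"
  have z0: "z \<ge> 0" using h by (simp add: z_def)
  have zj: "z * h \<le> \<bar>real_of_int (\<xi> $ j)\<bar>" using j h by (simp add: z_def field_simps)
  have "z ^ k * ?c \<le> ?G * fact k powr s" for k
  proof -
    have "\<bar>real_of_int (monomial \<xi> (\<lambda>i. if i = j then k else 0))\<bar> * ?c \<le> ?G * (h ^ k * fact k powr s)"
      by (rule norm_monomial_fourier_transform_le[OF tf]) (use gevrey_quotient_le[OF phi h, of "\<lambda>i. if i = j then k else 0"] in simp)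
    then have "\<bar>real_of_int (\<xi> $ j)\<bar> ^ k * ?c \<le> ?G * (h ^ k * fact k powr s)"
      by (simp add: monomial_single power_abs)
    moreover have "(z * h) ^ k * ?c \<le> \<bar>real_of_int (\<xi> $ j)\<bar> ^ k * ?c"
      using zj z0 h by (intro mult_right_mono power_mono) auto
    ultimately have "h ^ k * (z ^ k * ?c) \<le> h ^ k * (?G * fact k powr s)"
      by (simp add: power_mult_distrib mult_ac)
    then show ?thesis using h by simp
  qed
  from factorial_powr_decay[OF s z0 norm_ge_zero gevrey_norm_nonneg[OF phi h] this]
  have "?c * exp (s / 2 * z powr (1 / s)) \<le> 2 powr s * ?G" .
  moreover have "s / 2 * z powr (1 / s) = gevrey_rate CARD('n) s h * norm (int_vec \<xi>) powr (1 / s)"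
  proof -
    have "z = norm (int_vec \<xi>) * (1 / (?N * h))" by (simp add: z_def)
    then have "z powr (1 / s) = norm (int_vec \<xi>) powr (1 / s) * (1 / (?N * h)) powr (1 / s)"
      using h by (simp only: powr_mult[of "norm (int_vec \<xi>)" "1 / (?N * h)"])
    then show ?thesis by (simp add: gevrey_rate_def)
  qed
  ultimately have "?c * gevrey_weight s (gevrey_rate CARD('n) s h) \<xi> \<le> 2 powr s * ?G"
    by (simp add: gevrey_weight_def)
  then have "?c * gevrey_weight s (gevrey_rate CARD('n) s h) \<xi> * gevrey_weight s (- gevrey_rate CARD('n) s h) \<xi>
     \<le> 2 powr s * ?G * gevrey_weight s (- gevrey_rate CARD('n) s h) \<xi>"
    by (rule mult_right_mono) simp
  then show ?thesis by (simp add: mult.assoc gevrey_weight_minus)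
qed

text \<open>The converse direction: take y^k <= k! exp y with y = epsilon |xi|^(1/s) / s and raise
  it to the power s. Then exp(s y) is the weight and y^s = |xi| (epsilon/s)^s, which explains the
  constant (s/epsilon)^s.\<close>

lemma power_le_gevrey_weight:
  fixes \<xi> :: "int ^ 'n::finite"
  assumes s: "s \<ge> 1" and e: "\<epsilon> > 0"
  shows "norm (int_vec \<xi>) ^ k \<le> ((s / \<epsilon>) powr s) ^ k * fact k powr s * gevrey_weight s \<epsilon> \<xi>"
proof (cases "norm (int_vec \<xi>) = 0 \<and> k = 0")
  case True
  then show ?thesis using gevrey_weight_ge_1[of \<epsilon> s \<xi>] e by simp
next
  case nz: False
  define x where "x = norm (int_vec \<xi>)"
  define y where "y = \<epsilon> * x powr (1 / s) / s"
  have x0: "x \<ge> 0" by (simp add: x_def)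
  have y0: "y \<ge> 0" using e s by (simp add: y_def)
  have ys: "y powr s = x * (\<epsilon> / s) powr s"
    using e s x0 by (simp add: y_def powr_mult powr_divide powr_powr)
  have "(y ^ k) powr s \<le> (fact k * exp y) powr s"
    using y0 s by (intro powr_mono2 power_le_fact_exp) auto
  also have "\<dots> = fact k powr s * gevrey_weight s \<epsilon> \<xi>"
    using s by (simp add: powr_mult exp_powr_real gevrey_weight_def y_def x_def mult.commute)
  also have "(y ^ k) powr s = (y powr s) ^ k"
  proof (cases "y = 0")
    case True
    then show ?thesis using s by (cases k) auto
  next
    case False
    then show ?thesis using y0 by (simp add: powr_realpow[symmetric] powr_powr mult.commute)
  qed
  finally have "x ^ k * ((\<epsilon> / s) powr s) ^ k \<le> fact k powr s * gevrey_weight s \<epsilon> \<xi>"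
    by (simp add: ys power_mult_distrib)
  then have "x ^ k * ((\<epsilon> / s) powr s) ^ k * ((s / \<epsilon>) powr s) ^ k \<le> fact k powr s * gevrey_weight s \<epsilon> \<xi> * ((s / \<epsilon>) powr s) ^ k"
    by (rule mult_right_mono) simp
  moreover have "((\<epsilon> / s) powr s) ^ k * ((s / \<epsilon>) powr s) ^ k = 1"
    using e s by (simp add: power_mult_distrib[symmetric] powr_mult[symmetric])
  ultimately show ?thesis by (simp add: mult_ac x_def)
qed

text \<open>Half of the rate epsilon absorbs the polynomial weight, and the other half makes the sum
  converge.\<close>

lemma rapid_gevrey:
  assumes s: "s \<ge> 1" and e: "\<epsilon> > 0" and c: "\<And>\<xi>. cmod (c \<xi>) \<le> C * gevrey_weight s (- \<epsilon>) \<xi>"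
  shows "rapid c"
  unfolding rapid_def
proof
  fix m
  have C0: "C \<ge> 0" using order.trans[OF norm_ge_zero c[of 0]] by (simp add: zero_le_mult_iff gevrey_weight_def)
  obtain D where D: "D \<ge> 0" "\<And>\<xi> :: int ^ 'a. japanese \<xi> ^ m \<le> D * gevrey_weight s (\<epsilon> / 2) \<xi>"
    using japanese_power_le_gevrey_weight[OF s, of "\<epsilon> / 2"] e by auto
  show "(\<lambda>\<xi>. cmod (c \<xi>) * japanese \<xi> ^ m) summable_on UNIV"
  proof (rule summable_on_bound)
    show "(\<lambda>\<xi> :: int ^ 'a. C * D * gevrey_weight s (- (\<epsilon> / 2)) \<xi>) summable_on UNIV"
      by (intro summable_on_cmult_right summable_gevrey_weight s) (use e in simp)
    fix \<xi> :: "int ^ 'a"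
    have "cmod (c \<xi>) * japanese \<xi> ^ m \<le> (C * gevrey_weight s (- \<epsilon>) \<xi>) * (D * gevrey_weight s (\<epsilon> / 2) \<xi>)"
      by (intro mult_mono c D mult_nonneg_nonneg C0) auto
    also have "\<dots> = C * D * (gevrey_weight s (- \<epsilon>) \<xi> * gevrey_weight s (\<epsilon> / 2) \<xi>)" by simp
    also have "gevrey_weight s (- \<epsilon>) \<xi> * gevrey_weight s (\<epsilon> / 2) \<xi> = gevrey_weight s (- (\<epsilon> / 2)) \<xi>"
      by (simp add: gevrey_weight_add[symmetric])
    finally show "norm (cmod (c \<xi>) * japanese \<xi> ^ m) \<le> C * D * gevrey_weight s (- (\<epsilon> / 2)) \<xi>" by simp
  qed
qed

text \<open>The step H depends only on s and epsilon, and its norm is bounded by a weighted l1 norm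
  of the coefficients. In this quantitative form coefficient estimates control the seminorms of the
  inductive limit.\<close>

lemma fourier_series_gevrey_step:
  fixes c :: "int ^ 'n::finite \<Rightarrow> complex"
  assumes s: "s \<ge> 1" and e: "\<epsilon> > 0" and c: "rapid c"
    and sm: "(\<lambda>\<xi>. cmod (c \<xi>) * gevrey_weight s \<epsilon> \<xi>) summable_on UNIV"
  defines "H \<equiv> (s / \<epsilon>) powr s"
  shows "cmod (D_multi \<alpha> (fourier_series c) x) \<le> (\<Sum>\<^sub>\<infinity>\<xi>. cmod (c \<xi>) * gevrey_weight s \<epsilon> \<xi>) * (H ^ mi_order \<alpha> * fact (mi_order \<alpha>) powr s)"
    and "fourier_series c \<in> gevrey_step H s"
    and "gevrey_norm H s (fourier_series c) \<le> (\<Sum>\<^sub>\<infinity>\<xi>. cmod (c \<xi>) * gevrey_weight s \<epsilon> \<xi>)"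
proof -
  let ?S = "\<Sum>\<^sub>\<infinity>\<xi>. cmod (c \<xi>) * gevrey_weight s \<epsilon> \<xi>"
  have H: "H > 0" using s e by (simp add: H_def)
  show bound: "cmod (D_multi \<alpha> (fourier_series c) x) \<le> ?S * (H ^ mi_order \<alpha> * fact (mi_order \<alpha>) powr s)" for \<alpha> x
  proof -
    have le: "norm (int_vec \<xi>) ^ mi_order \<alpha> * cmod (c \<xi>) \<le> (H ^ mi_order \<alpha> * fact (mi_order \<alpha>) powr s) * (cmod (c \<xi>) * gevrey_weight s \<epsilon> \<xi>)" for \<xi>
      using mult_right_mono[OF power_le_gevrey_weight[OF s e, of \<xi> "mi_order \<alpha>"] norm_ge_zero[of "c \<xi>"]]
      unfolding H_def by (simp add: mult_ac)
    have sm': "(\<lambda>\<xi>. (H ^ mi_order \<alpha> * fact (mi_order \<alpha>) powr s) * (cmod (c \<xi>) * gevrey_weight s \<epsilon> \<xi>)) summable_on UNIV"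
      by (intro summable_on_cmult_right sm)
    have "cmod (D_multi \<alpha> (fourier_series c) x) \<le> (\<Sum>\<^sub>\<infinity>\<xi>. norm (int_vec \<xi>) ^ mi_order \<alpha> * cmod (c \<xi>))"
      by (rule norm_D_multi_fourier_series_le[OF c])
    also have "\<dots> \<le> (\<Sum>\<^sub>\<infinity>\<xi>. (H ^ mi_order \<alpha> * fact (mi_order \<alpha>) powr s) * (cmod (c \<xi>) * gevrey_weight s \<epsilon> \<xi>))"
      by (rule infsum_mono[OF summable_on_bound[OF sm'] sm']) (use le in auto)
    also have "\<dots> = ?S * (H ^ mi_order \<alpha> * fact (mi_order \<alpha>) powr s)"
      by (subst infsum_cmult_right') (rule mult.commute)
    finally show ?thesis .
  qed
  have quot: "q \<le> ?S" if "q \<in> gevrey_quotients H s (fourier_series c)" for q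
    using that bound H by (auto simp: gevrey_quotients_def pos_divide_le_eq)
  show "fourier_series c \<in> gevrey_step H s"
    using fourier_series_torus_fun[OF c] quot by (auto simp: gevrey_step_def intro: bdd_aboveI[of _ ?S])
  show "gevrey_norm H s (fourier_series c) \<le> ?S"
    unfolding gevrey_norm_def by (rule cSup_least[OF _ quot]) (auto simp: gevrey_quotients_def)
qed

lemma D_multi_0: "D_multi (\<lambda>_. 0) \<phi> = \<phi>" for \<phi> :: "real ^ 'n::finite \<Rightarrow> complex"
proof -
  obtain js where js: "D_multi (\<lambda>_::'n. 0) = foldr Dx js" "\<And>j. count_list js j = 0"
    using D_multi_list[of "\<lambda>_::'n. 0" 0] by metis
  have "js = []" using js(2)[of "hd js"] by (cases js) auto
  with js(1) show ?thesis by simp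
qed

lemma distr_of_eq_fourier_transform: "\<psi> \<in> torus_fun \<Longrightarrow> distr_of \<phi> \<psi> = fourier_transform (\<lambda>x. \<phi> x * \<psi> x) 0"
  by (simp add: distr_of_def fourier_transform_def)

lemma distr_of_distributions:
  fixes \<phi> :: "real ^ 'n::finite \<Rightarrow> complex"
  assumes phi: "\<phi> \<in> torus_fun" shows "distr_of \<phi> \<in> distributions"
proof -
  obtain M where M: "\<And>x. cmod (\<phi> x) \<le> M" using torus_fun_bounded[OF phi] by blast
  have M0: "M \<ge> 0" using order.trans[OF norm_ge_zero M[of 0]] .
  note cont = torus_fun_continuous_on
  have lin: "distr_of \<phi> (\<lambda>x. a * \<psi> x + b * \<omega> x) = a * distr_of \<phi> \<psi> + b * distr_of \<phi> \<omega>"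
    if "\<psi> \<in> torus_fun" "\<omega> \<in> torus_fun" for a b \<psi> \<omega>
  proof -
    have "distr_of \<phi> (\<lambda>x. a * \<psi> x + b * \<omega> x) = fourier_transform (\<lambda>x. a * (\<phi> x * \<psi> x) + b * (\<phi> x * \<omega> x)) 0"
      using that by (simp add: distr_of_eq_fourier_transform torus_fun_lincomb algebra_simps)
    also have "\<dots> = a * distr_of \<phi> \<psi> + b * distr_of \<phi> \<omega>"
      using that by (subst fourier_transform_lincomb) (auto simp: distr_of_eq_fourier_transform intro!: continuous_on_mult cont[OF phi] cont[OF that(1)] cont[OF that(2)])
    finally show ?thesis .
  qed
  have bound: "cmod (distr_of \<phi> \<psi>) \<le> M * test_seminorm 0 \<psi>" if p: "\<psi> \<in> torus_fun" for \<psi>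
  proof -
    have "cmod (\<psi> x) \<le> test_seminorm 0 \<psi>" for x
      using norm_D_multi_le[OF p, of "\<lambda>_. 0" 0 x] by (simp add: D_multi_0)
    then show ?thesis
      unfolding distr_of_eq_fourier_transform[OF p]
      by (intro norm_fourier_transform_le continuous_intros cont phi p) (auto simp: norm_mult intro!: mult_mono M M0)
  qed
  show ?thesis
    unfolding distributions_def
  proof (intro CollectI conjI allI ballI impI)
    show "distr_of \<phi> \<psi> = 0" if "\<psi> \<notin> torus_fun" for \<psi> using that by (simp add: distr_of_def)
    show "distr_of \<phi> (\<lambda>x. \<psi> x + \<omega> x) = distr_of \<phi> \<psi> + distr_of \<phi> \<omega>"
      if "\<psi> \<in> torus_fun" "\<omega> \<in> torus_fun" for \<psi> \<omega> using lin[OF that, of 1 1] by simp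
    show "distr_of \<phi> (\<lambda>x. c * \<psi> x) = c * distr_of \<phi> \<psi>"
      if "\<psi> \<in> torus_fun" for \<psi> c using lin[OF that that, of c 0] by simp
    show "\<exists>C m. \<forall>\<psi>\<in>torus_fun. cmod (distr_of \<phi> \<psi>) \<le> C * test_seminorm m \<psi>"
      using bound by blast
  qed
qed

lemma distr_of_fourier_series:
  assumes u: "u \<in> distributions" and r: "rapid (fourier_coeff u)"
  shows "distr_of (fourier_series (fourier_coeff u)) = u"
  by (rule distribution_eqI[OF distr_of_distributions[OF fourier_series_torus_fun[OF r]] u])
     (simp add: fourier_coeff_distr_of fourier_transform_fourier_series rapid_abs_summable r)

lemma Cinf_rapid:
  fixes u :: "'n::finite distr"
  assumes u: "u \<in> distributions" and r: "rapid (fourier_coeff u)"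
  shows "u \<in> Cinf"
proof (rule CinfI)
  fix r' :: real
  obtain m where m: "r' \<le> real m" using real_arch_simple by blast
  show "u \<in> sobolev r'"
  proof (rule sobolevI_L2_set(1)[OF u])
    fix F :: "(int ^ 'n) set" assume F: "finite F"
    have s: "(\<lambda>\<xi>. cmod (fourier_coeff u \<xi>) * japanese \<xi> ^ m) summable_on UNIV" using r by (simp add: rapid_def)
    have "L2_set (sobolev_coeff r' u) F \<le> (\<Sum>\<xi>\<in>F. sobolev_coeff r' u \<xi>)"
      by (rule L2_set_le_sum) simp
    also have "\<dots> \<le> (\<Sum>\<xi>\<in>F. cmod (fourier_coeff u \<xi>) * japanese \<xi> ^ m)"
    proof (intro sum_mono)
      fix \<xi> :: "int ^ 'n"
      have "japanese \<xi> powr r' \<le> japanese \<xi> powr (real m)" by (rule powr_mono[OF m japanese_ge_1])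
      then show "sobolev_coeff r' u \<xi> \<le> cmod (fourier_coeff u \<xi>) * japanese \<xi> ^ m"
        unfolding sobolev_coeff_def by (intro mult_left_mono) (simp_all add: powr_realpow)
    qed
    also have "\<dots> \<le> (\<Sum>\<^sub>\<infinity>\<xi>. cmod (fourier_coeff u \<xi>) * japanese \<xi> ^ m)"
      by (rule finite_sum_le_infsum[OF s F]) auto
    finally show "L2_set (sobolev_coeff r' u) F \<le> (\<Sum>\<^sub>\<infinity>\<xi>. cmod (fourier_coeff u \<xi>) * japanese \<xi> ^ m)" .
  qed
qed

section \<open>Gevrey classes as decay conditions\<close>

lemma gevrey_step_distr_of:
  assumes "\<phi> \<in> gevrey_step h s" "h > 0"
  shows "distr_of \<phi> \<in> gevrey s"
proof -
  have tf: "\<phi> \<in> torus_fun" using assms by (simp add: gevrey_step_def)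
  have d: "distr_of \<phi> \<in> distributions" by (rule distr_of_distributions[OF tf])
  have "fourier_coeff (distr_of \<phi>) = fourier_transform \<phi>" by (auto simp: fourier_coeff_distr_of)
  then have "distr_of \<phi> \<in> Cinf" using Cinf_rapid[OF d] rapid_fourier_transform[OF tf] by simp
  \<comment> \<open>Adding 1 makes the constant positive, as \<open>gevrey\<close> demands, even
    when the norm is 0.\<close>
  moreover have "cmod (D_multi \<alpha> \<phi> x) \<le> (gevrey_norm h s \<phi> + 1) * h ^ mi_order \<alpha> * fact (mi_order \<alpha>) powr s" for \<alpha> x
  proof -
    have "gevrey_norm h s \<phi> * (h ^ mi_order \<alpha> * fact (mi_order \<alpha>) powr s) \<le> (gevrey_norm h s \<phi> + 1) * (h ^ mi_order \<alpha> * fact (mi_order \<alpha>) powr s)"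
      using assms(2) by (intro mult_right_mono) auto
    with gevrey_quotient_le[OF assms(1,2), of \<alpha> x] show ?thesis by (simp add: mult.assoc)
  qed
  moreover have "gevrey_norm h s \<phi> + 1 > 0" using gevrey_norm_nonneg[OF assms(1,2)] by simp
  ultimately show ?thesis using tf assms(2) unfolding gevrey_def by blast
qed

lemma gevreyE:
  assumes "u \<in> gevrey s"
  obtains \<phi> h where "\<phi> \<in> gevrey_step h s" "h > 0" "u = distr_of \<phi>"
proof -
  obtain \<phi> C h where *: "\<phi> \<in> torus_fun" "u = distr_of \<phi>" "h > 0"
    "\<And>\<alpha> x. cmod (D_multi \<alpha> \<phi> x) \<le> C * h ^ mi_order \<alpha> * fact (mi_order \<alpha>) powr s"
    using assms unfolding gevrey_def by blast
  have "q \<le> C" if "q \<in> gevrey_quotients h s \<phi>" for q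
    using that *(3,4) by (auto simp: gevrey_quotients_def pos_divide_le_eq mult.assoc)
  then have "\<phi> \<in> gevrey_step h s" using *(1) by (auto simp: gevrey_step_def intro: bdd_aboveI[of _ C])
  with that *(2,3) show thesis by blast
qed

lemma gevrey_distributions: "u \<in> gevrey s \<Longrightarrow> u \<in> distributions"
  unfolding gevrey_def using distr_of_distributions by blast

lemma gevrey_decay:
  fixes u :: "'n::finite distr"
  assumes "u \<in> gevrey s" "s \<ge> 1"
  shows "\<exists>\<epsilon>>0. \<exists>C. \<forall>\<xi>. cmod (fourier_coeff u \<xi>) \<le> C * gevrey_weight s (- \<epsilon>) \<xi>"
proof -
  obtain \<phi> h where *: "\<phi> \<in> gevrey_step h s" "h > 0" "u = distr_of \<phi>" using gevreyE[OF assms(1)] .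
  show ?thesis
    using fourier_transform_gevrey_decay[OF *(1,2) assms(2)] gevrey_rate_pos[OF _ assms(2) *(2), of "CARD('n)"]
    unfolding *(3) fourier_coeff_distr_of by (metis zero_less_card_finite)
qed

lemma summable_gevrey_product:
  fixes c :: "int ^ 'n::finite \<Rightarrow> complex"
  assumes s: "s \<ge> 1" and c: "\<And>\<xi>. cmod (c \<xi>) \<le> C * gevrey_weight s (- \<epsilon>) \<xi>" and "\<delta> < \<epsilon>"
  shows "(\<lambda>\<xi>. cmod (c \<xi>) * gevrey_weight s \<delta> \<xi>) summable_on UNIV"
proof (rule summable_on_bound)
  show "(\<lambda>\<xi> :: int ^ 'n. C * gevrey_weight s (- (\<epsilon> - \<delta>)) \<xi>) summable_on UNIV"
    by (intro summable_on_cmult_right summable_gevrey_weight s) (use assms in simp)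
  fix \<xi> :: "int ^ 'n"
  have "gevrey_weight s (- (\<epsilon> - \<delta>)) \<xi> = gevrey_weight s (- \<epsilon>) \<xi> * gevrey_weight s \<delta> \<xi>"
    by (simp add: gevrey_weight_add[symmetric])
  then show "norm (cmod (c \<xi>) * gevrey_weight s \<delta> \<xi>) \<le> C * gevrey_weight s (- (\<epsilon> - \<delta>)) \<xi>"
    using mult_right_mono[OF c[of \<xi>], of "gevrey_weight s \<delta> \<xi>"] by (simp add: mult.assoc)
qed

text \<open>The step belongs to the smaller rate epsilon/2, so that the coefficients multiplied by
  the growing weight are still summable.\<close>

lemma gevreyI_decay:
  fixes u :: "'n::finite distr"
  assumes u: "u \<in> distributions" and s: "s \<ge> 1" and e: "\<epsilon> > 0"
    and c: "\<And>\<xi>. cmod (fourier_coeff u \<xi>) \<le> C * gevrey_weight s (- \<epsilon>) \<xi>"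
  shows "u \<in> gevrey s"
proof -
  have r: "rapid (fourier_coeff u)" by (rule rapid_gevrey[OF s e c])
  have "distr_of (fourier_series (fourier_coeff u)) \<in> gevrey s"
    by (rule gevrey_step_distr_of[OF fourier_series_gevrey_step(2)[OF s, of "\<epsilon> / 2" "fourier_coeff u"]])
       (use e s in \<open>auto intro!: r summable_gevrey_product[OF s c]\<close>)
  then show ?thesis by (simp add: distr_of_fourier_series[OF u r])
qed

lemma gevrey_decay_common:
  assumes "\<And>\<xi>. cmod (fourier_coeff u \<xi>) \<le> C * gevrey_weight s (- \<epsilon>) \<xi>" "\<delta> \<le> \<epsilon>"
  shows "cmod (fourier_coeff u \<xi>) \<le> \<bar>C\<bar> * gevrey_weight s (- \<delta>) \<xi>"
proof -
  have "cmod (fourier_coeff u \<xi>) \<le> C * gevrey_weight s (- \<epsilon>) \<xi>" by (rule assms(1))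
  also have "\<dots> \<le> \<bar>C\<bar> * gevrey_weight s (- \<delta>) \<xi>"
    using assms(2) by (intro mult_mono gevrey_weight_mono) auto
  finally show ?thesis .
qed

lemma gevrey_diff:
  assumes u: "u \<in> gevrey s" and v: "v \<in> gevrey s" and s: "s \<ge> 1"
  shows "(\<lambda>\<phi>. u \<phi> - v \<phi>) \<in> gevrey s"
proof -
  obtain \<epsilon> C where e: "\<epsilon> > 0" "\<And>\<xi>. cmod (fourier_coeff u \<xi>) \<le> C * gevrey_weight s (- \<epsilon>) \<xi>"
    using gevrey_decay[OF u s] by blast
  obtain \<delta> D where d: "\<delta> > 0" "\<And>\<xi>. cmod (fourier_coeff v \<xi>) \<le> D * gevrey_weight s (- \<delta>) \<xi>"
    using gevrey_decay[OF v s] by blast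
  let ?m = "min \<epsilon> \<delta>"
  show ?thesis
  proof (rule gevreyI_decay[OF _ s, of _ ?m])
    show "(\<lambda>\<phi>. u \<phi> - v \<phi>) \<in> distributions"
      using distributions_lincomb[OF gevrey_distributions[OF u] gevrey_distributions[OF v], of 1 "-1"] by simp
    show "?m > 0" using e d by simp
    fix \<xi>
    have "cmod (fourier_coeff u \<xi> - fourier_coeff v \<xi>) \<le> \<bar>C\<bar> * gevrey_weight s (- ?m) \<xi> + \<bar>D\<bar> * gevrey_weight s (- ?m) \<xi>"
      by (rule order.trans[OF norm_triangle_ineq4 add_mono[OF gevrey_decay_common[OF e(2)] gevrey_decay_common[OF d(2)]]]) auto
    then show "cmod (fourier_coeff (\<lambda>\<phi>. u \<phi> - v \<phi>) \<xi>) \<le> (\<bar>C\<bar> + \<bar>D\<bar>) * gevrey_weight s (- ?m) \<xi>"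
      by (simp add: fourier_coeff_diff distrib_right)
  qed
qed

subsection \<open>The Gevrey topology\<close>

text \<open>Weights growing more slowly than every exp(delta |xi|^(1/s)), as in the projective
  description of a co-echelon space: each gives a seminorm that is continuous on all Banach steps at
  once.\<close>

definition admissible :: "real \<Rightarrow> (int ^ 'n \<Rightarrow> real) \<Rightarrow> bool" where
  "admissible s \<omega> \<longleftrightarrow> (\<forall>\<xi>. 0 \<le> \<omega> \<xi>) \<and> (\<forall>\<delta>>0. \<exists>C. \<forall>\<xi>. \<omega> \<xi> \<le> C * gevrey_weight s \<delta> \<xi>)"

definition weighted_sum :: "(int ^ 'n \<Rightarrow> real) \<Rightarrow> 'n::finite distr \<Rightarrow> real" where
  "weighted_sum \<omega> u = (\<Sum>\<^sub>\<infinity>\<xi>. \<omega> \<xi> * cmod (fourier_coeff u \<xi>))"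

lemma weighted_summand_le:
  fixes \<omega> :: "int ^ 'n \<Rightarrow> real"
  assumes w: "admissible s \<omega>" and e: "\<epsilon> > 0"
  shows "\<exists>C\<ge>0. \<forall>\<xi>. \<omega> \<xi> * gevrey_weight s (- \<epsilon>) \<xi> \<le> C * gevrey_weight s (- (\<epsilon> / 2)) \<xi>"
proof -
  obtain C where C: "\<And>\<xi>. \<omega> \<xi> \<le> C * gevrey_weight s (\<epsilon> / 2) \<xi>"
    using w e unfolding admissible_def by (meson half_gt_zero)
  have "0 \<le> \<omega> 0" using w by (simp add: admissible_def)
  then have "0 \<le> C * gevrey_weight s (\<epsilon> / 2) (0 :: int ^ 'n)" using C[of 0] by (rule order.trans)
  then have C0: "C \<ge> 0" by (simp add: zero_le_mult_iff gevrey_weight_def)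
  have "\<omega> \<xi> * gevrey_weight s (- \<epsilon>) \<xi> \<le> C * gevrey_weight s (- (\<epsilon> / 2)) \<xi>" for \<xi>
  proof -
    have "\<omega> \<xi> * gevrey_weight s (- \<epsilon>) \<xi> \<le> C * gevrey_weight s (\<epsilon> / 2) \<xi> * gevrey_weight s (- \<epsilon>) \<xi>"
      by (rule mult_right_mono[OF C]) simp
    then show ?thesis by (simp add: mult.assoc gevrey_weight_add[symmetric])
  qed
  with C0 show ?thesis by blast
qed

lemma weighted_sum_summable:
  fixes u :: "'n::finite distr"
  assumes w: "admissible s \<omega>" and u: "u \<in> gevrey s" and s: "s \<ge> 1"
  shows "(\<lambda>\<xi>. \<omega> \<xi> * cmod (fourier_coeff u \<xi>)) summable_on UNIV"
proof -
  obtain \<epsilon> C where e: "\<epsilon> > 0" "\<And>\<xi>. cmod (fourier_coeff u \<xi>) \<le> C * gevrey_weight s (- \<epsilon>) \<xi>"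
    using gevrey_decay[OF u s] by blast
  obtain D where D: "\<And>\<xi> :: int ^ 'n. \<omega> \<xi> * gevrey_weight s (- \<epsilon>) \<xi> \<le> D * gevrey_weight s (- (\<epsilon> / 2)) \<xi>"
    using weighted_summand_le[OF w e(1)] by blast
  have w0: "0 \<le> \<omega> \<xi>" for \<xi> using w by (simp add: admissible_def)
  show ?thesis
  proof (rule summable_on_bound)
    show "(\<lambda>\<xi> :: int ^ 'n. \<bar>C\<bar> * (D * gevrey_weight s (- (\<epsilon> / 2)) \<xi>)) summable_on UNIV"
      by (intro summable_on_cmult_right summable_gevrey_weight s) (use e in simp)
    fix \<xi> :: "int ^ 'n"
    have "\<omega> \<xi> * cmod (fourier_coeff u \<xi>) \<le> \<omega> \<xi> * (\<bar>C\<bar> * gevrey_weight s (- \<epsilon>) \<xi>)"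
      by (intro mult_left_mono gevrey_decay_common[OF e(2)] w0) simp
    also have "\<dots> = \<bar>C\<bar> * (\<omega> \<xi> * gevrey_weight s (- \<epsilon>) \<xi>)" by simp
    also have "\<dots> \<le> \<bar>C\<bar> * (D * gevrey_weight s (- (\<epsilon> / 2)) \<xi>)" by (intro mult_left_mono D) simp
    finally show "norm (\<omega> \<xi> * cmod (fourier_coeff u \<xi>)) \<le> \<bar>C\<bar> * (D * gevrey_weight s (- (\<epsilon> / 2)) \<xi>)"
      using w0[of \<xi>] by simp
  qed
qed

text \<open>On the step with constant h all coefficients decay at the rate
  \<open>gevrey_rate\<close>, which is the same for all members of the step; an admissible weight
  uses up half of it, and the rest is summable.\<close>

lemma weighted_sum_seminorm:
  fixes \<omega> :: "int ^ 'n::finite \<Rightarrow> real"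
  assumes w: "admissible s \<omega>" and s: "s \<ge> 1"
  shows "gevrey_seminorm s (weighted_sum \<omega>)"
  unfolding gevrey_seminorm_def
proof (intro conjI ballI allI impI)
  have w0: "0 \<le> \<omega> \<xi>" for \<xi> using w by (simp add: admissible_def)
  fix u v :: "'n distr" assume u: "u \<in> gevrey s" and v: "v \<in> gevrey s"
  note su = weighted_sum_summable[OF w u s] and sv = weighted_sum_summable[OF w v s]
  have le: "\<omega> \<xi> * cmod (fourier_coeff (\<lambda>\<phi>. u \<phi> + v \<phi>) \<xi>) \<le> \<omega> \<xi> * cmod (fourier_coeff u \<xi>) + \<omega> \<xi> * cmod (fourier_coeff v \<xi>)" for \<xi>
    using mult_left_mono[OF norm_triangle_ineq[of "fourier_coeff u \<xi>" "fourier_coeff v \<xi>"] w0[of \<xi>]]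
    by (simp add: fourier_coeff_def distrib_left)
  have "weighted_sum \<omega> (\<lambda>\<phi>. u \<phi> + v \<phi>) \<le> (\<Sum>\<^sub>\<infinity>\<xi>. \<omega> \<xi> * cmod (fourier_coeff u \<xi>) + \<omega> \<xi> * cmod (fourier_coeff v \<xi>))"
    unfolding weighted_sum_def
    by (rule infsum_mono[OF summable_on_bound[OF summable_on_add[OF su sv]] summable_on_add[OF su sv]]) (use le w0 in auto)
  also have "\<dots> = weighted_sum \<omega> u + weighted_sum \<omega> v"
    unfolding weighted_sum_def by (rule infsum_add[OF su sv])
  finally show "weighted_sum \<omega> (\<lambda>\<phi>. u \<phi> + v \<phi>) \<le> weighted_sum \<omega> u + weighted_sum \<omega> v" .
next
  fix c and u :: "'n distr"
  have "weighted_sum \<omega> (\<lambda>\<phi>. c * u \<phi>) = (\<Sum>\<^sub>\<infinity>\<xi>. cmod c * (\<omega> \<xi> * cmod (fourier_coeff u \<xi>)))"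
    unfolding weighted_sum_def by (intro infsum_cong) (simp add: fourier_coeff_def norm_mult)
  then show "weighted_sum \<omega> (\<lambda>\<phi>. c * u \<phi>) = cmod c * weighted_sum \<omega> u"
    by (simp add: weighted_sum_def infsum_cmult_right')
next
  fix h :: real assume h: "h > 0"
  have w0: "0 \<le> \<omega> \<xi>" for \<xi> using w by (simp add: admissible_def)
  let ?e = "gevrey_rate CARD('n) s h"
  have e: "?e > 0" by (rule gevrey_rate_pos) (use s h in auto)
  obtain D where D: "D \<ge> 0" "\<And>\<xi> :: int ^ 'n. \<omega> \<xi> * gevrey_weight s (- ?e) \<xi> \<le> D * gevrey_weight s (- (?e / 2)) \<xi>"
    using weighted_summand_le[OF w e] by blast
  let ?S = "\<Sum>\<^sub>\<infinity>\<xi> :: int ^ 'n. gevrey_weight s (- (?e / 2)) \<xi>"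
  have "weighted_sum \<omega> (distr_of \<phi>) \<le> (2 powr s * D * ?S) * gevrey_norm h s \<phi>" if phi: "\<phi> \<in> gevrey_step h s" for \<phi> :: "real ^ 'n \<Rightarrow> complex"
  proof -
    let ?G = "gevrey_norm h s \<phi>"
    have G: "?G \<ge> 0" by (rule gevrey_norm_nonneg[OF phi h])
    have sm: "(\<lambda>\<xi> :: int ^ 'n. (2 powr s * ?G * D) * gevrey_weight s (- (?e / 2)) \<xi>) summable_on UNIV"
      by (intro summable_on_cmult_right summable_gevrey_weight s) (use e in simp)
    have le: "\<omega> \<xi> * cmod (fourier_coeff (distr_of \<phi>) \<xi>) \<le> (2 powr s * ?G * D) * gevrey_weight s (- (?e / 2)) \<xi>" for \<xi>
    proof -
      have "\<omega> \<xi> * cmod (fourier_coeff (distr_of \<phi>) \<xi>) \<le> \<omega> \<xi> * (2 powr s * ?G * gevrey_weight s (- ?e) \<xi>)"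
        unfolding fourier_coeff_distr_of by (intro mult_left_mono fourier_transform_gevrey_decay phi h s w0)
      also have "\<dots> = 2 powr s * ?G * (\<omega> \<xi> * gevrey_weight s (- ?e) \<xi>)" by simp
      also have "\<dots> \<le> 2 powr s * ?G * (D * gevrey_weight s (- (?e / 2)) \<xi>)" by (intro mult_left_mono D) (simp add: G)
      finally show ?thesis by (simp add: mult.assoc)
    qed
    have "weighted_sum \<omega> (distr_of \<phi>) \<le> (\<Sum>\<^sub>\<infinity>\<xi> :: int ^ 'n. (2 powr s * ?G * D) * gevrey_weight s (- (?e / 2)) \<xi>)"
      unfolding weighted_sum_def
      by (rule infsum_mono[OF summable_on_bound[OF sm] sm]) (use le w0 in auto)
    also have "\<dots> = (2 powr s * ?G * D) * ?S" by (rule infsum_cmult_right')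
    finally show ?thesis by (simp add: mult_ac)
  qed
  then show "\<exists>C. \<forall>\<phi>\<in>gevrey_step h s. weighted_sum \<omega> (distr_of \<phi>) \<le> C * gevrey_norm h s \<phi>" by blast
qed

lemma gevrey_seminorm_minus:
  assumes "gevrey_seminorm s p" "(\<lambda>\<phi>. u \<phi> - v \<phi>) \<in> gevrey s"
  shows "p (\<lambda>\<phi>. v \<phi> - u \<phi>) = p (\<lambda>\<phi>. u \<phi> - v \<phi>)"
proof -
  have "\<forall>c. \<forall>u\<in>gevrey s. p (\<lambda>\<phi>. c * u \<phi>) = cmod c * p u"
    using assms(1) by (simp add: gevrey_seminorm_def)
  from this[rule_format, OF assms(2), of "-1"] show ?thesis by simp
qed

lemma gevrey_seminorm_self:
  assumes "gevrey_seminorm s p" "u \<in> gevrey s"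
  shows "p (\<lambda>\<phi>. u \<phi> - u \<phi>) = 0"
proof -
  have "\<forall>c. \<forall>u\<in>gevrey s. p (\<lambda>\<phi>. c * u \<phi>) = cmod c * p u"
    using assms(1) by (simp add: gevrey_seminorm_def)
  from this[rule_format, OF assms(2), of 0] show ?thesis by simp
qed

lemma gevrey_seminorm_triangle:
  assumes "gevrey_seminorm s p" "(\<lambda>\<phi>. u \<phi> - v \<phi>) \<in> gevrey s" "(\<lambda>\<phi>. v \<phi> - w \<phi>) \<in> gevrey s"
  shows "p (\<lambda>\<phi>. u \<phi> - w \<phi>) \<le> p (\<lambda>\<phi>. u \<phi> - v \<phi>) + p (\<lambda>\<phi>. v \<phi> - w \<phi>)"
proof -
  have "\<forall>u\<in>gevrey s. \<forall>v\<in>gevrey s. p (\<lambda>\<phi>. u \<phi> + v \<phi>) \<le> p u + p v"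
    using assms(1) by (simp add: gevrey_seminorm_def)
  from this[rule_format, OF assms(2,3)] show ?thesis by simp
qed

lemma gevrey_seminorm_0: "gevrey_seminorm s (\<lambda>_. 0)"
  unfolding gevrey_seminorm_def by (auto intro!: exI[of _ 0])

text \<open>The subbasic set of the zero seminorm is all of \<open>gevrey s\<close>, so the subbasis
  covers the space.\<close>

lemma gevrey_top_Union:
  "\<Union> {{v \<in> gevrey s. p (\<lambda>\<phi>. v \<phi> - u \<phi>) < e} | p u e. gevrey_seminorm s p \<and> u \<in> gevrey s \<and> e > 0} = gevrey s"
proof (intro equalityI subsetI)
  fix u assume u: "u \<in> gevrey s"
  have "{v \<in> gevrey s. (\<lambda>_. 0) (\<lambda>\<phi>. v \<phi> - u \<phi>) < (1::real)} \<in> {{v \<in> gevrey s. p (\<lambda>\<phi>. v \<phi> - u \<phi>) < e} | p u e. gevrey_seminorm s p \<and> u \<in> gevrey s \<and> e > 0}"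
    using u gevrey_seminorm_0[of s] by (intro CollectI exI[of _ "\<lambda>_. 0"] exI[of _ u] exI[of _ 1]) simp
  then show "u \<in> \<Union> {{v \<in> gevrey s. p (\<lambda>\<phi>. v \<phi> - u \<phi>) < e} | p u e. gevrey_seminorm s p \<and> u \<in> gevrey s \<and> e > 0}"
    by (rule UnionI) (use u in simp)
qed blast

lemma limitin_gevrey_topD:
  assumes lim: "limitin (gevrey_top s) f l F"
  shows "l \<in> gevrey s" "gevrey_seminorm s p \<Longrightarrow> e > 0 \<Longrightarrow> \<forall>\<^sub>F x in F. f x \<in> gevrey s \<and> p (\<lambda>\<phi>. f x \<phi> - l \<phi>) < e"
proof -
  note * = lim[unfolded gevrey_top_def limitin_topology_generated_by gevrey_top_Union]
  show l: "l \<in> gevrey s" using * by blast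
  assume p: "gevrey_seminorm s p" and e: "e > 0"
  have "l \<in> {v \<in> gevrey s. p (\<lambda>\<phi>. v \<phi> - l \<phi>) < e}" using l gevrey_seminorm_self[OF p l] e by simp
  moreover have "{v \<in> gevrey s. p (\<lambda>\<phi>. v \<phi> - l \<phi>) < e} \<in> {{v \<in> gevrey s. p (\<lambda>\<phi>. v \<phi> - u \<phi>) < e} | p u e. gevrey_seminorm s p \<and> u \<in> gevrey s \<and> e > 0}"
    using p l e by blast
  ultimately have "\<forall>\<^sub>F x in F. f x \<in> {v \<in> gevrey s. p (\<lambda>\<phi>. v \<phi> - l \<phi>) < e}" using * by blast
  then show "\<forall>\<^sub>F x in F. f x \<in> gevrey s \<and> p (\<lambda>\<phi>. f x \<phi> - l \<phi>) < e" by simp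
qed

text \<open>A subbasic neighbourhood of l may be centred at another point u; it contains the ball
  around l whose radius is the slack e - p(l - u).\<close>

lemma limitin_gevrey_topI:
  fixes l :: "'n::finite distr"
  assumes s: "s \<ge> 1" and l: "l \<in> gevrey s" and f: "\<And>x. x \<in> S \<Longrightarrow> f x \<in> gevrey s"
    and lim: "\<And>p e. gevrey_seminorm s p \<Longrightarrow> e > 0 \<Longrightarrow> \<forall>\<^sub>F x in at t within S. p (\<lambda>\<phi>. f x \<phi> - l \<phi>) < e"
  shows "limitin (gevrey_top s) f l (at t within S)"
  unfolding gevrey_top_def limitin_topology_generated_by gevrey_top_Union
proof (intro conjI l ballI impI)
  fix U :: "'n distr set" assume "U \<in> {{v \<in> gevrey s. p (\<lambda>\<phi>. v \<phi> - u \<phi>) < e} | p u e. gevrey_seminorm s p \<and> u \<in> gevrey s \<and> e > 0}"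
  then obtain p u e where U: "U = {v \<in> gevrey s. p (\<lambda>\<phi>. v \<phi> - u \<phi>) < e}" and p: "gevrey_seminorm s p" and u: "u \<in> gevrey s"
    by blast
  assume "l \<in> U"
  then have "e - p (\<lambda>\<phi>. l \<phi> - u \<phi>) > 0" by (simp add: U)
  from lim[OF p this] eventually_at_within_mem[of S t]
  show "\<forall>\<^sub>F x in at t within S. f x \<in> U"
  proof eventually_elim
    case (elim x)
    have "p (\<lambda>\<phi>. f x \<phi> - u \<phi>) \<le> p (\<lambda>\<phi>. f x \<phi> - l \<phi>) + p (\<lambda>\<phi>. l \<phi> - u \<phi>)"
      by (intro gevrey_seminorm_triangle[OF p] gevrey_diff f elim l u s)
    with elim show ?case by (simp add: U f)
  qed
qed

text \<open>A continuous seminorm along a continuous curve is a continuous function on a compact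
  interval. This is the fact that a failure of uniform decay would contradict.\<close>

lemma C0_curves_gevrey_weighted_sum_bounded:
  assumes f: "f \<in> C0_curves T (gevrey_top s)" and w: "admissible s \<omega>" and s: "s \<ge> 1"
  shows "\<exists>M. \<forall>t\<in>{0..T}. weighted_sum \<omega> (f t) \<le> M"
proof (rule continuous_on_Icc_bounded)
  let ?p = "weighted_sum \<omega>"
  have p: "gevrey_seminorm s ?p" by (rule weighted_sum_seminorm[OF w s])
  show "continuous_on {0..T} (\<lambda>t. ?p (f t))"
    unfolding continuous_on_def
  proof (intro ballI tendstoI)
    fix t and e :: real assume t: "t \<in> {0..T}" and e: "e > 0"
    note lim = C0_curvesD(2)[OF f t]
    have l: "f t \<in> gevrey s" by (rule limitin_gevrey_topD(1)[OF lim])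
    show "\<forall>\<^sub>F x in at t within {0..T}. dist (?p (f x)) (?p (f t)) < e"
      using limitin_gevrey_topD(2)[OF lim p e]
    proof eventually_elim
      case (elim x)
      then have x: "f x \<in> gevrey s" by simp
      have d: "(\<lambda>\<phi>. f x \<phi> - f t \<phi>) \<in> gevrey s" "(\<lambda>\<phi>. f t \<phi> - f x \<phi>) \<in> gevrey s" by (intro gevrey_diff x l s)+
      have "?p (f x) \<le> ?p (\<lambda>\<phi>. f x \<phi> - f t \<phi>) + ?p (f t)"
        using gevrey_seminorm_triangle[OF p d(1), of "\<lambda>_. 0"] l by simp
      moreover have "?p (f t) \<le> ?p (\<lambda>\<phi>. f t \<phi> - f x \<phi>) + ?p (f x)"
        using gevrey_seminorm_triangle[OF p d(2), of "\<lambda>_. 0"] x by simp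
      moreover have "?p (\<lambda>\<phi>. f t \<phi> - f x \<phi>) = ?p (\<lambda>\<phi>. f x \<phi> - f t \<phi>)"
        by (rule gevrey_seminorm_minus[OF p d(1)])
      ultimately show ?case using elim unfolding dist_real_def by linarith
    qed
  qed
qed

lemma weighted_sum_ge:
  assumes w: "admissible s \<omega>" and u: "u \<in> gevrey s" and s: "s \<ge> 1"
  shows "\<omega> \<xi> * cmod (fourier_coeff u \<xi>) \<le> weighted_sum \<omega> u"
proof -
  have "(\<Sum>\<xi>\<in>{\<xi>}. \<omega> \<xi> * cmod (fourier_coeff u \<xi>)) \<le> weighted_sum \<omega> u"
    unfolding weighted_sum_def
    by (rule finite_sum_le_infsum[OF weighted_sum_summable[OF w u s]]) (use w in \<open>auto simp: admissible_def\<close>)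
  then show ?thesis by simp
qed

lemma topspace_gevrey_top: "topspace (gevrey_top s) = gevrey s"
  unfolding gevrey_top_def topology_generated_by_topspace by (rule gevrey_top_Union)

text \<open>Regularity of the inductive limit: if no uniform rate existed, there would be points \<open>t\<^sub>n\<close> and frequencies
  \<open>\<xi>\<^sub>n\<close> violating the rate \<open>1/(n+1)\<close>, and a weight concentrated on these frequencies would define a continuous
  seminorm that is unbounded on the compact curve.\<close>

lemma C0_curves_gevrey_decay:
  fixes f :: "real \<Rightarrow> 'n::finite distr"
  assumes f: "f \<in> C0_curves T (gevrey_top s)" and s: "s \<ge> 1"
  shows "\<exists>\<epsilon>>0. \<exists>C. \<forall>t\<in>{0..T}. \<forall>\<xi>. cmod (fourier_coeff (f t) \<xi>) \<le> C * gevrey_weight s (- \<epsilon>) \<xi>"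
proof (rule ccontr)
  assume neg: "\<not> ?thesis"
  let ?e = "\<lambda>n. 1 / (real n + 1)"
  have "\<exists>t \<xi>. t \<in> {0..T} \<and> real n * gevrey_weight s (- ?e n) \<xi> < cmod (fourier_coeff (f t) \<xi>)" for n
  proof (rule ccontr)
    assume "\<nexists>t \<xi>. t \<in> {0..T} \<and> real n * gevrey_weight s (- ?e n) \<xi> < cmod (fourier_coeff (f t) \<xi>)"
    then have "\<forall>t\<in>{0..T}. \<forall>\<xi>. cmod (fourier_coeff (f t) \<xi>) \<le> real n * gevrey_weight s (- ?e n) \<xi>"
      by (auto simp: not_less)
    moreover have "?e n > 0" by simp
    ultimately show False using neg by blast
  qed
  then obtain tt \<xi>\<xi> where t: "\<And>n. tt n \<in> {0..T}"
    and big: "\<And>n. real n * gevrey_weight s (- ?e n) (\<xi>\<xi> n) < cmod (fourier_coeff (f (tt n)) (\<xi>\<xi> n))" by metis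
  \<comment> \<open>The sequence of frequencies may repeat values, so a supremum is taken; inserting
    0 covers the frequencies that do not occur.\<close>
  define A where "A \<xi> = insert 0 {gevrey_weight s (?e n) \<xi> | n. \<xi>\<xi> n = \<xi>}" for \<xi>
  define \<omega> where "\<omega> \<xi> = Sup (A \<xi>)" for \<xi>
  \<comment> \<open>All rates 1/(n+1) are at most 1, so the supremum is finite.\<close>
  have A_le: "a \<le> gevrey_weight s 1 \<xi>" if "a \<in> A \<xi>" for a \<xi>
    using that by (auto simp: A_def intro!: gevrey_weight_mono)
  then have bdd: "bdd_above (A \<xi>)" for \<xi> by (rule bdd_aboveI)
  have adm: "admissible s \<omega>"
    unfolding admissible_def
  proof (intro conjI allI impI)
    show "0 \<le> \<omega> \<xi>" for \<xi> unfolding \<omega>_def by (rule cSup_upper[OF _ bdd]) (simp add: A_def)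
    fix \<delta> :: real assume d: "\<delta> > 0"
    obtain n0 where n0: "?e n0 < \<delta>" using reals_Archimedean[OF d] by (auto simp: inverse_eq_divide add.commute)
    \<comment> \<open>From n0 on the rates are below delta; the finitely many earlier frequencies
      are absorbed into C.\<close>
    define C where "C = 1 + (\<Sum>n<n0. gevrey_weight s 1 (\<xi>\<xi> n))"
    have C1: "1 \<le> C" by (simp add: C_def sum_nonneg)
    have "\<omega> \<xi> \<le> C * gevrey_weight s \<delta> \<xi>" for \<xi>
      unfolding \<omega>_def
    proof (rule cSup_least)
      show "A \<xi> \<noteq> {}" by (simp add: A_def)
      fix a assume a: "a \<in> A \<xi>"
      then consider "a = 0" | n where "a = gevrey_weight s (?e n) \<xi>" "\<xi>\<xi> n = \<xi>" by (auto simp: A_def)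
      then show "a \<le> C * gevrey_weight s \<delta> \<xi>"
      proof cases
        case 1
        then show ?thesis using C1 by simp
      next
        case (2 n)
        show ?thesis
        proof (cases "n < n0")
          case True
          have "a \<le> gevrey_weight s 1 (\<xi>\<xi> n)" using A_le[OF a] 2(2) by simp
          also have "\<dots> \<le> (\<Sum>n<n0. gevrey_weight s 1 (\<xi>\<xi> n))" by (rule member_le_sum) (use True in auto)
          also have "\<dots> \<le> C * 1" by (simp add: C_def)
          also have "\<dots> \<le> C * gevrey_weight s \<delta> \<xi>" using C1 d by (intro mult_left_mono gevrey_weight_ge_1) auto
          finally show ?thesis .
        next
          case False
          then have "?e n \<le> ?e n0" by (simp add: frac_le)
          then have "a \<le> 1 * gevrey_weight s \<delta> \<xi>" unfolding 2(1) using n0 by (simp add: gevrey_weight_mono)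
          also have "\<dots> \<le> C * gevrey_weight s \<delta> \<xi>" by (rule mult_right_mono[OF C1]) simp
          finally show ?thesis .
        qed
      qed
    qed
    then show "\<exists>C. \<forall>\<xi>. \<omega> \<xi> \<le> C * gevrey_weight s \<delta> \<xi>" by blast
  qed
  obtain M where M: "\<And>t. t \<in> {0..T} \<Longrightarrow> weighted_sum \<omega> (f t) \<le> M"
    using C0_curves_gevrey_weighted_sum_bounded[OF f adm s] by blast
  obtain n where n: "M < real n" using reals_Archimedean2 by blast
  have "gevrey_weight s (?e n) (\<xi>\<xi> n) \<le> \<omega> (\<xi>\<xi> n)"
    unfolding \<omega>_def by (rule cSup_upper[OF _ bdd]) (auto simp: A_def)
  then have "gevrey_weight s (?e n) (\<xi>\<xi> n) * cmod (fourier_coeff (f (tt n)) (\<xi>\<xi> n)) \<le> \<omega> (\<xi>\<xi> n) * cmod (fourier_coeff (f (tt n)) (\<xi>\<xi> n))"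
    by (rule mult_right_mono) simp
  also have "\<dots> \<le> weighted_sum \<omega> (f (tt n))"
    by (rule weighted_sum_ge[OF adm _ s]) (use C0_curvesD(1)[OF f t] in \<open>simp add: topspace_gevrey_top\<close>)
  also have "\<dots> \<le> M" by (rule M[OF t])
  finally have "gevrey_weight s (?e n) (\<xi>\<xi> n) * cmod (fourier_coeff (f (tt n)) (\<xi>\<xi> n)) \<le> M" .
  moreover have "gevrey_weight s (?e n) (\<xi>\<xi> n) * (real n * gevrey_weight s (- ?e n) (\<xi>\<xi> n)) \<le>
      gevrey_weight s (?e n) (\<xi>\<xi> n) * cmod (fourier_coeff (f (tt n)) (\<xi>\<xi> n))"
    by (intro mult_left_mono less_imp_le[OF big]) simp
  moreover have "gevrey_weight s (?e n) (\<xi>\<xi> n) * (real n * gevrey_weight s (- ?e n) (\<xi>\<xi> n)) = real n"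
    using gevrey_weight_minus[of s "?e n" "\<xi>\<xi> n"] by (simp only: mult.left_commute[of _ "real n"] mult_1_right)
  ultimately show False using n by linarith
qed

text \<open>A common decay rate epsilon puts all differences f x - l into one Banach step, where p
  is bounded by the step norm and hence by a weighted l1 norm of the coefficients with rate
  epsilon/2. Dominated convergence then reduces convergence in the inductive limit to single
  coefficients.\<close>

lemma limitin_gevrey_dominated:
  fixes f :: "real \<Rightarrow> 'n::finite distr"
  assumes s: "s \<ge> 1" and e: "\<epsilon> > 0" and l: "l \<in> distributions" and f: "\<And>x. x \<in> S \<Longrightarrow> f x \<in> distributions"
    and fb: "\<And>x \<xi>. x \<in> S \<Longrightarrow> cmod (fourier_coeff (f x) \<xi>) \<le> C * gevrey_weight s (- \<epsilon>) \<xi>"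
    and lb: "\<And>\<xi>. cmod (fourier_coeff l \<xi>) \<le> C * gevrey_weight s (- \<epsilon>) \<xi>"
    and lim: "\<And>\<xi>. ((\<lambda>x. fourier_coeff (f x) \<xi>) \<longlongrightarrow> fourier_coeff l \<xi>) (at t within S)"
  shows "limitin (gevrey_top s) f l (at t within S)"
proof (rule limitin_gevrey_topI[OF s])
  show "l \<in> gevrey s" by (rule gevreyI_decay[OF l s e lb])
  show "f x \<in> gevrey s" if "x \<in> S" for x by (rule gevreyI_decay[OF f[OF that] s e fb[OF that]])
  fix p :: "'n distr \<Rightarrow> real" and d :: real assume p: "gevrey_seminorm s p" and d: "d > 0"
  let ?H = "(s / (\<epsilon> / 2)) powr s"
  let ?d = "\<lambda>x \<phi>. f x \<phi> - l \<phi>"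
  have e2: "\<epsilon> / 2 > 0" and H: "?H > 0" using e s by simp_all
  then obtain Cp where Cp: "\<And>\<phi>. \<phi> \<in> gevrey_step ?H s \<Longrightarrow> p (distr_of \<phi>) \<le> Cp * gevrey_norm ?H s \<phi>"
    using p unfolding gevrey_seminorm_def by blast
  have diff_le: "cmod (fourier_coeff (?d x) \<xi>) \<le> 2 * C * gevrey_weight s (- \<epsilon>) \<xi>" if "x \<in> S" for x \<xi>
    using order.trans[OF norm_triangle_ineq4 add_mono[OF fb[OF that] lb], of \<xi> \<xi>] by (simp add: fourier_coeff_diff)
  have p_le: "p (?d x) \<le> \<bar>Cp\<bar> * (\<Sum>\<^sub>\<infinity>\<xi>. cmod (fourier_coeff (?d x) \<xi>) * gevrey_weight s (\<epsilon> / 2) \<xi>)" if x: "x \<in> S" for x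
  proof -
    have dd: "?d x \<in> distributions" using distributions_lincomb[OF f[OF x] l, of 1 "-1"] by simp
    have r: "rapid (fourier_coeff (?d x))" by (rule rapid_gevrey[OF s e diff_le[OF x]])
    have sm: "(\<lambda>\<xi>. cmod (fourier_coeff (?d x) \<xi>) * gevrey_weight s (\<epsilon> / 2) \<xi>) summable_on UNIV"
      by (rule summable_gevrey_product[OF s diff_le[OF x]]) (use e in simp)
    let ?\<phi> = "fourier_series (fourier_coeff (?d x))"
    note step = fourier_series_gevrey_step[OF s e2 r sm]
    have "p (?d x) = p (distr_of ?\<phi>)" by (simp add: distr_of_fourier_series[OF dd r])
    also have "\<dots> \<le> Cp * gevrey_norm ?H s ?\<phi>" by (rule Cp[OF step(2)])
    also have "\<dots> \<le> \<bar>Cp\<bar> * gevrey_norm ?H s ?\<phi>"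
      by (intro mult_right_mono gevrey_norm_nonneg[OF step(2) H]) simp
    also have "\<dots> \<le> \<bar>Cp\<bar> * (\<Sum>\<^sub>\<infinity>\<xi>. cmod (fourier_coeff (?d x) \<xi>) * gevrey_weight s (\<epsilon> / 2) \<xi>)"
      by (intro mult_left_mono step(3)) simp
    finally show ?thesis .
  qed
  have "((\<lambda>x. \<Sum>\<^sub>\<infinity>\<xi>. cmod (fourier_coeff (?d x) \<xi>) * gevrey_weight s (\<epsilon> / 2) \<xi>) \<longlongrightarrow> 0) (at t within S)"
  proof (rule infsum_dominated_tendsto_0)
    show "(\<lambda>\<xi> :: int ^ 'n. 2 * C * gevrey_weight s (- (\<epsilon> / 2)) \<xi>) summable_on UNIV"
      by (intro summable_on_cmult_right summable_gevrey_weight s e2)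
    show "\<forall>\<^sub>F x in at t within S. \<forall>\<xi>. \<bar>cmod (fourier_coeff (?d x) \<xi>) * gevrey_weight s (\<epsilon> / 2) \<xi>\<bar> \<le> 2 * C * gevrey_weight s (- (\<epsilon> / 2)) \<xi>"
      using eventually_at_within_mem
    proof (rule eventually_mono, intro allI)
      fix x \<xi> assume x: "x \<in> S"
      have "cmod (fourier_coeff (?d x) \<xi>) * gevrey_weight s (\<epsilon> / 2) \<xi> \<le> 2 * C * gevrey_weight s (- \<epsilon>) \<xi> * gevrey_weight s (\<epsilon> / 2) \<xi>"
        by (rule mult_right_mono[OF diff_le[OF x]]) simp
      also have "\<dots> = 2 * C * gevrey_weight s (- (\<epsilon> / 2)) \<xi>"
        by (simp add: mult.assoc gevrey_weight_add[symmetric])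
      finally show "\<bar>cmod (fourier_coeff (?d x) \<xi>) * gevrey_weight s (\<epsilon> / 2) \<xi>\<bar> \<le> 2 * C * gevrey_weight s (- (\<epsilon> / 2)) \<xi>" by simp
    qed
    show "((\<lambda>x. cmod (fourier_coeff (?d x) \<xi>) * gevrey_weight s (\<epsilon> / 2) \<xi>) \<longlongrightarrow> 0) (at t within S)" for \<xi>
      unfolding fourier_coeff_diff by (intro tendsto_mult_left_zero tendsto_norm_zero LIM_zero lim)
  qed
  then have "((\<lambda>x. \<bar>Cp\<bar> * (\<Sum>\<^sub>\<infinity>\<xi>. cmod (fourier_coeff (?d x) \<xi>) * gevrey_weight s (\<epsilon> / 2) \<xi>)) \<longlongrightarrow> 0) (at t within S)"
    by (rule tendsto_mult_right_zero)
  from order_tendstoD(2)[OF this d] eventually_at_within_mem[of S t]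
  show "\<forall>\<^sub>F x in at t within S. p (?d x) < d"
    by eventually_elim (use p_le in \<open>auto intro: order.strict_trans1\<close>)
qed

lemma C0_curves_gevreyI:
  fixes u :: "real \<Rightarrow> 'n::finite distr"
  assumes s: "s \<ge> 1" and e: "\<epsilon> > 0" and ext: "u \<in> extensional {0..T}"
    and u: "\<And>t. t \<in> {0..T} \<Longrightarrow> u t \<in> distributions"
    and b: "\<And>t \<xi>. t \<in> {0..T} \<Longrightarrow> cmod (fourier_coeff (u t) \<xi>) \<le> C * gevrey_weight s (- \<epsilon>) \<xi>"
    and cont: "\<And>\<xi>. continuous_on {0..T} (\<lambda>t. fourier_coeff (u t) \<xi>)"
  shows "u \<in> C0_curves T (gevrey_top s)"
  unfolding C0_curves_iff
  by (intro conjI ballI ext limitin_gevrey_dominated[OF s e u u b b])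
     (use cont in \<open>auto simp: continuous_on_def\<close>)

lemma C0_curves_gevrey_fourier_coeff_continuous:
  fixes f :: "real \<Rightarrow> 'n::finite distr"
  assumes f: "f \<in> C0_curves T (gevrey_top s)" and s: "s \<ge> 1"
  shows "continuous_on {0..T} (\<lambda>t. fourier_coeff (f t) \<xi>)"
  unfolding continuous_on_def
proof (intro ballI tendstoI)
  fix t and e :: real assume t: "t \<in> {0..T}" and e: "e > 0"
  \<comment> \<open>The constant weight 1 is admissible, and its seminorm dominates each single
    coefficient.\<close>
  let ?w = "\<lambda>_ :: int ^ 'n. 1 :: real"
  have w: "admissible s ?w"
    unfolding admissible_def by (auto intro!: exI[of _ 1] simp: gevrey_weight_ge_1)
  note lim = C0_curvesD(2)[OF f t]
  show "\<forall>\<^sub>F x in at t within {0..T}. dist (fourier_coeff (f x) \<xi>) (fourier_coeff (f t) \<xi>) < e"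
    using limitin_gevrey_topD(2)[OF lim weighted_sum_seminorm[OF w s] e]
  proof eventually_elim
    case (elim x)
    have "(\<lambda>\<phi>. f x \<phi> - f t \<phi>) \<in> gevrey s"
      using elim limitin_gevrey_topD(1)[OF lim] by (intro gevrey_diff s) auto
    from weighted_sum_ge[OF w this s, of \<xi>] elim show ?case
      by (simp add: fourier_coeff_diff dist_norm)
  qed
qed

text \<open>Makes the Sobolev construction and the uniqueness result available for Gevrey data. The
  uniform decay rate supplies the majorant for continuity.\<close>

lemma C0_curves_gevrey_sobolev:
  fixes f :: "real \<Rightarrow> 'n::finite distr"
  assumes f: "f \<in> C0_curves T (gevrey_top s)" and s: "s \<ge> 1"
  shows "f \<in> C0_curves T (sobolev_top r)"
proof -
  obtain \<epsilon> C where e: "\<epsilon> > 0" and C: "\<And>t \<xi>. t \<in> {0..T} \<Longrightarrow> cmod (fourier_coeff (f t) \<xi>) \<le> C * gevrey_weight s (- \<epsilon>) \<xi>"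
    using C0_curves_gevrey_decay[OF f s] by blast
  define m :: "int ^ 'n \<Rightarrow> real" where "m \<xi> = \<bar>C\<bar> * gevrey_weight s (- \<epsilon>) \<xi>" for \<xi>
  obtain k where k: "r \<le> real k" using real_arch_simple by blast
  have m0: "0 \<le> m \<xi>" for \<xi> by (simp add: m_def)
  have "rapid (\<lambda>\<xi>. complex_of_real (m \<xi>))"
    by (rule rapid_gevrey[OF s e, of _ "\<bar>C\<bar>"]) (simp add: m_def norm_mult)
  then have sm: "(\<lambda>\<xi>. m \<xi> * japanese \<xi> ^ k) summable_on UNIV"
    by (simp add: rapid_def m0)
  show ?thesis
  proof (rule C0_curves_sobolevI)
    show "f \<in> extensional {0..T}" by (rule C0_curvesD(3)[OF f])
    show "f t \<in> distributions" if "t \<in> {0..T}" for t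
      using C0_curvesD(1)[OF f that] by (auto simp: topspace_gevrey_top intro: gevrey_distributions)
    show "cmod (fourier_coeff (f t) \<xi>) \<le> m \<xi>" if "t \<in> {0..T}" for t \<xi>
      unfolding m_def by (rule gevrey_decay_common[OF C[OF that]]) simp
    show "continuous_on {0..T} (\<lambda>t. fourier_coeff (f t) \<xi>)" for \<xi>
      by (rule C0_curves_gevrey_fourier_coeff_continuous[OF f s])
    fix F :: "(int ^ 'n) set" assume F: "finite F"
    have "L2_set (\<lambda>\<xi>. m \<xi> * japanese \<xi> powr r) F \<le> (\<Sum>\<xi>\<in>F. m \<xi> * japanese \<xi> powr r)"
      by (rule L2_set_le_sum) (simp add: m_def)
    also have "\<dots> \<le> (\<Sum>\<xi>\<in>F. m \<xi> * japanese \<xi> ^ k)"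
    proof (intro sum_mono mult_left_mono)
      show "japanese \<xi> powr r \<le> japanese \<xi> ^ k" for \<xi> :: "int ^ 'n"
        using powr_mono[OF k japanese_ge_1[of \<xi>]] by (simp add: powr_realpow)
    qed (simp add: m_def)
    also have "\<dots> \<le> (\<Sum>\<^sub>\<infinity>\<xi>. m \<xi> * japanese \<xi> ^ k)"
      by (rule finite_sum_le_infsum[OF sm F]) (auto simp: m_def)
    finally show "L2_set (\<lambda>\<xi>. m \<xi> * japanese \<xi> powr r) F \<le> (\<Sum>\<^sub>\<infinity>\<xi>. m \<xi> * japanese \<xi> ^ k)" .
  qed
qed

context parabolic_problem
begin

text \<open>The solution keeps the smaller of the rates of f and g. In the derivative the symbol, of
  order 2, is paid for with half of that rate, and both bounds are then stated for the halved
  rate.\<close>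

lemma solution_gevrey_bounds:
  assumes f: "f \<in> C0_curves T (gevrey_top s)" and g: "g \<in> gevrey s" and s: "s \<ge> 1"
  shows "\<exists>\<epsilon>>0. \<exists>B\<ge>0. \<forall>t\<in>{0..T}. \<forall>\<xi>.
    cmod (solution_coeff f g \<xi> t) \<le> B * gevrey_weight s (- \<epsilon>) \<xi> \<and>
    cmod (symbol \<xi> t * solution_coeff f g \<xi> t + \<i> * fourier_coeff (f t) \<xi>) \<le> B * gevrey_weight s (- \<epsilon>) \<xi>"
proof -
  have f0: "f \<in> C0_curves T (sobolev_top 0)" by (rule C0_curves_gevrey_sobolev[OF f s])
  obtain \<epsilon>\<^sub>1 C\<^sub>1 where 1: "\<epsilon>\<^sub>1 > 0" "\<And>t \<xi>. t \<in> {0..T} \<Longrightarrow> cmod (fourier_coeff (f t) \<xi>) \<le> C\<^sub>1 * gevrey_weight s (- \<epsilon>\<^sub>1) \<xi>"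
    using C0_curves_gevrey_decay[OF f s] by blast
  obtain \<epsilon>\<^sub>2 C\<^sub>2 where 2: "\<epsilon>\<^sub>2 > 0" "\<And>\<xi>. cmod (fourier_coeff g \<xi>) \<le> C\<^sub>2 * gevrey_weight s (- \<epsilon>\<^sub>2) \<xi>"
    using gevrey_decay[OF g s] by blast
  define \<epsilon> where "\<epsilon> = min \<epsilon>\<^sub>1 \<epsilon>\<^sub>2"
  have e: "\<epsilon> > 0" "\<epsilon> / 2 > 0" using 1 2 by (simp_all add: \<epsilon>_def)
  have fb: "cmod (fourier_coeff (f t) \<xi>) \<le> \<bar>C\<^sub>1\<bar> * gevrey_weight s (- \<epsilon>) \<xi>" if "t \<in> {0..T}" for t \<xi>
    by (rule gevrey_decay_common[OF 1(2)[OF that]]) (simp add: \<epsilon>_def)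
  have gb: "cmod (fourier_coeff g \<xi>) \<le> \<bar>C\<^sub>2\<bar> * gevrey_weight s (- \<epsilon>) \<xi>" for \<xi>
    by (rule gevrey_decay_common[OF 2(2)]) (simp add: \<epsilon>_def)
  obtain K where K: "K \<ge> 0" "\<And>\<xi> t. t \<in> {0..T} \<Longrightarrow> cmod (solution_coeff f g \<xi> t) \<le>
     K * (cmod (fourier_coeff g \<xi>) + integral {0..T} (\<lambda>s. cmod (fourier_coeff (f s) \<xi>)))"
    using solution_coeff_bound[OF f0] by blast
  define B where "B = K * (\<bar>C\<^sub>2\<bar> + T * \<bar>C\<^sub>1\<bar>)"
  have B0: "B \<ge> 0" using K T_pos by (simp add: B_def)
  have sb: "cmod (solution_coeff f g \<xi> t) \<le> B * gevrey_weight s (- \<epsilon>) \<xi>" if t: "t \<in> {0..T}" for t \<xi>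
  proof -
    have "integral {0..T} (\<lambda>s. cmod (fourier_coeff (f s) \<xi>)) \<le> integral {0..T} (\<lambda>_. \<bar>C\<^sub>1\<bar> * gevrey_weight s (- \<epsilon>) \<xi>)"
      by (intro integral_le integrable_continuous_interval continuous_intros
          C0_curves_fourier_coeff_continuous[OF f0] fb)
    also have "\<dots> = T * (\<bar>C\<^sub>1\<bar> * gevrey_weight s (- \<epsilon>) \<xi>)" using T_pos by simp
    finally have "K * (cmod (fourier_coeff g \<xi>) + integral {0..T} (\<lambda>s. cmod (fourier_coeff (f s) \<xi>)))
      \<le> K * (\<bar>C\<^sub>2\<bar> * gevrey_weight s (- \<epsilon>) \<xi> + T * (\<bar>C\<^sub>1\<bar> * gevrey_weight s (- \<epsilon>) \<xi>))"
      by (intro mult_left_mono add_mono gb K)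
    also have "\<dots> = B * gevrey_weight s (- \<epsilon>) \<xi>" by (simp add: B_def algebra_simps)
    finally show ?thesis using K(2)[OF t] by (rule order.trans[rotated])
  qed
  obtain M where M: "M \<ge> 0" "\<And>t \<xi>. t \<in> {0..T} \<Longrightarrow> cmod (symbol \<xi> t) \<le> M * (japanese \<xi>)\<^sup>2"
    using symbol_bound by blast
  obtain D where D: "D \<ge> 0" "\<And>\<xi> :: int ^ 'n. (japanese \<xi>)\<^sup>2 \<le> D * gevrey_weight s (\<epsilon> / 2) \<xi>"
    using japanese_power_le_gevrey_weight[OF s e(2)] by blast
  have half: "gevrey_weight s (\<epsilon> / 2) \<xi> * gevrey_weight s (- \<epsilon>) \<xi> = gevrey_weight s (- (\<epsilon> / 2)) \<xi>" for \<xi> :: "int ^ 'n"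
    by (simp add: gevrey_weight_add[symmetric])
  have wm: "gevrey_weight s (- \<epsilon>) \<xi> \<le> gevrey_weight s (- (\<epsilon> / 2)) \<xi>" for \<xi> :: "int ^ 'n"
    using e by (intro gevrey_weight_mono) simp
  have db: "cmod (symbol \<xi> t * solution_coeff f g \<xi> t + \<i> * fourier_coeff (f t) \<xi>) \<le> (M * D * B + \<bar>C\<^sub>1\<bar>) * gevrey_weight s (- (\<epsilon> / 2)) \<xi>"
    if t: "t \<in> {0..T}" for t \<xi>
  proof -
    have "cmod (symbol \<xi> t * solution_coeff f g \<xi> t) \<le> (M * (D * gevrey_weight s (\<epsilon> / 2) \<xi>)) * (B * gevrey_weight s (- \<epsilon>) \<xi>)"
      unfolding norm_mult
      by (intro mult_mono sb[OF t] order.trans[OF M(2)[OF t]] mult_left_mono D M mult_nonneg_nonneg) auto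
    also have "\<dots> = M * D * B * gevrey_weight s (- (\<epsilon> / 2)) \<xi>" by (simp add: half[symmetric])
    finally have "cmod (symbol \<xi> t * solution_coeff f g \<xi> t) \<le> M * D * B * gevrey_weight s (- (\<epsilon> / 2)) \<xi>" .
    moreover have "cmod (\<i> * fourier_coeff (f t) \<xi>) \<le> \<bar>C\<^sub>1\<bar> * gevrey_weight s (- (\<epsilon> / 2)) \<xi>"
      using order.trans[OF fb[OF t] mult_left_mono[OF wm]] by (simp add: norm_mult)
    ultimately show ?thesis
      using norm_triangle_ineq[of "symbol \<xi> t * solution_coeff f g \<xi> t" "\<i> * fourier_coeff (f t) \<xi>"]
      by (simp add: distrib_right)
  qed
  define B' where "B' = B + M * D * B + \<bar>C\<^sub>1\<bar>"
  have nn: "0 \<le> M * D * B" using M D B0 by simp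
  have "cmod (solution_coeff f g \<xi> t) \<le> B' * gevrey_weight s (- (\<epsilon> / 2)) \<xi>" if "t \<in> {0..T}" for t \<xi>
    by (rule order.trans[OF sb[OF that] mult_mono[OF _ wm]]) (use nn B0 in \<open>auto simp: B'_def\<close>)
  moreover have "cmod (symbol \<xi> t * solution_coeff f g \<xi> t + \<i> * fourier_coeff (f t) \<xi>) \<le> B' * gevrey_weight s (- (\<epsilon> / 2)) \<xi>"
    if "t \<in> {0..T}" for t \<xi>
    by (rule order.trans[OF db[OF that] mult_right_mono]) (use B0 in \<open>auto simp: B'_def\<close>)
  moreover have "B' \<ge> 0" using nn B0 by (simp add: B'_def)
  ultimately show ?thesis using e(2) by blast
qed

lemma gevrey_well_posed:
  assumes s: "s \<ge> 1" and f: "f \<in> C0_curves T (gevrey_top s)" and g: "g \<in> gevrey s"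
  shows "\<exists>!u. u \<in> C1_curves T (gevrey_top s) \<and> solves_CP T a2 a1 a0 f g u"
proof (rule ex1I[of _ "solution f g"])
  let ?u = "solution f g" and ?V = "solution_deriv f g"
  have fr: "f \<in> C0_curves T (sobolev_top r)" for r by (rule C0_curves_gevrey_sobolev[OF f s])
  have gr: "g \<in> sobolev r" for r using g by (auto simp: gevrey_def intro: Cinf_sobolev)
  obtain \<epsilon> B where e: "\<epsilon> > 0" and B0: "B \<ge> 0"
    and ub: "\<And>t \<xi>. t \<in> {0..T} \<Longrightarrow> cmod (solution_coeff f g \<xi> t) \<le> B * gevrey_weight s (- \<epsilon>) \<xi>"
    and Vb: "\<And>t \<xi>. t \<in> {0..T} \<Longrightarrow> cmod (symbol \<xi> t * solution_coeff f g \<xi> t + \<i> * fourier_coeff (f t) \<xi>) \<le> B * gevrey_weight s (- \<epsilon>) \<xi>"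
    using solution_gevrey_bounds[OF f g s] by blast
  have ud: "?u t \<in> distributions" and Vd: "?V t \<in> distributions" if "t \<in> {0..T}" for t
    using C0_curvesD(1)[OF solution_C0[OF fr gr] that] C0_curvesD(1)[OF solution_deriv_C0[OF fr gr] that] sobolev_distributions by auto
  have C0: "?u \<in> C0_curves T (gevrey_top s)"
  proof (rule C0_curves_gevreyI[OF s e _ ud _ C0_curves_fourier_coeff_continuous[OF solution_C0[OF fr gr]], of B])
    show "?u \<in> extensional {0..T}" by (simp add: solution_def)
    show "cmod (fourier_coeff (?u t) \<xi>) \<le> B * gevrey_weight s (- \<epsilon>) \<xi>" if "t \<in> {0..T}" for t \<xi>
      unfolding fourier_coeff_solution[OF that] by (rule ub[OF that])
  qed
  have C0': "?V \<in> C0_curves T (gevrey_top s)"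
  proof (rule C0_curves_gevreyI[OF s e _ Vd _ C0_curves_fourier_coeff_continuous[OF solution_deriv_C0[OF fr gr]], of B])
    show "?V \<in> extensional {0..T}" by (simp add: solution_deriv_def)
    show "cmod (fourier_coeff (?V t) \<xi>) \<le> B * gevrey_weight s (- \<epsilon>) \<xi>" if "t \<in> {0..T}" for t \<xi>
      unfolding fourier_coeff_solution_deriv[OF that] by (rule Vb[OF that])
  qed
  have "limitin (gevrey_top s) (\<lambda>\<tau> \<psi>. (?u \<tau> \<psi> - ?u t \<psi>) / of_real (\<tau> - t)) (?V t) (at t within {0..T})"
    if t: "t \<in> {0..T}" for t
  proof (rule limitin_gevrey_dominated[OF s e Vd[OF t]])
    show "cmod (fourier_coeff (?V t) \<xi>) \<le> B * gevrey_weight s (- \<epsilon>) \<xi>" for \<xi>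
      unfolding fourier_coeff_solution_deriv[OF t] by (rule Vb[OF t])
    show "((\<lambda>\<tau>. fourier_coeff (\<lambda>\<psi>. (?u \<tau> \<psi> - ?u t \<psi>) / of_real (\<tau> - t)) \<xi>) \<longlongrightarrow> fourier_coeff (?V t) \<xi>) (at t within {0..T})" for \<xi>
      using limitin_sobolev_eval[OF solution_quotient[OF fr gr t] cexp_torus_fun] by (simp add: fourier_coeff_eq)
    fix x assume x: "x \<in> {0..T}"
    show "(\<lambda>\<psi>. (?u x \<psi> - ?u t \<psi>) / of_real (x - t)) \<in> distributions"
      using distributions_lincomb[OF ud[OF x] ud[OF t], of "1 / of_real (x - t)" "- (1 / of_real (x - t))"]
      by (simp add: diff_divide_distrib)
    fix \<xi>
    \<comment> \<open>The mean value inequality transfers the bound for the derivative to the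
      difference quotients, which gives a majorant independent of x.\<close>
    have "norm (solution_coeff f g \<xi> x - solution_coeff f g \<xi> t) \<le> (B * gevrey_weight s (- \<epsilon>) \<xi>) * norm (x - t)"
    proof (rule differentiable_bound[OF convex_real_interval(5) _ _ x t])
      fix y assume y: "y \<in> {0..T}"
      show "(solution_coeff f g \<xi> has_derivative
          (\<lambda>h. h *\<^sub>R (symbol \<xi> y * solution_coeff f g \<xi> y + \<i> * fourier_coeff (f y) \<xi>))) (at y within {0..T})"
        using solution_coeff_derivative[OF fr y] by (simp add: has_vector_derivative_def)
      show "onorm (\<lambda>h. h *\<^sub>R (symbol \<xi> y * solution_coeff f g \<xi> y + \<i> * fourier_coeff (f y) \<xi>)) \<le> B * gevrey_weight s (- \<epsilon>) \<xi>"
      proof (rule onorm_le)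
        show "norm (h *\<^sub>R (symbol \<xi> y * solution_coeff f g \<xi> y + \<i> * fourier_coeff (f y) \<xi>)) \<le> (B * gevrey_weight s (- \<epsilon>) \<xi>) * norm h" for h
          using mult_left_mono[OF Vb[OF y, of \<xi>] abs_ge_zero[of h]] by (simp add: mult.commute)
      qed
    qed
    moreover have "fourier_coeff (\<lambda>\<psi>. (?u x \<psi> - ?u t \<psi>) / of_real (x - t)) \<xi>
        = (solution_coeff f g \<xi> x - solution_coeff f g \<xi> t) / of_real (x - t)"
      using fourier_coeff_solution[OF x, of f g \<xi>] fourier_coeff_solution[OF t, of f g \<xi>] by (simp add: fourier_coeff_def)
    \<comment> \<open>At x = t the quotient is 0, because division by 0 yields 0, and the bound
      holds since B is nonnegative.\<close>
    ultimately show "cmod (fourier_coeff (\<lambda>\<psi>. (?u x \<psi> - ?u t \<psi>) / of_real (x - t)) \<xi>) \<le> B * gevrey_weight s (- \<epsilon>) \<xi>"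
      using B0 by (cases "x = t") (simp_all add: norm_divide pos_divide_le_eq flip: of_real_diff)
  qed
  then show "?u \<in> C1_curves T (gevrey_top s) \<and> solves_CP T a2 a1 a0 f g ?u"
    by (intro conjI C1_curvesI[OF C0 C0'] solution_solves_CP[OF fr gr])
  show "u = ?u" if "u \<in> C1_curves T (gevrey_top s) \<and> solves_CP T a2 a1 a0 f g u" for u
    using solves_CP_unique[OF conjunct2[OF that] solution_solves_CP[OF fr gr] fr] .
qed

end

theorem corollary6p3:
  fixes T :: real
    and a2 a0 :: "real \<Rightarrow> complex"
    and a1 :: "'n::finite \<Rightarrow> real \<Rightarrow> complex"
  assumes "T > 0"
    and "continuous_on {0..T} a2"
    and "\<And>j. continuous_on {0..T} (a1 j)"
    and "continuous_on {0..T} a0"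
    and "\<And>t. t \<in> {0..T} \<Longrightarrow> Im (a2 t) < 0"
  shows
    "(\<forall>r. \<forall>f\<in>C0_curves T (sobolev_top r). \<forall>g\<in>sobolev r.
        \<exists>!u. u \<in> C0_curves T (sobolev_top r) \<inter> C1_curves T (sobolev_top (r - 2)) \<and>
             solves_CP T a2 a1 a0 f g u) \<and>
     (\<forall>f\<in>C0_curves T Cinf_top. \<forall>g\<in>Cinf.
        \<exists>!u. u \<in> C1_curves T Cinf_top \<and> solves_CP T a2 a1 a0 f g u) \<and>
     (\<forall>s\<ge>1. \<forall>f\<in>C0_curves T (gevrey_top s). \<forall>g\<in>gevrey s.
        \<exists>!u. u \<in> C1_curves T (gevrey_top s) \<and> solves_CP T a2 a1 a0 f g u)"
proof -
  interpret parabolic_problem T a2 a0 a1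
    by unfold_locales (fact assms)+
  show ?thesis
    using sobolev_well_posed Cinf_well_posed gevrey_well_posed by blast
qed

end
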